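(* Let $n\ge 1$ and $0\le\alpha<n$, and let $\sigma$ and $\omega$ be locally finite positive Borel measures on $\mathbb{R}^n$ with no common point masses (i.e. $\sigma(\{p\})\,\omega(\{p\})=0$ for every $p\in\mathbb{R}^n$). Let $\mathbf{R}^{\alpha,n}$ be the vector of $\alpha$-fractional Riesz transforms on $\mathbb{R}^n$, and let $\mathfrak{T}_{\mathbf{R}^{\alpha,n}}$, $\mathfrak{T}^{\ast}_{\mathbf{R}^{\alpha,n}}$ be the cube testing constants formed with the tangent line truncations of $\mathbf{R}^{\alpha,n}$. If at least one of the measures $\sigma$ and $\omega$ is supported on a line in $\mathbb{R}^n$, then the energy constants satisfy $$\mathcal{E}_\alpha\le C\left(\sqrt{\mathcal{A}_2^{\alpha}}+\mathfrak{T}_{\mathbf{R}^{\alpha,n}}\right)\quad\text{and}\quad \mathcal{E}_\alpha^{\ast}\le C\left(\sqrt{\mathcal{A}_2^{\alpha,\ast}}+\mathfrak{T}^{\ast}_{\mathbf{R}^{\alpha,n}}\right),$$ where the constant $C$ depends only on $n$, $\alpha$ and the fixed parameters $\gamma,\varepsilon,\mathbf{r}$ in the definition of the energy constants, and not on $\sigma$, $\omega$ or the line.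
   Context: All constants below take values in $[0,\infty]$; suprema of quotients are over cubes for which the denominator is positive. $|E|$ is Lebesgue measure, $|E|_\mu=\mu(E)$, so a cube $Q$ has side length $|Q|^{1/n}$; $x_Q$ is its center, and $\gamma Q$ is the cube with the same center and $\gamma$ times the side length. $\mathcal{Q}^n$ is the collection of all cubes in $\mathbb{R}^n$ (sides parallel to the axes). A measure is supported on a line if it vanishes on the complement of some (affine) line. **Riesz transforms and truncations.** $\mathbf{R}^{\alpha,n}=\{R_\ell^{\alpha,n}\}_{\ell=1}^n$, where $R_\ell^{\alpha,n}$ is convolution with $K_\ell^{\alpha,n}(w)=c_{\alpha,n}\frac{w^\ell}{|w|^{n+1-\alpha}}=\frac{\Omega_\ell(w)}{|w|^{n-\alpha}}$, with $\Omega_\ell(w)=c_{\alpha,n}w^\ell/|w|$ ($\Omega_\ell(0)=0$), $w^\ell$ the $\ell$-th coordinate of $w$, and $c_{\alpha,n}>0$ a fixed constant. For $0<\delta<R$, the tangent line truncation has kernel $\Omega_\ell(w)\psi^\alpha_{\delta,R}(|w|)$, where $\psi^\alpha_{\delta,R}$ is continuously differentiable on an interval $(0,S)$ with $S>R$, equals $r^{\alpha-n}$ for $\delta\le r\le R$, has constant derivative on $(0,\delta)$ and on $(R,S)$, satisfies $\psi^\alpha_{\delta,R}(S)=0$, and is $0$ on $[S,\infty)$. Thus the truncated operator applied to a measure $\mu$ is $x\mapsto\int\Omega_\ell(x-y)\psi^\alpha_{\delta,R}(|x-y|)\,d\mu(y)$. **Testing constants.** With the supremum also taken over all tangent line truncations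 ($0<\delta<R$), $$\mathfrak{T}_{\mathbf{R}^{\alpha,n}}^2=\sup_{Q\in\mathcal{Q}^n}\frac1{|Q|_\sigma}\int_Q|\mathbf{R}^{\alpha,n}(\mathbf{1}_Q\sigma)|^2d\omega,\qquad (\mathfrak{T}^{\ast}_{\mathbf{R}^{\alpha,n}})^2=\sup_{Q\in\mathcal{Q}^n}\frac1{|Q|_\omega}\int_Q|(\mathbf{R}^{\alpha,n})^{\ast}(\mathbf{1}_Q\omega)|^2d\sigma,$$ where $(\mathbf{R}^{\alpha,n})^{\ast}$ has componentwise the transposed kernels (hence equals $-\mathbf{R}^{\alpha,n}$). **Poisson integrals and $\mathcal{A}_2^\alpha$.** $$\mathrm{P}^\alpha(Q,\mu)=\int\frac{|Q|^{1/n}}{(|Q|^{1/n}+|x-x_Q|)^{n+1-\alpha}}d\mu(x),\qquad \mathcal{P}^\alpha(Q,\mu)=\int\left(\frac{|Q|^{1/n}}{(|Q|^{1/n}+|x-x_Q|)^2}\right)^{n-\alpha}d\mu(x),$$ $$\mathcal{A}_2^\alpha=\sup_{Q\in\mathcal{Q}^n}\mathcal{P}^\alpha(Q,\sigma)\frac{|Q|_\omega}{|Q|^{1-\alpha/n}},\qquad \mathcal{A}_2^{\alpha,\ast}=\sup_{Q\in\mathcal{Q}^n}\mathcal{P}^\alpha(Q,\omega)\frac{|Q|_\sigma}{|Q|^{1-\alpha/n}}.$$ **Dyadic notions.** A dyadic grid $\mathcal{D}$ is a collection of half-open cubes of side lengths $2^k$, $k\in\mathbb{Z}$, such that for each $k$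 those of side length $2^k$ partition $\mathbb{R}^n$, and each cube of side length $2^k$ is a union of $2^n$ cubes of side length $2^{k-1}$ in $\mathcal{D}$ (its children). $\pi^\ell K$ is the $\ell$-fold dyadic parent of $K\in\mathcal{D}$. Fix $\gamma\ge2$, $0<\varepsilon<1$, and $\mathbf{r}\in\mathbb{N}$, with $\mathbf{r}$ sufficiently large depending on $n,\alpha,\gamma,\varepsilon$; in particular so large that $\sum_{J\in\mathcal{M}_{\mathbf{r}\text{-deep}}(K)}\mathbf{1}_{\gamma J}\le\beta\mathbf{1}_K$ for all dyadic $K$, with $\beta$ depending only on $n,\gamma,\mathbf{r},\varepsilon$, where the notation is as follows. - $J\in\mathcal{D}$ is $\mathbf{r}$-deeply embedded in $K\in\mathcal{D}$ if $J\subset K$, $|J|^{1/n}\le2^{-\mathbf{r}}|K|^{1/n}$ and $\operatorname{dist}(J,\partial K)\ge\frac12|J|^{\varepsilon/n}|K|^{(1-\varepsilon)/n}$. - $J\in\mathcal{D}$ is good if for every $I\in\mathcal{D}$ with $I\supset J$, either $|J|^{1/n}\ge2^{-\mathbf{r}}|I|^{1/n}$ or $J$ is $\mathbf{r}$-deeply embedded in $I$. - $\mathcal{M}_{\mathbf{r}\text{-deep}}(K)$ is the set of maximal dyadic subcubes of $K$ that are $\mathbf{r}$-deeply embedded in $K$. $\mathcal{M}_{\text{good}}(K)$ is the set of maximal good dyadic subcubes of $K$. - For $\ell\ge0$, $\mathcal{M}^\ell_{\mathbf{r}\text{-deep}}(K)=\{J\in\mathcal{M}_{\mathbf{r}\text{-deep}}(\pi^\ell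 K):J\subset L\text{ for some }L\in\mathcal{M}_{\mathbf{r}\text{-deep}}(K)\}$. - For a locally finite positive Borel measure $\mu$, $\triangle_J^\mu f=\sum_{J'\text{ child of }J}(\mathbb{E}^\mu_{J'}f)\mathbf{1}_{J'}-(\mathbb{E}^\mu_Jf)\mathbf{1}_J$, where $\mathbb{E}^\mu_Jf=|J|_\mu^{-1}\int_Jf\,d\mu$ (and $0$ if $|J|_\mu=0$). Put $\mathsf{P}_K^{\text{subgood},\mu}f=\sum_{J\in\mathcal{M}_{\text{good}}(K)}\sum_{J'\in\mathcal{D},\,J'\subset J}\triangle^\mu_{J'}f$, applied componentwise to the identity map $\mathbf{x}=(x_1,\dots,x_n)$ on $\mathbb{R}^n$. Equivalently $\|\mathsf{P}_K^{\text{subgood},\mu}\mathbf{x}\|^2_{L^2(\mu)}=\sum_{J\in\mathcal{M}_{\text{good}}(K)}\int_J|\mathbf{x}-\mathbb{E}_J^\mu\mathbf{x}|^2d\mu$. **Energy constants.** $$(\mathcal{E}_\alpha)^2=\sup_{\ell\ge0}\ \sup_{I=\dot\cup I_r}\frac1{|I|_\sigma}\sum_{r=1}^\infty\ \sum_{J\in\mathcal{M}^\ell_{\mathbf{r}\text{-deep}}(I_r)}\left(\frac{\mathrm{P}^\alpha(J,\mathbf{1}_{I\setminus\gamma J}\sigma)}{|J|^{1/n}}\right)^2\left\|\mathsf{P}_J^{\text{subgood},\omega}\mathbf{x}\right\|^2_{L^2(\omega)},$$ where the second supremum is over all dyadic grids $\mathcal{D}$, all $I\in\mathcal{D}$, and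 all decompositions of $I$ into pairwise disjoint $\mathcal{D}$-dyadic subcubes $\{I_r\}_{r\ge1}$. The dual constant $\mathcal{E}_\alpha^{\ast}$ is defined by the same formula with $\sigma$ and $\omega$ interchanged everywhere. *)

theory Defs
  imports "HOL-Analysis.Analysis"
begin

section \<open>Cubes\<close>

text \<open>
  A cube is encoded by its lower corner and its side length; as a point set it is half-open.
  By dominated convergence the suprema over cubes below do not change if closed or open cubes
  are used instead.
\<close>

type_synonym 'n cube = "(real ^ 'n) \<times> real"

abbreviation side :: "'n::finite cube \<Rightarrow> real" where
  "side Q \<equiv> snd Q"

definition cube_set :: "'n::finite cube \<Rightarrow> (real ^ 'n) set" where
  "cube_set Q = {x. \<forall>i. fst Q $ i \<le> x $ i \<and> x $ i < fst Q $ i + side Q}"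

definition cubes :: "'n::finite cube set" where
  "cubes = {Q. 0 < side Q}"

definition cube_center :: "'n::finite cube \<Rightarrow> real ^ 'n" where
  "cube_center Q = (\<chi> i. fst Q $ i + side Q / 2)"

definition dilate :: "real \<Rightarrow> 'n::finite cube \<Rightarrow> 'n cube" where
  "dilate t Q = ((\<chi> i. cube_center Q $ i - t * side Q / 2), t * side Q)"

definition volume :: "'n::finite cube \<Rightarrow> real" where
  "volume Q = measure lborel (cube_set Q)"


section \<open>Measures\<close>

definition locally_finite_borel :: "(real ^ 'n::finite) measure \<Rightarrow> bool" where
  "locally_finite_borel \<mu> \<longleftrightarrow>
     sets \<mu> = sets borel \<and> (\<forall>K. compact K \<longrightarrow> emeasure \<mu> K < \<infinity>)"

definition no_common_point_masses ::
    "(real ^ 'n::finite) measure \<Rightarrow> (real ^ 'n) measure \<Rightarrow> bool" where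
  "no_common_point_masses \<sigma> \<omega> \<longleftrightarrow> (\<forall>p. emeasure \<sigma> {p} * emeasure \<omega> {p} = 0)"

definition supported_on_line :: "(real ^ 'n::finite) measure \<Rightarrow> bool" where
  "supported_on_line \<mu> \<longleftrightarrow>
     (\<exists>a v. v \<noteq> 0 \<and> emeasure \<mu> (- range (\<lambda>t. a + t *\<^sub>R v)) = 0)"

definition restrict_measure :: "'a set \<Rightarrow> 'a measure \<Rightarrow> 'a measure" where
  "restrict_measure A \<mu> = density \<mu> (indicator A)"

definition ennsqrt :: "ennreal \<Rightarrow> ennreal" where
  "ennsqrt x = (if x = \<infinity> then \<infinity> else ennreal (sqrt (enn2real x)))"


section \<open>Riesz transforms, tangent line truncations and testing constants\<close>

text \<open>
  The condition \<open>isCont \<psi> S\<close> says that the tangent line at \<open>R\<close> is followed until it reaches zero;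
  it makes \<open>S\<close> and the values of \<open>\<psi>\<close> on the positive half-line unique.
\<close>

definition tangent_line_truncation ::
    "nat \<Rightarrow> real \<Rightarrow> real \<Rightarrow> real \<Rightarrow> (real \<Rightarrow> real) \<Rightarrow> bool" where
  "tangent_line_truncation n \<alpha> \<delta> R \<psi> \<longleftrightarrow>
     (\<exists>S>R. \<psi> C1_differentiable_on {0<..<S} \<and>
        (\<forall>r\<in>{\<delta>..R}. \<psi> r = r powr (\<alpha> - real n)) \<and>
        (\<exists>m. \<forall>r\<in>{0<..<\<delta>}. (\<psi> has_real_derivative m) (at r)) \<and>
        (\<exists>m. \<forall>r\<in>{R<..<S}. (\<psi> has_real_derivative m) (at r)) \<and>
        isCont \<psi> S \<and> (\<forall>r\<ge>S. \<psi> r = 0))"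

text \<open>Since \<open>0 / 0 = 0\<close>, the value at the origin is \<open>0\<close>.\<close>

definition riesz_Omega :: "real \<Rightarrow> 'n::finite \<Rightarrow> real ^ 'n \<Rightarrow> real" where
  "riesz_Omega c l w = c * (w $ l) / norm w"

definition riesz_kernel ::
    "real \<Rightarrow> (real \<Rightarrow> real) \<Rightarrow> real ^ 'n \<Rightarrow> real ^ 'n \<Rightarrow> real ^ 'n::finite" where
  "riesz_kernel c \<psi> x y = (\<chi> l. riesz_Omega c l (x - y) * \<psi> (norm (x - y)))"

definition riesz_truncations ::
    "real \<Rightarrow> real \<Rightarrow> (real ^ 'n \<Rightarrow> real ^ 'n \<Rightarrow> real ^ 'n::finite) set" where
  "riesz_truncations c \<alpha> =
     {riesz_kernel c \<psi> | \<psi> \<delta> R. 0 < \<delta> \<and> \<delta> < R \<and> tangent_line_truncation CARD('n) \<alpha> \<delta> R \<psi>}"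

definition transpose_kernel :: "('a \<Rightarrow> 'a \<Rightarrow> 'b) \<Rightarrow> 'a \<Rightarrow> 'a \<Rightarrow> 'b" where
  "transpose_kernel K x y = K y x"

definition kernel_op ::
    "(real ^ 'n \<Rightarrow> real ^ 'n \<Rightarrow> real ^ 'n) \<Rightarrow> (real ^ 'n) measure \<Rightarrow> real ^ 'n \<Rightarrow> real ^ 'n::finite" where
  "kernel_op K \<mu> x = (\<chi> l. \<integral>y. K x y $ l \<partial>\<mu>)"

definition testing_sq ::
    "(real ^ 'n \<Rightarrow> real ^ 'n \<Rightarrow> real ^ 'n) set \<Rightarrow>
     (real ^ 'n::finite) measure \<Rightarrow> (real ^ 'n) measure \<Rightarrow> ennreal" where
  "testing_sq \<K> \<sigma> \<omega> =
     (SUP K\<in>\<K>. SUP Q\<in>{Q\<in>cubes. 0 < emeasure \<sigma> (cube_set Q)}.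
        (\<integral>\<^sup>+x\<in>cube_set Q.
           ennreal ((norm (kernel_op K (restrict_measure (cube_set Q) \<sigma>) x))\<^sup>2) \<partial>\<omega>)
        / emeasure \<sigma> (cube_set Q))"

definition riesz_testing ::
    "real \<Rightarrow> real \<Rightarrow> (real ^ 'n::finite) measure \<Rightarrow> (real ^ 'n) measure \<Rightarrow> ennreal" where
  "riesz_testing c \<alpha> \<sigma> \<omega> = ennsqrt (testing_sq (riesz_truncations c \<alpha>) \<sigma> \<omega>)"

definition riesz_testing_dual ::
    "real \<Rightarrow> real \<Rightarrow> (real ^ 'n::finite) measure \<Rightarrow> (real ^ 'n) measure \<Rightarrow> ennreal" where
  "riesz_testing_dual c \<alpha> \<sigma> \<omega> =
     ennsqrt (testing_sq (transpose_kernel ` riesz_truncations c \<alpha>) \<omega> \<sigma>)"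


section \<open>Poisson integrals and the Muckenhoupt constants\<close>

definition poisson :: "real \<Rightarrow> 'n::finite cube \<Rightarrow> (real ^ 'n) measure \<Rightarrow> ennreal" where
  "poisson \<alpha> Q \<mu> =
     (\<integral>\<^sup>+x. ennreal (side Q /
        (side Q + norm (x - cube_center Q)) powr (real CARD('n) + 1 - \<alpha>)) \<partial>\<mu>)"

definition reproducing_poisson ::
    "real \<Rightarrow> 'n::finite cube \<Rightarrow> (real ^ 'n) measure \<Rightarrow> ennreal" where
  "reproducing_poisson \<alpha> Q \<mu> =
     (\<integral>\<^sup>+x. ennreal ((side Q / (side Q + norm (x - cube_center Q))\<^sup>2)
        powr (real CARD('n) - \<alpha>)) \<partial>\<mu>)"

definition muckenhoupt ::
    "real \<Rightarrow> (real ^ 'n::finite) measure \<Rightarrow> (real ^ 'n) measure \<Rightarrow> ennreal" where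
  "muckenhoupt \<alpha> \<sigma> \<omega> =
     (SUP Q\<in>cubes. reproducing_poisson \<alpha> Q \<sigma> *
        (emeasure \<omega> (cube_set Q) / ennreal (volume Q powr (1 - \<alpha> / real CARD('n)))))"

definition muckenhoupt_dual ::
    "real \<Rightarrow> (real ^ 'n::finite) measure \<Rightarrow> (real ^ 'n) measure \<Rightarrow> ennreal" where
  "muckenhoupt_dual \<alpha> \<sigma> \<omega> = muckenhoupt \<alpha> \<omega> \<sigma>"


section \<open>Dyadic grids\<close>

definition dyadic_grid :: "'n::finite cube set \<Rightarrow> bool" where
  "dyadic_grid D \<longleftrightarrow>
     (\<forall>Q\<in>D. \<exists>k::int. side Q = 2 powi k) \<and>
     (\<forall>k::int. partition_on UNIV (cube_set ` {Q\<in>D. side Q = 2 powi k})) \<and>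
     (\<forall>Q\<in>D. \<exists>S\<subseteq>D. card S = 2 ^ CARD('n) \<and> (\<forall>J\<in>S. side J = side Q / 2) \<and>
        cube_set Q = (\<Union>J\<in>S. cube_set J))"

definition children :: "'n::finite cube set \<Rightarrow> 'n cube \<Rightarrow> 'n cube set" where
  "children D J = {J'\<in>D. side J' = side J / 2 \<and> cube_set J' \<subseteq> cube_set J}"

definition dyadic_parent :: "'n::finite cube set \<Rightarrow> 'n cube \<Rightarrow> 'n cube" where
  "dyadic_parent D K = (THE Q. Q \<in> D \<and> K \<in> children D Q)"

definition deeply_embedded :: "nat \<Rightarrow> real \<Rightarrow> 'n::finite cube \<Rightarrow> 'n cube \<Rightarrow> bool" where
  "deeply_embedded r \<epsilon> J K \<longleftrightarrow>
     cube_set J \<subseteq> cube_set K \<and> side J \<le> side K / 2 ^ r \<and>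
     setdist (cube_set J) (frontier (cube_set K)) \<ge> 1/2 * side J powr \<epsilon> * side K powr (1 - \<epsilon>)"

definition good :: "'n::finite cube set \<Rightarrow> nat \<Rightarrow> real \<Rightarrow> 'n cube \<Rightarrow> bool" where
  "good D r \<epsilon> J \<longleftrightarrow>
     (\<forall>I\<in>D. cube_set J \<subseteq> cube_set I \<longrightarrow> side J \<ge> side I / 2 ^ r \<or> deeply_embedded r \<epsilon> J I)"

definition maximal_cubes :: "'n::finite cube set \<Rightarrow> 'n cube set" where
  "maximal_cubes F = {J\<in>F. \<forall>J'\<in>F. cube_set J \<subseteq> cube_set J' \<longrightarrow> J' = J}"

definition M_deep :: "'n::finite cube set \<Rightarrow> nat \<Rightarrow> real \<Rightarrow> 'n cube \<Rightarrow> 'n cube set" where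
  "M_deep D r \<epsilon> K = maximal_cubes {J\<in>D. deeply_embedded r \<epsilon> J K}"

definition M_good :: "'n::finite cube set \<Rightarrow> nat \<Rightarrow> real \<Rightarrow> 'n cube \<Rightarrow> 'n cube set" where
  "M_good D r \<epsilon> K = maximal_cubes {J\<in>D. cube_set J \<subseteq> cube_set K \<and> good D r \<epsilon> J}"

definition M_deep_level ::
    "'n::finite cube set \<Rightarrow> nat \<Rightarrow> real \<Rightarrow> nat \<Rightarrow> 'n cube \<Rightarrow> 'n cube set" where
  "M_deep_level D r \<epsilon> l K =
     {J \<in> M_deep D r \<epsilon> ((dyadic_parent D ^^ l) K). \<exists>L\<in>M_deep D r \<epsilon> K. cube_set J \<subseteq> cube_set L}"


section \<open>Haar projections\<close>

text \<open>Since \<open>inverse 0 = 0\<close>, the average over a null cube is \<open>0\<close>.\<close>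

definition cube_avg ::
    "(real ^ 'n) measure \<Rightarrow> 'n cube \<Rightarrow> (real ^ 'n \<Rightarrow> real ^ 'n) \<Rightarrow> real ^ 'n::finite" where
  "cube_avg \<mu> J f =
     (\<chi> i. inverse (measure \<mu> (cube_set J)) * (LINT x:cube_set J|\<mu>. f x $ i))"

definition haar_diff ::
    "'n cube set \<Rightarrow> (real ^ 'n) measure \<Rightarrow> 'n cube \<Rightarrow> (real ^ 'n \<Rightarrow> real ^ 'n) \<Rightarrow>
     real ^ 'n \<Rightarrow> real ^ 'n::finite" where
  "haar_diff D \<mu> J f x =
     (\<Sum>J'\<in>children D J. indicator (cube_set J') x *\<^sub>R cube_avg \<mu> J' f)
     - indicator (cube_set J) x *\<^sub>R cube_avg \<mu> J f"

definition L2_norm_sq :: "'a measure \<Rightarrow> ('a \<Rightarrow> 'b::real_normed_vector) \<Rightarrow> ennreal" where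
  "L2_norm_sq \<mu> g = (\<integral>\<^sup>+x. ennreal ((norm (g x))\<^sup>2) \<partial>\<mu>)"

text \<open>
  The sum of a family of functions, unconditionally convergent in \<open>L\<^sup>2(\<mu>)\<close>; the limit is unique
  up to \<open>\<mu>\<close>-null sets.
\<close>

definition L2_sum ::
    "'a measure \<Rightarrow> ('i \<Rightarrow> 'a \<Rightarrow> 'b::real_normed_vector) \<Rightarrow> 'i set \<Rightarrow> 'a \<Rightarrow> 'b" where
  "L2_sum \<mu> f A =
     (SOME g. g \<in> borel_measurable \<mu> \<and>
        ((\<lambda>F. L2_norm_sq \<mu> (\<lambda>x. (\<Sum>i\<in>F. f i x) - g x)) \<longlongrightarrow> 0) (finite_subsets_at_top A))"

definition subgood_proj ::
    "'n cube set \<Rightarrow> nat \<Rightarrow> real \<Rightarrow> (real ^ 'n) measure \<Rightarrow> 'n cube \<Rightarrow>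
     (real ^ 'n \<Rightarrow> real ^ 'n) \<Rightarrow> real ^ 'n \<Rightarrow> real ^ 'n::finite" where
  "subgood_proj D r \<epsilon> \<mu> K f =
     L2_sum \<mu> (\<lambda>(J, J'). haar_diff D \<mu> J' f)
       (SIGMA J:M_good D r \<epsilon> K. {J'\<in>D. cube_set J' \<subseteq> cube_set J})"


section \<open>Energy constants\<close>

definition dyadic_decomposition :: "'n::finite cube set \<Rightarrow> 'n cube \<Rightarrow> 'n cube set \<Rightarrow> bool" where
  "dyadic_decomposition D I \<I> \<longleftrightarrow>
     \<I> \<subseteq> D \<and> disjoint_family_on cube_set \<I> \<and> (\<Union>J\<in>\<I>. cube_set J) = cube_set I"

text \<open>
  A family of pairwise disjoint dyadic cubes is countable, so that a decomposition
  can be represented by the (finite or infinite) set of its members.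
\<close>

definition energy_sq ::
    "nat \<Rightarrow> real \<Rightarrow> real \<Rightarrow> real \<Rightarrow> (real ^ 'n::finite) measure \<Rightarrow> (real ^ 'n) measure \<Rightarrow> ennreal"
  where
  "energy_sq r \<epsilon> \<gamma> \<alpha> \<sigma> \<omega> =
     (SUP (l, D, I, \<I>) \<in> {(l, D, I, \<I>). dyadic_grid D \<and> I \<in> D \<and> dyadic_decomposition D I \<I> \<and>
          0 < emeasure \<sigma> (cube_set I)}.
        (\<Sum>\<^sub>\<infinity>I'\<in>\<I>. \<Sum>\<^sub>\<infinity>J\<in>M_deep_level D r \<epsilon> l I'.
           (poisson \<alpha> J (restrict_measure (cube_set I - cube_set (dilate \<gamma> J)) \<sigma>)
              / ennreal (side J))\<^sup>2 *
           L2_norm_sq \<omega> (subgood_proj D r \<epsilon> \<omega> J (\<lambda>x. x)))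
        / emeasure \<sigma> (cube_set I))"

definition energy ::
    "nat \<Rightarrow> real \<Rightarrow> real \<Rightarrow> real \<Rightarrow> (real ^ 'n::finite) measure \<Rightarrow> (real ^ 'n) measure \<Rightarrow> ennreal"
  where
  "energy r \<epsilon> \<gamma> \<alpha> \<sigma> \<omega> = ennsqrt (energy_sq r \<epsilon> \<gamma> \<alpha> \<sigma> \<omega>)"

definition energy_dual ::
    "nat \<Rightarrow> real \<Rightarrow> real \<Rightarrow> real \<Rightarrow> (real ^ 'n::finite) measure \<Rightarrow> (real ^ 'n) measure \<Rightarrow> ennreal"
  where
  "energy_dual r \<epsilon> \<gamma> \<alpha> \<sigma> \<omega> = energy r \<epsilon> \<gamma> \<alpha> \<omega> \<sigma>"

end

theory Submission
  imports Defs
begin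

text \<open>
  Transposing the Riesz kernel only changes its sign, so the second inequality is the first one with the
  two measures exchanged, and it suffices to bound the energy constant of \<open>\<sigma>\<close> and \<open>\<omega>\<close>. Let \<open>m = n - \<alpha>\<close>.
  For a cube \<open>J\<close> of the energy sum over \<open>I\<close>, the Poisson integral divided by the side of \<open>J\<close> is comparable to
  \<open>P\<^sub>J\<close>, the integral of \<open>|y - x|^(-m - 1)\<close> in \<open>d\<sigma>(y)\<close> over the points \<open>y\<close> of \<open>I\<close> outside the dilate of \<open>J\<close>, for
  any \<open>x\<close> in \<open>J\<close>. The squared norm of the Haar projection is at most the integral of \<open>|x - z|\<^sup>2\<close> over \<open>J\<close>, for any \<open>z\<close>
  (\<open>subgood_energy_le\<close>).

  Let \<open>G\<close> and \<open>H\<^sub>J\<close> be the truncated operator applied to \<open>\<sigma>\<close> restricted to \<open>I\<close> and to the dilate of \<open>J\<close>. The cubes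
  \<open>J\<close> are disjoint and their dilates stay in \<open>I\<close> and overlap boundedly (\<open>M_deep_overlap\<close>), so testing
  bounds the sum over \<open>J\<close> of the integrals of \<open>|G|\<^sup>2 + |H\<^sub>J|\<^sup>2\<close> over \<open>J\<close>. The theorem follows from this if the
  energy can be reversed, that is, if \<open>P\<^sub>J |x - z|\<close> is bounded by the sizes of \<open>G\<close> and \<open>H\<^sub>J\<close> at \<open>x\<close> and \<open>z\<close>. Now
  \<open>G - H\<^sub>J\<close> is the integral of the kernel over \<open>y\<close> outside the dilate, and for finitely many \<open>J\<close> the truncation
  can be chosen so that it is invisible there. The obstacle is cancellation between different \<open>y\<close>.

  This is where the line enters. Let \<open>e\<close> be its direction. The component along \<open>e\<close> of the kernel has a
  derivative along \<open>e\<close> which is negative and of full size as long as \<open>x - y\<close> is in a narrow cone around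
  the line (\<open>line_kernel_reversal\<close>), and so contributions of such \<open>y\<close> do not cancel.

  Suppose that \<open>\<sigma>\<close> is on the line. The perpendicular part of \<open>x - y\<close> does not depend on \<open>y\<close>, so the
  perpendicular component of \<open>G\<close> has no cancellation at all and controls \<open>P\<^sub>J\<close> times the distance of \<open>x\<close> to the
  line (\<open>perp_part_bound\<close>). If \<open>x\<close> or \<open>z\<close> is far from the line, compared with the side of \<open>J\<close>, this is all that
  is needed; if both are near, every \<open>y\<close> is seen within the cone (\<open>reversal_from_line\<close>).

  Suppose that \<open>\<omega>\<close> is on the line. Then \<open>x\<close> and \<open>z\<close> are on the line, and the points \<open>y\<close> outside the cone produce an
  error (\<open>reversal_on_line\<close>). Their distance to \<open>J\<close> is comparable to their distance to the line, so a given \<open>y\<close>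
  interacts only with cubes \<open>J\<close> inside a single cube around \<open>y\<close>. Hence the errors add up to a local
  Muckenhoupt condition (\<open>far_energy_sum\<close>).
\<close>

section \<open>The fractional Riesz kernel along a line\<close>

definition perp :: "'a::real_inner \<Rightarrow> 'a \<Rightarrow> 'a" where
  "perp e w = w - (w \<bullet> e) *\<^sub>R e"

text \<open>
  The component along \<open>e\<close> of the kernel \<open>w / |w|^(m + 1)\<close>, where \<open>m = n - \<alpha>\<close>; up to the factor \<open>c\<close> this
  is the Riesz kernel without truncation.
\<close>

definition line_kernel :: "real \<Rightarrow> 'a::real_inner \<Rightarrow> 'a \<Rightarrow> real" where
  "line_kernel m e w = (w \<bullet> e) * norm w powr (- (m + 1))"

lemma perp_add: "perp e (v + w) = perp e v + perp e w"
  by (simp add: perp_def inner_add_left algebra_simps)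

lemma perp_scale: "perp e (t *\<^sub>R w) = t *\<^sub>R perp e w"
  by (simp add: perp_def algebra_simps)

lemma perp_diff: "perp e (v - w) = perp e v - perp e w"
  by (simp add: perp_def inner_diff_left algebra_simps)

lemma perp_orth: "norm e = 1 \<Longrightarrow> perp e w \<bullet> e = 0"
  by (simp add: perp_def inner_diff_left dot_square_norm)

lemma perp_multiple: "norm e = 1 \<Longrightarrow> perp e (t *\<^sub>R e) = 0"
  by (simp add: perp_def dot_square_norm)

lemma inner_eq_perp:
  assumes "norm e = 1"
  shows "w \<bullet> h = (w \<bullet> e) * (h \<bullet> e) + perp e w \<bullet> perp e h"
proof -
  have "e \<bullet> e = 1" using assms by (simp add: dot_square_norm)
  then show ?thesis by (simp add: perp_def inner_diff_left inner_diff_right inner_commute)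
qed

lemma norm_sq_perp:
  assumes "norm e = 1"
  shows "(norm w)\<^sup>2 = (w \<bullet> e)\<^sup>2 + (norm (perp e w))\<^sup>2"
  using inner_eq_perp[OF assms, of w w] unfolding power2_norm_eq_inner by (simp add: power2_eq_square)

lemma norm_perp_le: "norm e = 1 \<Longrightarrow> norm (perp e w) \<le> norm w"
  by (rule power2_le_imp_le) (simp_all add: norm_sq_perp[of e w])

lemma abs_inner_unit_le: "norm e = 1 \<Longrightarrow> \<bar>w \<bullet> e\<bar> \<le> norm w"
  using Cauchy_Schwarz_ineq2[of w e] by simp

lemma norm_le_perp_sum: "norm e = 1 \<Longrightarrow> norm w \<le> \<bar>w \<bullet> e\<bar> + norm (perp e w)"
  using norm_triangle_ineq[of "(w \<bullet> e) *\<^sub>R e" "perp e w"] by (simp add: perp_def)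

text \<open>
  The mean value theorem on the segment from \<open>a\<close> to \<open>a + h\<close>. The estimates below need the derivative
  at a single, unknown point of the segment, so they assume size and angle bounds along all of it.
\<close>

lemma line_kernel_mean_value:
  fixes a h e :: "'a::real_inner"
  assumes "\<And>t. 0 \<le> t \<Longrightarrow> t \<le> 1 \<Longrightarrow> a + t *\<^sub>R h \<noteq> 0"
  obtains t where "0 < t" "t < 1"
    "line_kernel m e (a + h) - line_kernel m e a =
       norm (a + t *\<^sub>R h) powr (- (m + 1)) *
       (h \<bullet> e - (m + 1) * ((a + t *\<^sub>R h) \<bullet> e) * ((a + t *\<^sub>R h) \<bullet> h) / (norm (a + t *\<^sub>R h))\<^sup>2)"
proof -
  define w where "w = (\<lambda>t::real. a + t *\<^sub>R h)"
  \<comment> \<open>The squared norm is a polynomial in \<open>t\<close>, so its powers are differentiated instead of those of the norm.\<close>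
  define N where "N = (\<lambda>t. w t \<bullet> w t)"
  have Npos: "0 < N t" if "0 \<le> t" "t \<le> 1" for t
    using assms[OF that] by (simp add: N_def w_def)
  have nw: "norm (w t) powr p = N t powr (p / 2)" for t p
    by (simp add: N_def norm_eq_sqrt_inner powr_half_sqrt[symmetric] powr_powr)
  have derN: "(N has_real_derivative 2 * (w t \<bullet> h)) (at t)" for t
  proof -
    have "N = (\<lambda>t. a \<bullet> a + 2 * t * (a \<bullet> h) + t * t * (h \<bullet> h))"
      by (simp add: N_def w_def fun_eq_iff inner_add_left inner_add_right inner_commute algebra_simps)
    then show ?thesis
      by (auto intro!: derivative_eq_intros simp: w_def inner_add_left algebra_simps)
  qed
  define g where "g = (\<lambda>t. (w t \<bullet> e) * N t powr (- (m + 1) / 2))"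
  have derg: "(g has_real_derivative (h \<bullet> e) * N t powr (- (m + 1) / 2) +
      (w t \<bullet> e) * ((- (m + 1) / 2) * N t powr (- (m + 1) / 2 - 1) * (2 * (w t \<bullet> h)))) (at t)"
    if "0 \<le> t" "t \<le> 1" for t
  proof -
    have 1: "((\<lambda>t. w t \<bullet> e) has_real_derivative (h \<bullet> e)) (at t)"
      by (auto simp: w_def inner_add_left intro!: derivative_eq_intros)
    have 2: "((\<lambda>t. N t powr (- (m + 1) / 2)) has_real_derivative
        (- (m + 1) / 2) * N t powr (- (m + 1) / 2 - 1) * (2 * (w t \<bullet> h))) (at t)"
      using DERIV_fun_powr[OF derN Npos[OF that], of "- (m + 1) / 2"] by simp
    show ?thesis unfolding g_def
      using DERIV_mult[OF 1 2] by (simp add: algebra_simps)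
  qed
  obtain t where t: "0 < t" "t < 1" "g 1 - g 0 = (1 - 0) * ((h \<bullet> e) * N t powr (- (m + 1) / 2) +
      (w t \<bullet> e) * ((- (m + 1) / 2) * N t powr (- (m + 1) / 2 - 1) * (2 * (w t \<bullet> h))))"
    using MVT2[of 0 1 g, OF _ derg] by auto
  have "N t powr (- (m + 1) / 2 - 1) = N t powr (- (m + 1) / 2) / N t"
    using Npos[of t] t by (simp add: powr_diff)
  moreover have "line_kernel m e (w s) = g s" for s
    by (simp add: line_kernel_def g_def nw)
  moreover have "N t = (norm (w t))\<^sup>2" by (simp add: N_def power2_norm_eq_inner)
  moreover have "0 < N t" using Npos t by simp
  moreover have "A * P + B * ((- (m + 1) / 2) * (P / M) * (2 * C)) = P * (A - (m + 1) * B * C / M)"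
    if "0 < M" for A B C P M :: real
    using that by (simp add: field_simps)
  ultimately have "line_kernel m e (w 1) - line_kernel m e (w 0) =
       norm (w t) powr (- (m + 1)) *
       (h \<bullet> e - (m + 1) * (w t \<bullet> e) * (w t \<bullet> h) / (norm (w t))\<^sup>2)"
    using t(3) by (simp only: nw mult_1 diff_zero)
  with t show ?thesis by (intro that[of t]) (auto simp: w_def)
qed

lemma powr_neg_bounds:
  fixes T \<kappa> p u :: real
  assumes "0 < T" "0 < \<kappa>" "0 \<le> p" "T / \<kappa> \<le> u" "u \<le> \<kappa> * T"
  shows "u powr (- p) \<le> \<kappa> powr p * T powr (- p)" "\<kappa> powr (- p) * T powr (- p) \<le> u powr (- p)"
proof -
  have u: "0 < u" using assms by (smt (verit) divide_pos_pos)
  have "u powr (- p) \<le> (T / \<kappa>) powr (- p)"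
    using assms u by (intro powr_mono2') auto
  also have "\<dots> = \<kappa> powr p * T powr (- p)"
    using assms by (simp add: powr_divide powr_minus divide_simps)
  finally show "u powr (- p) \<le> \<kappa> powr p * T powr (- p)" .
  have "(\<kappa> * T) powr (- p) \<le> u powr (- p)"
    using assms u by (intro powr_mono2') auto
  then show "\<kappa> powr (- p) * T powr (- p) \<le> u powr (- p)"
    using assms by (simp add: powr_mult)
qed

lemma line_kernel_lipschitz:
  fixes a h e :: "'a::real_inner"
  assumes e: "norm e = 1" and m: "0 < m" and T: "0 < T" "0 < \<kappa>"
    and w: "\<And>t. 0 \<le> t \<Longrightarrow> t \<le> 1 \<Longrightarrow> T / \<kappa> \<le> norm (a + t *\<^sub>R h)"
           "\<And>t. 0 \<le> t \<Longrightarrow> t \<le> 1 \<Longrightarrow> norm (a + t *\<^sub>R h) \<le> \<kappa> * T"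
  shows "\<bar>line_kernel m e (a + h) - line_kernel m e a\<bar>
           \<le> (m + 2) * \<kappa> powr (m + 1) * norm h * T powr (- (m + 1))"
proof -
  have pos: "0 < norm (a + t *\<^sub>R h)" if "0 \<le> t" "t \<le> 1" for t
    using w(1)[OF that] T by (smt (verit) divide_pos_pos)
  obtain t where t: "0 < t" "t < 1" and eq:
    "line_kernel m e (a + h) - line_kernel m e a =
       norm (a + t *\<^sub>R h) powr (- (m + 1)) *
       (h \<bullet> e - (m + 1) * ((a + t *\<^sub>R h) \<bullet> e) * ((a + t *\<^sub>R h) \<bullet> h) / (norm (a + t *\<^sub>R h))\<^sup>2)"
    using line_kernel_mean_value[of a h m e] pos by (metis norm_zero order_less_irrefl)
  define w where "w = a + t *\<^sub>R h"
  have wpos: "0 < norm w" using pos t by (simp add: w_def)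
  have "\<bar>(w \<bullet> e) * (w \<bullet> h)\<bar> \<le> norm w * (norm w * norm h)"
    unfolding abs_mult
    by (intro mult_mono abs_inner_unit_le[OF e] Cauchy_Schwarz_ineq2) auto
  then have "\<bar>(w \<bullet> e) * (w \<bullet> h)\<bar> / (norm w)\<^sup>2 \<le> norm h"
    using wpos by (simp add: divide_simps power2_eq_square mult_ac)
  then have "(m + 1) * (\<bar>(w \<bullet> e) * (w \<bullet> h)\<bar> / (norm w)\<^sup>2) \<le> (m + 1) * norm h"
    using m by (intro mult_left_mono) auto
  moreover have "\<bar>(m + 1) * (w \<bullet> e) * (w \<bullet> h) / (norm w)\<^sup>2\<bar> = (m + 1) * (\<bar>(w \<bullet> e) * (w \<bullet> h)\<bar> / (norm w)\<^sup>2)"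
    using m by (simp add: abs_mult)
  moreover have "\<bar>h \<bullet> e\<bar> \<le> norm h" by (rule abs_inner_unit_le[OF e])
  moreover have "(m + 2) * norm h = (m + 1) * norm h + norm h" by (simp add: algebra_simps)
  moreover have "\<bar>a - b\<bar> \<le> z" if "x \<le> y" "\<bar>b\<bar> = x" "\<bar>a\<bar> \<le> c" "z = y + c" for a b c x y z :: real
    using that by linarith
  ultimately have 1: "\<bar>h \<bullet> e - (m + 1) * (w \<bullet> e) * (w \<bullet> h) / (norm w)\<^sup>2\<bar> \<le> (m + 2) * norm h"
    by blast
  have 2: "norm w powr (- (m + 1)) \<le> \<kappa> powr (m + 1) * T powr (- (m + 1))"
    using powr_neg_bounds(1)[of T \<kappa> "m + 1" "norm w"] T m assms(5,6)[of t] t by (simp add: w_def)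
  have "\<bar>line_kernel m e (a + h) - line_kernel m e a\<bar> =
     norm w powr (- (m + 1)) * \<bar>h \<bullet> e - (m + 1) * (w \<bullet> e) * (w \<bullet> h) / (norm w)\<^sup>2\<bar>"
    unfolding eq w_def by (simp add: abs_mult)
  also have "\<dots> \<le> (\<kappa> powr (m + 1) * T powr (- (m + 1))) * ((m + 2) * norm h)"
    by (intro mult_mono 1 2) auto
  finally show ?thesis by (simp add: mult_ac)
qed

text \<open>
  Write \<open>p\<close> and \<open>q\<close> for the component of \<open>w\<close> along \<open>e\<close> and the length of its perpendicular part. The
  derivative of the kernel along \<open>e\<close> is \<open>(q\<^sup>2 - m p\<^sup>2) / |w|^(m + 3)\<close>. Inside the cone where \<open>q\<close> is a small
  multiple of \<open>|w|\<close> it is negative and comparable to \<open>|w|^(-m - 1)\<close>, hence as large as the full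
  gradient. A perpendicular displacement costs at most its length times the same power.
\<close>

lemma line_kernel_reversal:
  fixes a h e :: "'a::real_inner"
  assumes e: "norm e = 1" and m: "0 < m" and T: "0 < T" "0 < \<kappa>"
    and w: "\<And>t. 0 \<le> t \<Longrightarrow> t \<le> 1 \<Longrightarrow> T / \<kappa> \<le> norm (a + t *\<^sub>R h)"
           "\<And>t. 0 \<le> t \<Longrightarrow> t \<le> 1 \<Longrightarrow> norm (a + t *\<^sub>R h) \<le> \<kappa> * T"
    and q: "\<And>t. 0 \<le> t \<Longrightarrow> t \<le> 1 \<Longrightarrow> norm (perp e (a + t *\<^sub>R h)) \<le> sqrt (m / (m + 2)) / \<kappa> * T"
  shows "m / (m + 2) * \<kappa> powr (- (m + 1)) * \<bar>h \<bullet> e\<bar> * T powr (- (m + 1))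
           \<le> - sgn (h \<bullet> e) * (line_kernel m e (a + h) - line_kernel m e a)
             + (m + 1) * \<kappa> powr (m + 1) * norm (perp e h) * T powr (- (m + 1))"
proof -
  have pos: "0 < norm (a + t *\<^sub>R h)" if "0 \<le> t" "t \<le> 1" for t
    using w(1)[OF that] T by (smt (verit) divide_pos_pos)
  obtain t where t: "0 < t" "t < 1" and eq:
    "line_kernel m e (a + h) - line_kernel m e a =
       norm (a + t *\<^sub>R h) powr (- (m + 1)) *
       (h \<bullet> e - (m + 1) * ((a + t *\<^sub>R h) \<bullet> e) * ((a + t *\<^sub>R h) \<bullet> h) / (norm (a + t *\<^sub>R h))\<^sup>2)"
    using line_kernel_mean_value[of a h m e] pos by (metis norm_zero order_less_irrefl)
  define w where "w = a + t *\<^sub>R h"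
  define W where "W = norm w powr (- (m + 1))"
  define p q u where "p = w \<bullet> e" and "q = norm (perp e w)" and "u = h \<bullet> e"
  have wpos: "0 < norm w" using pos t by (simp add: w_def)
  have Nsq: "(norm w)\<^sup>2 = p\<^sup>2 + q\<^sup>2" using norm_sq_perp[OF e, of w] by (simp add: p_def q_def)
  have q_le: "q \<le> sqrt (m / (m + 2)) * norm w"
  proof -
    have "q \<le> sqrt (m / (m + 2)) * (T / \<kappa>)" using assms(7)[of t] t by (simp add: q_def w_def)
    also have "\<dots> \<le> sqrt (m / (m + 2)) * norm w"
      using assms(5)[of t] t m by (intro mult_left_mono) (auto simp: w_def)
    finally show ?thesis .
  qed
  then have "q\<^sup>2 \<le> (sqrt (m / (m + 2)) * norm w)\<^sup>2" by (intro power_mono) (auto simp: q_def)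
  then have q2: "q\<^sup>2 \<le> m / (m + 2) * (norm w)\<^sup>2" using m by (simp add: power_mult_distrib)
  \<comment> \<open>Up to the factor \<open>|w|^(-m - 3)\<close> the right-hand side is minus the derivative along \<open>e\<close>.\<close>
  have p2: "m / (m + 2) * (norm w)\<^sup>2 \<le> (m + 1) * p\<^sup>2 - (norm w)\<^sup>2"
  proof -
    have "(m + 1) * p\<^sup>2 - (norm w)\<^sup>2 = m * (norm w)\<^sup>2 - (m + 1) * q\<^sup>2"
      unfolding Nsq by (simp add: algebra_simps)
    also have "\<dots> \<ge> m * (norm w)\<^sup>2 - (m + 1) * (m / (m + 2) * (norm w)\<^sup>2)"
      using q2 m by (intro diff_mono mult_left_mono) auto
    also have "m * (norm w)\<^sup>2 - (m + 1) * (m / (m + 2) * (norm w)\<^sup>2) = m / (m + 2) * (norm w)\<^sup>2"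
      using m by (simp add: field_simps)
    finally show ?thesis .
  qed
  then have "m / (m + 2) * (norm w)\<^sup>2 / (norm w)\<^sup>2 \<le> ((m + 1) * p\<^sup>2 - (norm w)\<^sup>2) / (norm w)\<^sup>2"
    by (rule divide_right_mono) simp
  then have A: "m / (m + 2) \<le> (m + 1) * p\<^sup>2 / (norm w)\<^sup>2 - 1"
    using wpos by (simp add: diff_divide_distrib)
  have B: "\<bar>p * (perp e w \<bullet> perp e h)\<bar> / (norm w)\<^sup>2 \<le> norm (perp e h)"
  proof -
    have "\<bar>p * (perp e w \<bullet> perp e h)\<bar> \<le> norm w * (norm w * norm (perp e h))"
      unfolding abs_mult p_def
      by (intro mult_mono abs_inner_unit_le[OF e]
           order_trans[OF Cauchy_Schwarz_ineq2] norm_perp_le[OF e]) auto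
    then show ?thesis using wpos by (simp add: divide_simps power2_eq_square mult_ac)
  qed
  have "w \<bullet> h = p * u + perp e w \<bullet> perp e h" unfolding p_def u_def by (rule inner_eq_perp[OF e])
  moreover have "- s * (W * (u - (m + 1) * p * (p * u + x) / N)) =
      W * ((s * u) * ((m + 1) * p\<^sup>2 / N - 1) + s * ((m + 1) * (p * x / N)))" if "0 < N" for s x N :: real
    using that by (simp add: field_simps power2_eq_square)
  moreover have "\<bar>u\<bar> = sgn u * u" by (simp add: sgn_real_def)
  moreover have "0 < (norm w)\<^sup>2" using wpos by simp
  ultimately have "- sgn u * (line_kernel m e (a + h) - line_kernel m e a) =
     W * (\<bar>u\<bar> * ((m + 1) * p\<^sup>2 / (norm w)\<^sup>2 - 1) + sgn u * ((m + 1) * (p * (perp e w \<bullet> perp e h) / (norm w)\<^sup>2)))"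
    unfolding eq w_def[symmetric] W_def[symmetric] u_def[symmetric] p_def[symmetric]
    by (simp only:)
  also have "\<dots> \<ge> W * (\<bar>u\<bar> * (m / (m + 2)) + - ((m + 1) * norm (perp e h)))"
  proof (intro mult_left_mono add_mono A)
    have "\<bar>sgn u * ((m + 1) * (p * (perp e w \<bullet> perp e h) / (norm w)\<^sup>2))\<bar>
        \<le> 1 * ((m + 1) * norm (perp e h))"
      unfolding abs_mult using B m
      by (intro mult_mono) (auto simp: abs_mult sgn_real_def)
    then show "- ((m + 1) * norm (perp e h)) \<le> sgn u * ((m + 1) * (p * (perp e w \<bullet> perp e h) / (norm w)\<^sup>2))"
      by (metis abs_le_iff minus_le_iff mult_1)
  qed (auto simp: W_def)
  finally have main: "W * (\<bar>u\<bar> * (m / (m + 2))) \<le> - sgn u * (line_kernel m e (a + h) - line_kernel m e a)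
      + W * ((m + 1) * norm (perp e h))"
    unfolding distrib_left mult_minus_right by (simp only: add_uminus_conv_diff diff_le_eq)
  have W: "W \<le> \<kappa> powr (m + 1) * T powr (- (m + 1))" "\<kappa> powr (- (m + 1)) * T powr (- (m + 1)) \<le> W"
    using powr_neg_bounds[of T \<kappa> "m + 1" "norm w"] T m assms(5,6)[of t] t by (simp_all add: w_def W_def)
  have "(\<kappa> powr (- (m + 1)) * T powr (- (m + 1))) * (\<bar>u\<bar> * (m / (m + 2))) \<le> W * (\<bar>u\<bar> * (m / (m + 2)))"
    using W(2) m by (intro mult_right_mono) auto
  also note main
  also have "- sgn u * (line_kernel m e (a + h) - line_kernel m e a) + W * ((m + 1) * norm (perp e h))
      \<le> - sgn u * (line_kernel m e (a + h) - line_kernel m e a)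
        + (\<kappa> powr (m + 1) * T powr (- (m + 1))) * ((m + 1) * norm (perp e h))"
    using W(1) m by (intro add_left_mono mult_right_mono) auto
  finally have fin: "(\<kappa> powr (- (m + 1)) * T powr (- (m + 1))) * (\<bar>u\<bar> * (m / (m + 2)))
      \<le> - sgn u * (line_kernel m e (a + h) - line_kernel m e a)
        + (\<kappa> powr (m + 1) * T powr (- (m + 1))) * ((m + 1) * norm (perp e h))" .
  have e1: "(\<kappa> powr (- (m + 1)) * T powr (- (m + 1))) * (\<bar>u\<bar> * (m / (m + 2))) =
      m / (m + 2) * \<kappa> powr (- (m + 1)) * \<bar>u\<bar> * T powr (- (m + 1))" by (simp only: mult_ac)
  have e2: "(\<kappa> powr (m + 1) * T powr (- (m + 1))) * ((m + 1) * norm (perp e h)) =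
      (m + 1) * \<kappa> powr (m + 1) * norm (perp e h) * T powr (- (m + 1))" by (simp only: mult_ac)
  show ?thesis using fin unfolding e1 e2 unfolding u_def .
qed


section \<open>Cubes\<close>

lemma card_ge_1: "1 \<le> real CARD('n::finite)"
  by (simp add: Suc_leI)

lemma mem_cube_set: "x \<in> cube_set Q \<longleftrightarrow> (\<forall>i. fst Q $ i \<le> x $ i \<and> x $ i < fst Q $ i + side Q)"
  by (simp add: cube_set_def)

text \<open>
  Distances between points are compared with side lengths only up to constants depending on the
  dimension, so the crude factor \<open>n\<close> is used in place of \<open>sqrt n\<close> throughout.
\<close>

lemma norm_le_card_mult:
  fixes x :: "real ^ 'n::finite"
  assumes "\<And>i. \<bar>x $ i\<bar> \<le> b"
  shows "norm x \<le> real CARD('n) * b"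
  using sum_bounded_above[of UNIV "\<lambda>i. \<bar>x $ i\<bar>" b] assms norm_le_l1_cart[of x] by force

lemma cube_set_measurable [measurable, simp]: "cube_set Q \<in> sets borel"
  unfolding cube_set_def by measurable

lemma convex_cube_set: "convex (cube_set Q)"
  unfolding convex_alt
proof (intro ballI allI impI)
  fix x y t assume x: "x \<in> cube_set Q" and y: "y \<in> cube_set Q" and t: "0 \<le> t \<and> t \<le> (1::real)"
  have "fst Q $ i \<le> (1 - t) * x $ i + t * y $ i \<and> (1 - t) * x $ i + t * y $ i < fst Q $ i + side Q" for i
  proof -
    have "convex {fst Q $ i ..< fst Q $ i + side Q}" by simp
    then have "(1 - t) *\<^sub>R (x $ i) + t *\<^sub>R (y $ i) \<in> {fst Q $ i ..< fst Q $ i + side Q}"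
      using x y t unfolding convex_alt mem_cube_set by auto
    then show ?thesis by simp
  qed
  then show "(1 - t) *\<^sub>R x + t *\<^sub>R y \<in> cube_set Q" by (simp add: mem_cube_set)
qed

lemma norm_diff_cube_le:
  assumes "x \<in> cube_set Q" "y \<in> cube_set (Q :: 'n::finite cube)"
  shows "norm (x - y) \<le> real CARD('n) * side Q"
proof (rule norm_le_card_mult)
  fix i
  have "fst Q $ i \<le> x $ i" "x $ i < fst Q $ i + side Q" "fst Q $ i \<le> y $ i" "y $ i < fst Q $ i + side Q"
    using assms by (auto simp: mem_cube_set)
  then show "\<bar>(x - y) $ i\<bar> \<le> side Q" by (simp add: abs_le_iff)
qed

lemma cube_center_mem: "0 < side Q \<Longrightarrow> cube_center Q \<in> cube_set Q"
  by (simp add: mem_cube_set cube_center_def)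

lemma cube_corner_mem: "0 < side Q \<Longrightarrow> fst Q \<in> cube_set Q"
  by (simp add: mem_cube_set)

lemma side_pos_of_mem: "x \<in> cube_set Q \<Longrightarrow> 0 < side Q"
  using mem_cube_set[of x Q] by (meson le_less_trans less_add_same_cancel1)

text \<open>
  Since the cubes are half-open, the upper faces are compared through a point of \<open>J\<close> whose \<open>i\<close>-th
  coordinate approaches the face.
\<close>

lemma cube_subset_iff:
  assumes "0 < side J"
  shows "cube_set J \<subseteq> cube_set L \<longleftrightarrow>
    (\<forall>i. fst L $ i \<le> fst J $ i \<and> fst J $ i + side J \<le> fst L $ i + side L)"
proof
  assume sub: "cube_set J \<subseteq> cube_set L"
  show "\<forall>i. fst L $ i \<le> fst J $ i \<and> fst J $ i + side J \<le> fst L $ i + side L"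
  proof (intro allI conjI)
    fix i
    show "fst L $ i \<le> fst J $ i" using subsetD[OF sub cube_corner_mem[OF assms]] by (simp add: mem_cube_set)
    show "fst J $ i + side J \<le> fst L $ i + side L"
    proof (rule dense_le_bounded)
      show "fst J $ i < fst J $ i + side J" using assms by simp
      fix z assume z: "fst J $ i < z" "z < fst J $ i + side J"
      have "(\<chi> j. if j = i then z else fst J $ j) \<in> cube_set J"
        using z assms by (simp add: mem_cube_set)
      then have "(\<chi> j. if j = i then z else fst J $ j) \<in> cube_set L" using sub by blast
      then show "z \<le> fst L $ i + side L" unfolding mem_cube_set by (auto dest!: spec[of _ i])
    qed
  qed
next
  assume "\<forall>i. fst L $ i \<le> fst J $ i \<and> fst J $ i + side J \<le> fst L $ i + side L"
  then have "fst L $ i \<le> fst J $ i" "fst J $ i + side J \<le> fst L $ i + side L" for i by auto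
  then show "cube_set J \<subseteq> cube_set L"
    unfolding mem_cube_set subset_iff by (meson order_trans less_le_trans)
qed

lemma cube_subset_side_le:
  assumes "0 < side J" "cube_set J \<subseteq> cube_set L"
  shows "side J \<le> side L"
  using assms cube_subset_iff[of J L] by (smt (verit, best))

lemma cube_set_inject:
  assumes "0 < side J" "0 < side L" "cube_set J = cube_set L"
  shows "J = L"
proof (rule prod_eqI)
  show "fst J = fst L" using assms cube_subset_iff[of J L] cube_subset_iff[of L J]
    by (auto simp: vec_eq_iff intro!: order_antisym)
  show "snd J = snd L" using assms cube_subset_side_le[of J L] cube_subset_side_le[of L J] by simp
qed

lemma side_dilate [simp]: "side (dilate t Q) = t * side Q"
  by (simp add: dilate_def)

lemma mem_dilate:
  "x \<in> cube_set (dilate t Q) \<longleftrightarrow>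
    (\<forall>i. cube_center Q $ i - t * side Q / 2 \<le> x $ i \<and> x $ i < cube_center Q $ i + t * side Q / 2)"
  by (simp add: mem_cube_set dilate_def algebra_simps)

lemma cube_subset_dilate:
  assumes "1 \<le> t" "0 < side Q"
  shows "cube_set Q \<subseteq> cube_set (dilate t Q)"
proof
  fix x assume x: "x \<in> cube_set Q"
  have "side Q \<le> t * side Q" using assms by simp
  then show "x \<in> cube_set (dilate t Q)"
    unfolding mem_dilate
  proof (intro allI)
    fix i
    have "fst Q $ i \<le> x $ i" "x $ i < fst Q $ i + side Q" using x by (auto simp: mem_cube_set)
    with \<open>side Q \<le> t * side Q\<close>
    show "cube_center Q $ i - t * side Q / 2 \<le> x $ i \<and> x $ i < cube_center Q $ i + t * side Q / 2"
      unfolding cube_center_def vec_lambda_beta by linarith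
  qed
qed

text \<open>
  The dilate of \<open>Q\<close> is the neighbourhood of \<open>Q\<close> of radius \<open>(t - 1) side Q / 2\<close> in the maximum norm, and
  the smaller cube has the smaller radius.
\<close>

lemma dilate_mono:
  assumes "1 \<le> t" "0 < side J" "cube_set J \<subseteq> cube_set L"
  shows "cube_set (dilate t J) \<subseteq> cube_set (dilate t L)"
proof -
  have s: "side J \<le> side L" using cube_subset_side_le assms by blast
  then have "(t - 1) * side J \<le> (t - 1) * side L" using assms by (intro mult_left_mono) auto
  then have "t * side J - side J \<le> t * side L - side L" by (simp add: algebra_simps)
  moreover have "0 < side (dilate t J)" using assms by simp
  ultimately show ?thesis using assms(3)
    unfolding cube_subset_iff[OF \<open>0 < side (dilate t J)\<close>] cube_subset_iff[OF assms(2)]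
    unfolding dilate_def cube_center_def fst_conv snd_conv vec_lambda_beta
    by (smt (verit, ccfv_threshold) field_sum_of_halves)
qed

lemma outside_dilate_component:
  assumes "y \<notin> cube_set (dilate t Q)"
  obtains i where "t * side Q / 2 \<le> \<bar>y $ i - cube_center Q $ i\<bar>"
  using assms unfolding mem_dilate by (smt (verit))

lemma center_dist_component:
  assumes "x \<in> cube_set Q"
  shows "\<bar>x $ i - cube_center Q $ i\<bar> \<le> side Q / 2"
proof -
  have "fst Q $ i \<le> x $ i" "x $ i < fst Q $ i + side Q" using assms by (auto simp: mem_cube_set)
  then show ?thesis by (simp add: cube_center_def abs_le_iff) (simp add: field_simps)
qed

lemma cube_set_cbox:
  fixes Q :: "'n::finite cube"
  shows "cube_set Q \<subseteq> cbox (fst Q) (fst Q + (\<chi> i. side Q))"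
    and "box (fst Q) (fst Q + (\<chi> i. side Q)) \<subseteq> cube_set Q"
  by (auto simp: mem_cube_set mem_box_cart less_imp_le)

lemma emeasure_cube:
  fixes Q :: "'n::finite cube"
  assumes "0 \<le> side Q"
  shows "emeasure lborel (cube_set Q) = ennreal (side Q ^ CARD('n))"
proof -
  let ?b = "fst Q + (\<chi> i. side Q)"
  have ne: "cbox (fst Q) ?b \<noteq> {}" using assms by (auto simp: interval_ne_empty_cart)
  have "emeasure lborel (cbox (fst Q) ?b) = ennreal (measure lborel (cbox (fst Q) ?b))"
    by (rule emeasure_eq_ennreal_measure) (use emeasure_lborel_cbox_finite[of "fst Q" ?b] in auto)
  also have "\<dots> = ennreal (side Q ^ CARD('n))"
    using content_cbox_cart[OF ne] by simp
  finally have c: "emeasure lborel (cbox (fst Q) ?b) = ennreal (side Q ^ CARD('n))" .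
  have le: "fst Q \<bullet> b \<le> ?b \<bullet> b" if "b \<in> Basis" for b
    using that assms by (auto simp: Basis_vec_def inner_axis)
  have "emeasure lborel (box (fst Q) ?b) = emeasure lborel (cbox (fst Q) ?b)"
    using le by (simp add: emeasure_lborel_cbox emeasure_lborel_box)
  moreover have "emeasure lborel (cube_set Q) \<le> emeasure lborel (cbox (fst Q) ?b)"
    by (intro emeasure_mono cube_set_cbox) auto
  moreover have "emeasure lborel (box (fst Q) ?b) \<le> emeasure lborel (cube_set Q)"
    by (intro emeasure_mono cube_set_cbox) auto
  ultimately show ?thesis using c by simp
qed

lemma volume_cube:
  fixes Q :: "'n::finite cube"
  assumes "0 \<le> side Q" shows "volume Q = side Q ^ CARD('n)"
  using emeasure_cube[OF assms] assms by (simp add: volume_def measure_def)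

lemma emeasure_cube_finite:
  assumes "locally_finite_borel \<mu>"
  shows "emeasure \<mu> (cube_set Q) < \<infinity>"
proof -
  have "emeasure \<mu> (cube_set Q) \<le> emeasure \<mu> (cbox (fst Q) (fst Q + (\<chi> i. side Q)))"
    using assms by (intro emeasure_mono cube_set_cbox(1)) (auto simp: locally_finite_borel_def)
  also have "\<dots> < \<infinity>" using assms by (auto simp: locally_finite_borel_def)
  finally show ?thesis .
qed

lemma locally_finite_sets: "locally_finite_borel \<mu> \<Longrightarrow> sets \<mu> = sets borel"
  by (simp add: locally_finite_borel_def)

lemma integrable_bounded_cube:
  fixes f :: "real ^ 'n::finite \<Rightarrow> 'b::{banach, second_countable_topology}"
  assumes \<mu>: "locally_finite_borel \<mu>" and "f \<in> borel_measurable borel"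
    "\<And>x. x \<in> cube_set K \<Longrightarrow> norm (f x) \<le> B" "\<And>x. x \<notin> cube_set K \<Longrightarrow> f x = 0"
  shows "integrable \<mu> f"
  by (rule integrableI_bounded_set[where A = "cube_set K" and B = B])
     (use assms emeasure_cube_finite[OF \<mu>, of K] in
       \<open>auto simp: locally_finite_sets measurable_cong_sets[OF locally_finite_sets[OF \<mu>] refl]\<close>)

lemma norm_cube_bound: "(x :: real ^ 'n::finite) \<in> cube_set K \<Longrightarrow> norm x \<le> real CARD('n) * side K + norm (cube_center K)"
  using norm_diff_cube_le[of x K "cube_center K"] cube_center_mem[of K] side_pos_of_mem[of x K]
    norm_triangle_sub[of x "cube_center K"] by auto


section \<open>Dyadic grids\<close>

lemma grid_side_pos: "dyadic_grid D \<Longrightarrow> Q \<in> D \<Longrightarrow> 0 < side Q"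
  unfolding dyadic_grid_def by fastforce

lemma grid_side_powi: "dyadic_grid D \<Longrightarrow> Q \<in> D \<Longrightarrow> \<exists>k::int. side Q = 2 powi k"
  unfolding dyadic_grid_def by blast

lemma grid_point:
  assumes "dyadic_grid D"
  obtains Q where "Q \<in> D" "side Q = 2 powi k" "x \<in> cube_set Q"
proof -
  have "\<Union> (cube_set ` {Q \<in> D. side Q = 2 powi k}) = UNIV"
    using assms unfolding dyadic_grid_def partition_on_def by blast
  then show ?thesis using that by blast
qed

lemma grid_same_side:
  assumes D: "dyadic_grid D" and Q: "Q \<in> D" "Q' \<in> D" "side Q = side Q'"
    and ne: "x \<in> cube_set Q" "x \<in> cube_set Q'"
  shows "Q = Q'"
proof -
  obtain k :: int where k: "side Q = 2 powi k" using grid_side_powi[OF D Q(1)] by blast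
  have "disjoint (cube_set ` {Q \<in> D. side Q = 2 powi k})"
    using D unfolding dyadic_grid_def partition_on_def by blast
  moreover have "cube_set Q \<in> cube_set ` {Q \<in> D. side Q = 2 powi k}"
    "cube_set Q' \<in> cube_set ` {Q \<in> D. side Q = 2 powi k}" using Q k by auto
  ultimately have "cube_set Q = cube_set Q'"
    using ne disjointD by blast
  then show ?thesis using cube_set_inject grid_side_pos[OF D] Q by blast
qed

lemma grid_children:
  assumes D: "dyadic_grid D" and Q: "Q \<in> D"
  shows "finite (children D Q)" "cube_set Q = (\<Union>J\<in>children D Q. cube_set J)"
proof -
  obtain S where S: "S \<subseteq> D" "card S = 2 ^ CARD('a)" "\<forall>J\<in>S. side J = side Q / 2"
      "cube_set Q = (\<Union>J\<in>S. cube_set J)"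
    using D Q unfolding dyadic_grid_def by blast
  have "children D Q = S"
  proof
    show "S \<subseteq> children D Q" using S by (auto simp: children_def)
    show "children D Q \<subseteq> S"
    proof
      fix J assume J: "J \<in> children D Q"
      then have "J \<in> D" by (simp add: children_def)
      then have "fst J \<in> cube_set J" using grid_side_pos[OF D, of J] by (intro cube_corner_mem)
      moreover from this J have "fst J \<in> cube_set Q" by (auto simp: children_def)
      ultimately obtain J' where "J' \<in> S" "fst J \<in> cube_set J'" "fst J \<in> cube_set J" using S by auto
      moreover from this have "J = J'"
        using J S by (intro grid_same_side[OF D, of J J' "fst J"]) (auto simp: children_def)
      ultimately show "J \<in> S" by simp
    qed
  qed
  moreover have "finite S" using S(2) by (metis card.infinite power_not_zero zero_neq_numeral)
  ultimately show "finite (children D Q)" "cube_set Q = (\<Union>J\<in>children D Q. cube_set J)" using S by auto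
qed

lemma child_unique:
  assumes D: "dyadic_grid D" and C: "C \<in> children D J" "C' \<in> children D J" "x \<in> cube_set C" "x \<in> cube_set C'"
  shows "C = C'"
  using C by (intro grid_same_side[OF D, of C C' x]) (auto simp: children_def)

lemma child_indicator_sum:
  fixes F :: "'n::finite cube \<Rightarrow> 'b::real_vector"
  assumes D: "dyadic_grid D" and J: "J \<in> D" and C: "C \<in> children D J" "x \<in> cube_set C"
  shows "(\<Sum>C'\<in>children D J. indicator (cube_set C') x *\<^sub>R F C') = F C"
proof -
  have "(\<Sum>C'\<in>children D J. indicator (cube_set C') x *\<^sub>R F C') = (\<Sum>C'\<in>children D J. if C' = C then F C' else 0)"
  proof (rule sum.cong[OF refl])
    fix C' assume C': "C' \<in> children D J"
    show "indicator (cube_set C') x *\<^sub>R F C' = (if C' = C then F C' else 0)"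
    proof (cases "C' = C")
      case False
      then have "x \<notin> cube_set C'" using child_unique[OF D C' C(1) _ C(2)] by blast
      then show ?thesis using False by simp
    qed (use C in simp)
  qed
  then show ?thesis using C grid_children(1)[OF D J] by simp
qed

lemma child_indicator_sum':
  fixes F :: "'n::finite cube \<Rightarrow> 'b::real_vector"
  assumes D: "dyadic_grid D" and J: "J \<in> D" and x: "x \<notin> cube_set J"
  shows "(\<Sum>C'\<in>children D J. indicator (cube_set C') x *\<^sub>R F C') = 0"
  using x by (intro sum.neutral) (auto simp: children_def indicator_def)

lemma child_split:
  fixes h :: "real ^ 'n::finite \<Rightarrow> 'b::real_vector"
  assumes D: "dyadic_grid D" and J: "J \<in> D"
  shows "indicator (cube_set J) x *\<^sub>R h x = (\<Sum>C\<in>children D J. indicator (cube_set C) x *\<^sub>R h x)"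
proof (cases "x \<in> cube_set J")
  case True
  then obtain C where "C \<in> children D J" "x \<in> cube_set C" using grid_children(2)[OF D J] by blast
  with child_indicator_sum[OF D J this, of "\<lambda>_. h x"] True show ?thesis by simp
next
  case False
  then show ?thesis using child_indicator_sum'[OF D J False, of "\<lambda>_. h x"] by simp
qed

lemma grid_side_ratio:
  assumes D: "dyadic_grid D" and Q: "Q \<in> D" "Q' \<in> D" "side Q \<le> side Q'"
  obtains j :: nat where "side Q' = 2 ^ j * side Q"
proof -
  obtain k k' :: int where k: "side Q = 2 powi k" "side Q' = 2 powi k'"
    using grid_side_powi[OF D] Q by metis
  then have "k \<le> k'"
    using Q(3) power_int_strict_increasing[of k' k "2::real"] by (cases "k \<le> k'") auto
  have "side Q' = 2 powi (int (nat (k' - k))) * 2 powi k" using \<open>k \<le> k'\<close> k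
    by (subst power_int_add[symmetric]) auto
  then have "side Q' = 2 ^ nat (k' - k) * side Q" by (simp add: k del: int_nat_eq)
  then show ?thesis by (rule that)
qed

text \<open>
  Descend from \<open>Q'\<close> through the children containing \<open>x\<close>: after finitely many steps the side is that of
  \<open>Q\<close>, and two grid cubes of equal side with a common point coincide.
\<close>

lemma grid_nested:
  assumes D: "dyadic_grid D"
  shows "Q \<in> D \<Longrightarrow> Q' \<in> D \<Longrightarrow> side Q \<le> side Q' \<Longrightarrow> x \<in> cube_set Q \<Longrightarrow> x \<in> cube_set Q' \<Longrightarrow>
    cube_set Q \<subseteq> cube_set Q'"
proof -
  have "Q \<in> D \<Longrightarrow> Q' \<in> D \<Longrightarrow> side Q' = 2 ^ j * side Q \<Longrightarrow> x \<in> cube_set Q \<Longrightarrow> x \<in> cube_set Q' \<Longrightarrow>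
    cube_set Q \<subseteq> cube_set Q'" for j
  proof (induction j arbitrary: Q')
    case 0 then show ?case using grid_same_side[OF D, of Q Q' x] by simp
  next
    case (Suc j)
    obtain J where J: "J \<in> children D Q'" "x \<in> cube_set J"
      using grid_children(2)[OF D Suc.prems(2)] Suc.prems(5) by blast
    then have "cube_set Q \<subseteq> cube_set J" using Suc.prems by (intro Suc.IH) (auto simp: children_def)
    then show ?case using J by (auto simp: children_def)
  qed
  then show "Q \<in> D \<Longrightarrow> Q' \<in> D \<Longrightarrow> side Q \<le> side Q' \<Longrightarrow> x \<in> cube_set Q \<Longrightarrow> x \<in> cube_set Q' \<Longrightarrow>
    cube_set Q \<subseteq> cube_set Q'" using grid_side_ratio[OF D, of Q Q'] by metis
qed

lemma grid_nested_or_disjoint: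
  assumes "dyadic_grid D" "Q \<in> D" "Q' \<in> D"
  shows "cube_set Q \<subseteq> cube_set Q' \<or> cube_set Q' \<subseteq> cube_set Q \<or> cube_set Q \<inter> cube_set Q' = {}"
  using grid_nested[OF assms(1)] assms by (metis disjoint_iff linear)

lemma grid_parent:
  assumes D: "dyadic_grid D" and Q: "Q \<in> D"
  obtains P where "P \<in> D" "side P = 2 * side Q" "cube_set Q \<subseteq> cube_set P"
proof -
  obtain k :: int where k: "side Q = 2 powi k" using grid_side_powi[OF D Q] by blast
  obtain P where P: "P \<in> D" "side P = 2 powi (k + 1)" "fst Q \<in> cube_set P" using grid_point[OF D] by metis
  have s: "side P = 2 * side Q" using P k by (simp add: power_int_add)
  have "0 < side Q" using grid_side_pos D Q by blast
  then have "cube_set Q \<subseteq> cube_set P"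
    using grid_nested[OF D Q P(1), of "fst Q"] s P(3) by (simp add: cube_corner_mem)
  then show ?thesis using that P s by blast
qed

lemma dyadic_parent_props:
  assumes D: "dyadic_grid D" and K: "K \<in> D"
  shows "dyadic_parent D K \<in> D" "K \<in> children D (dyadic_parent D K)"
proof -
  obtain P where P: "P \<in> D" "side P = 2 * side K" "cube_set K \<subseteq> cube_set P" using grid_parent[OF D K] .
  have pos: "fst K \<in> cube_set K" using grid_side_pos[OF D K] by (rule cube_corner_mem)
  have "P \<in> D \<and> K \<in> children D P" using P K by (auto simp: children_def)
  moreover have "P' = P" if "P' \<in> D \<and> K \<in> children D P'" for P'
    using that P pos by (intro grid_same_side[OF D, of P' P "fst K"]) (auto simp: children_def)
  ultimately have "dyadic_parent D K \<in> D \<and> K \<in> children D (dyadic_parent D K)"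
    unfolding dyadic_parent_def by (rule theI)
  then show "dyadic_parent D K \<in> D" "K \<in> children D (dyadic_parent D K)" by auto
qed

lemma dyadic_ancestor_mem: "dyadic_grid D \<Longrightarrow> K \<in> D \<Longrightarrow> (dyadic_parent D ^^ l) K \<in> D"
  by (induction l) (auto intro: dyadic_parent_props)

lemma maximal_cubes_disjoint:
  assumes D: "dyadic_grid D" and F: "F \<subseteq> D" and J: "J \<in> maximal_cubes F" "J' \<in> maximal_cubes F" "J \<noteq> J'"
  shows "cube_set J \<inter> cube_set J' = {}"
proof -
  have "J \<in> D" "J' \<in> D" using J F by (auto simp: maximal_cubes_def)
  moreover have "cube_set J \<subseteq> cube_set J' \<Longrightarrow> J' = J" "cube_set J' \<subseteq> cube_set J \<Longrightarrow> J = J'"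
    using J(1,2) by (simp_all add: maximal_cubes_def)
  ultimately show ?thesis using grid_nested_or_disjoint[OF D, of J J'] J(3) by metis
qed

lemma finite_grid_subcubes:
  assumes D: "dyadic_grid D" and K: "K \<in> D"
  shows "finite {J \<in> D. cube_set J \<subseteq> cube_set K \<and> side K \<le> 2 ^ j * side J}"
proof -
  have fin: "finite {J \<in> D. cube_set J \<subseteq> cube_set K \<and> side K = 2 ^ j * side J}" for j
  proof (induction j)
    case 0
    have "J = K" if "J \<in> D" "cube_set J \<subseteq> cube_set K" "side K = 2 ^ 0 * side J" for J
    proof -
      have "fst J \<in> cube_set J" using grid_side_pos[OF D that(1)] by (rule cube_corner_mem)
      then show "J = K" using that grid_same_side[OF D that(1) K, of "fst J"] by auto
    qed
    then have "{J \<in> D. cube_set J \<subseteq> cube_set K \<and> side K = 2 ^ 0 * side J} \<subseteq> {K}" by blast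
    then show ?case using finite_subset by blast
  next
    case (Suc j)
    have "{J \<in> D. cube_set J \<subseteq> cube_set K \<and> side K = 2 ^ Suc j * side J} \<subseteq>
        (\<Union>P\<in>{J \<in> D. cube_set J \<subseteq> cube_set K \<and> side K = 2 ^ j * side J}. children D P)"
    proof
      fix J assume "J \<in> {J \<in> D. cube_set J \<subseteq> cube_set K \<and> side K = 2 ^ Suc j * side J}"
      then have J: "J \<in> D" "cube_set J \<subseteq> cube_set K" "side K = 2 ^ Suc j * side J" by auto
      obtain P where P: "P \<in> D" "side P = 2 * side J" "cube_set J \<subseteq> cube_set P" using grid_parent[OF D J(1)] .
      have c: "fst J \<in> cube_set J" using grid_side_pos[OF D J(1)] by (rule cube_corner_mem)
      have "side P \<le> side K" using J P grid_side_pos[OF D J(1)] by simp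
      then have "cube_set P \<subseteq> cube_set K" using grid_nested[OF D P(1) K] c P J by blast
      then show "J \<in> (\<Union>P\<in>{J \<in> D. cube_set J \<subseteq> cube_set K \<and> side K = 2 ^ j * side J}. children D P)"
        using P J by (intro UN_I[of P]) (simp_all add: children_def)
    qed
    moreover have "finite (\<Union>P\<in>{J \<in> D. cube_set J \<subseteq> cube_set K \<and> side K = 2 ^ j * side J}. children D P)"
      by (rule finite_UN_I[OF Suc]) (simp add: grid_children(1)[OF D])
    ultimately show ?case by (rule finite_subset)
  qed
  have "{J \<in> D. cube_set J \<subseteq> cube_set K \<and> side K \<le> 2 ^ j * side J} \<subseteq>
      (\<Union>i\<in>{..j}. {J \<in> D. cube_set J \<subseteq> cube_set K \<and> side K = 2 ^ i * side J})"
  proof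
    fix J assume "J \<in> {J \<in> D. cube_set J \<subseteq> cube_set K \<and> side K \<le> 2 ^ j * side J}"
    then have J: "J \<in> D" "cube_set J \<subseteq> cube_set K" "side K \<le> 2 ^ j * side J" by auto
    have pos: "0 < side J" using grid_side_pos[OF D J(1)] .
    then obtain i :: nat where i: "side K = 2 ^ i * side J"
      using grid_side_ratio[OF D J(1) K] cube_subset_side_le J by metis
    then have "(2::real) ^ i \<le> 2 ^ j" using J(3) pos by simp
    then have "i \<le> j" by simp
    then show "J \<in> (\<Union>i\<in>{..j}. {J \<in> D. cube_set J \<subseteq> cube_set K \<and> side K = 2 ^ i * side J})" using i J by auto
  qed
  moreover have "finite (\<Union>i\<in>{..j}. {J \<in> D. cube_set J \<subseteq> cube_set K \<and> side K = 2 ^ i * side J})"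
    by (rule finite_UN_I) (simp_all add: fin)
  ultimately show ?thesis by (rule finite_subset)
qed


section \<open>Haar projections of the identity map\<close>

text \<open>
  The condition that \<open>g\<close> pairs with \<open>f i\<close> as \<open>f i\<close> with itself says that the partial sums are the
  orthogonal projections of \<open>g\<close>, although the \<open>f i\<close> are not normalised.
\<close>

lemma bessel_identity:
  fixes f :: "'i \<Rightarrow> 'a \<Rightarrow> 'b::euclidean_space" and g :: "'a \<Rightarrow> 'b"
  assumes F: "finite F"
    and int: "integrable M (\<lambda>x. g x \<bullet> g x)" "\<And>i. i \<in> F \<Longrightarrow> integrable M (\<lambda>x. g x \<bullet> f i x)"
      "\<And>i j. i \<in> F \<Longrightarrow> j \<in> F \<Longrightarrow> integrable M (\<lambda>x. f i x \<bullet> f j x)"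
    and orth: "\<And>i j. i \<in> F \<Longrightarrow> j \<in> F \<Longrightarrow> i \<noteq> j \<Longrightarrow> (\<integral>x. f i x \<bullet> f j x \<partial>M) = 0"
    and self: "\<And>i. i \<in> F \<Longrightarrow> (\<integral>x. g x \<bullet> f i x \<partial>M) = (\<integral>x. f i x \<bullet> f i x \<partial>M)"
  shows "integrable M (\<lambda>x. (norm (g x - (\<Sum>i\<in>F. f i x)))\<^sup>2)"
    and "(\<integral>x. (norm (g x - (\<Sum>i\<in>F. f i x)))\<^sup>2 \<partial>M) =
           (\<integral>x. (norm (g x))\<^sup>2 \<partial>M) - (\<Sum>i\<in>F. \<integral>x. (norm (f i x))\<^sup>2 \<partial>M)"
proof -
  have eq: "(norm (g x - (\<Sum>i\<in>F. f i x)))\<^sup>2 =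
      g x \<bullet> g x - 2 * (\<Sum>i\<in>F. g x \<bullet> f i x) + (\<Sum>i\<in>F. \<Sum>j\<in>F. f i x \<bullet> f j x)" for x
  proof -
    have "(norm (g x - s))\<^sup>2 = g x \<bullet> g x - 2 * (g x \<bullet> s) + s \<bullet> s" for s
      by (simp add: power2_norm_eq_inner inner_diff_left inner_diff_right inner_commute)
    moreover have "(\<Sum>i\<in>F. f i x) \<bullet> (\<Sum>i\<in>F. f i x) = (\<Sum>i\<in>F. \<Sum>j\<in>F. f i x \<bullet> f j x)"
      unfolding inner_sum_left unfolding inner_sum_right ..
    ultimately show ?thesis by (simp only: inner_sum_right)
  qed
  show "integrable M (\<lambda>x. (norm (g x - (\<Sum>i\<in>F. f i x)))\<^sup>2)"
    unfolding eq using int by auto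
  have "(\<integral>x. (norm (g x - (\<Sum>i\<in>F. f i x)))\<^sup>2 \<partial>M) =
      (\<integral>x. g x \<bullet> g x \<partial>M) - 2 * (\<Sum>i\<in>F. \<integral>x. g x \<bullet> f i x \<partial>M) + (\<Sum>i\<in>F. \<Sum>j\<in>F. \<integral>x. f i x \<bullet> f j x \<partial>M)"
    unfolding eq using int by (simp add: Bochner_Integration.integral_add Bochner_Integration.integral_diff Bochner_Integration.integral_sum)
  also have "(\<Sum>i\<in>F. \<Sum>j\<in>F. \<integral>x. f i x \<bullet> f j x \<partial>M) = (\<Sum>i\<in>F. \<Sum>j\<in>F. if i = j then \<integral>x. f i x \<bullet> f i x \<partial>M else 0)"
    using orth by (intro sum.cong) auto
  also have "\<dots> = (\<Sum>i\<in>F. \<integral>x. f i x \<bullet> f i x \<partial>M)" using F by simp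
  also have "(\<Sum>i\<in>F. \<integral>x. g x \<bullet> f i x \<partial>M) = (\<Sum>i\<in>F. \<integral>x. f i x \<bullet> f i x \<partial>M)"
    using self by (rule sum.cong[OF refl])
  finally show "(\<integral>x. (norm (g x - (\<Sum>i\<in>F. f i x)))\<^sup>2 \<partial>M) =
           (\<integral>x. (norm (g x))\<^sup>2 \<partial>M) - (\<Sum>i\<in>F. \<integral>x. (norm (f i x))\<^sup>2 \<partial>M)"
    by (simp add: power2_norm_eq_inner)
qed

lemma L2_norm_sq_triangle:
  fixes f g :: "'a \<Rightarrow> 'b::euclidean_space"
  assumes [measurable]: "f \<in> borel_measurable M" "g \<in> borel_measurable M"
  shows "L2_norm_sq M (\<lambda>x. f x + g x) \<le> 2 * L2_norm_sq M f + 2 * L2_norm_sq M g"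
proof -
  have "(norm (f x + g x))\<^sup>2 \<le> 2 * (norm (f x))\<^sup>2 + 2 * (norm (g x))\<^sup>2" for x
  proof -
    have "(norm (f x + g x))\<^sup>2 \<le> (norm (f x) + norm (g x))\<^sup>2"
      by (intro power_mono norm_triangle_ineq) auto
    also have "\<dots> \<le> 2 * (norm (f x))\<^sup>2 + 2 * (norm (g x))\<^sup>2"
      using sum_squares_bound[of "norm (f x)" "norm (g x)"] by (simp add: power2_sum)
    finally show ?thesis .
  qed
  then have "ennreal ((norm (f x + g x))\<^sup>2) \<le> 2 * ennreal ((norm (f x))\<^sup>2) + 2 * ennreal ((norm (g x))\<^sup>2)" for x
    by (simp add: ennreal_mult'[symmetric] ennreal_plus[symmetric] ennreal_leI del: ennreal_plus
          flip: ennreal_numeral)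
  then have "L2_norm_sq M (\<lambda>x. f x + g x) \<le> (\<integral>\<^sup>+x. 2 * ennreal ((norm (f x))\<^sup>2) + 2 * ennreal ((norm (g x))\<^sup>2) \<partial>M)"
    unfolding L2_norm_sq_def by (intro nn_integral_mono)
  also have "\<dots> = 2 * L2_norm_sq M f + 2 * L2_norm_sq M g"
    unfolding L2_norm_sq_def by (simp add: nn_integral_add nn_integral_cmult)
  finally show ?thesis .
qed

text \<open>
  The chosen limit and \<open>g\<close> are limits of the same net, so they agree almost everywhere.
\<close>

lemma L2_sum_norm_eq:
  fixes f :: "'i \<Rightarrow> 'a \<Rightarrow> 'b::euclidean_space"
  assumes [measurable]: "\<And>i. i \<in> A \<Longrightarrow> f i \<in> borel_measurable M" "g \<in> borel_measurable M"
    and lim: "((\<lambda>F. L2_norm_sq M (\<lambda>x. (\<Sum>i\<in>F. f i x) - g x)) \<longlongrightarrow> 0) (finite_subsets_at_top A)"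
  shows "L2_norm_sq M (L2_sum M f A) = L2_norm_sq M g"
proof -
  define h where "h = L2_sum M f A"
  have "h \<in> borel_measurable M \<and>
     ((\<lambda>F. L2_norm_sq M (\<lambda>x. (\<Sum>i\<in>F. f i x) - h x)) \<longlongrightarrow> 0) (finite_subsets_at_top A)"
    unfolding h_def L2_sum_def by (rule someI[where x = g]) (use assms in auto)
  then have h [measurable]: "h \<in> borel_measurable M"
    and limh: "((\<lambda>F. L2_norm_sq M (\<lambda>x. (\<Sum>i\<in>F. f i x) - h x)) \<longlongrightarrow> 0) (finite_subsets_at_top A)" by auto
  have le: "L2_norm_sq M (\<lambda>x. h x - g x) \<le>
      2 * L2_norm_sq M (\<lambda>x. (\<Sum>i\<in>F. f i x) - g x) + 2 * L2_norm_sq M (\<lambda>x. (\<Sum>i\<in>F. f i x) - h x)"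
    if F: "finite F" "F \<subseteq> A" for F
  proof -
    have [measurable]: "(\<lambda>x. \<Sum>i\<in>F. f i x) \<in> borel_measurable M"
      using F assms(1) by (intro borel_measurable_sum) auto
    have "L2_norm_sq M (\<lambda>x. h x - g x) = L2_norm_sq M (\<lambda>x. ((\<Sum>i\<in>F. f i x) - g x) + (h x - (\<Sum>i\<in>F. f i x)))"
      by simp
    also have "\<dots> \<le> 2 * L2_norm_sq M (\<lambda>x. (\<Sum>i\<in>F. f i x) - g x) + 2 * L2_norm_sq M (\<lambda>x. h x - (\<Sum>i\<in>F. f i x))"
      by (intro L2_norm_sq_triangle) measurable
    finally show ?thesis by (simp add: L2_norm_sq_def norm_minus_commute)
  qed
  have "((\<lambda>F. 2 * L2_norm_sq M (\<lambda>x. (\<Sum>i\<in>F. f i x) - g x) + 2 * L2_norm_sq M (\<lambda>x. (\<Sum>i\<in>F. f i x) - h x))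
      \<longlongrightarrow> 2 * 0 + 2 * 0) (finite_subsets_at_top A)"
    by (intro tendsto_add ennreal_tendsto_cmult lim limh) auto
  moreover have "eventually (\<lambda>F. L2_norm_sq M (\<lambda>x. h x - g x) \<le>
      2 * L2_norm_sq M (\<lambda>x. (\<Sum>i\<in>F. f i x) - g x) + 2 * L2_norm_sq M (\<lambda>x. (\<Sum>i\<in>F. f i x) - h x))
      (finite_subsets_at_top A)"
    using le by (intro eventually_finite_subsets_at_top_weakI)
  ultimately have "L2_norm_sq M (\<lambda>x. h x - g x) \<le> 2 * 0 + 2 * 0"
    by (rule tendsto_lowerbound) simp
  then have "L2_norm_sq M (\<lambda>x. h x - g x) = 0" by simp
  then have "AE x in M. h x = g x"
    unfolding L2_norm_sq_def by (subst (asm) nn_integral_0_iff_AE) (auto simp: ennreal_eq_0_iff)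
  then show ?thesis
    unfolding L2_norm_sq_def h_def[symmetric] by (intro nn_integral_cong_AE) auto
qed

text \<open>
  By the Bessel identity for \<open>g\<close> the error of a partial sum decreases when terms are added. Smallness
  along one sequence of finite sets therefore gives convergence of the whole net to \<open>g\<close>. The Bessel
  inequality for \<open>h\<close> bounds the partial sums, and hence \<open>g\<close>, by the norm of \<open>h\<close>.
\<close>

lemma orthogonal_L2_sum_le:
  fixes f :: "'i \<Rightarrow> 'a \<Rightarrow> 'b::euclidean_space" and g h :: "'a \<Rightarrow> 'b"
  assumes f: "\<And>i. i \<in> A \<Longrightarrow> f i \<in> borel_measurable M" and g: "g \<in> borel_measurable M"
    and int_ff: "\<And>i j. i \<in> A \<Longrightarrow> j \<in> A \<Longrightarrow> integrable M (\<lambda>x. f i x \<bullet> f j x)"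
    and int_g: "integrable M (\<lambda>x. g x \<bullet> g x)" "\<And>i. i \<in> A \<Longrightarrow> integrable M (\<lambda>x. g x \<bullet> f i x)"
    and int_h: "integrable M (\<lambda>x. h x \<bullet> h x)" "\<And>i. i \<in> A \<Longrightarrow> integrable M (\<lambda>x. h x \<bullet> f i x)"
    and orth: "\<And>i j. i \<in> A \<Longrightarrow> j \<in> A \<Longrightarrow> i \<noteq> j \<Longrightarrow> (\<integral>x. f i x \<bullet> f j x \<partial>M) = 0"
    and selfg: "\<And>i. i \<in> A \<Longrightarrow> (\<integral>x. g x \<bullet> f i x \<partial>M) = (\<integral>x. f i x \<bullet> f i x \<partial>M)"
    and selfh: "\<And>i. i \<in> A \<Longrightarrow> (\<integral>x. h x \<bullet> f i x \<partial>M) = (\<integral>x. f i x \<bullet> f i x \<partial>M)"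
    and FN: "\<And>N. finite (FN N)" "\<And>N. FN N \<subseteq> A"
    and lim: "(\<lambda>N::nat. \<integral>x. (norm (g x - (\<Sum>i\<in>FN N. f i x)))\<^sup>2 \<partial>M) \<longlonglongrightarrow> 0"
  shows "L2_norm_sq M (L2_sum M f A) \<le> ennreal (\<integral>x. (norm (h x))\<^sup>2 \<partial>M)"
proof -
  define b where "b = (\<lambda>F. \<Sum>i\<in>F. \<integral>x. (norm (f i x))\<^sup>2 \<partial>M)"
  define e where "e = (\<lambda>F. \<integral>x. (norm (g x - (\<Sum>i\<in>F. f i x)))\<^sup>2 \<partial>M)"
  have besselg: "integrable M (\<lambda>x. (norm (g x - (\<Sum>i\<in>F. f i x)))\<^sup>2)"
      "e F = (\<integral>x. (norm (g x))\<^sup>2 \<partial>M) - b F" if F: "finite F" "F \<subseteq> A" for F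
    unfolding e_def b_def
    by (rule bessel_identity[OF F(1) int_g(1)];
        (assumption | rule int_g(2) int_ff orth selfg subsetD[OF F(2)])+)+
  have besselh: "(\<integral>x. (norm (h x - (\<Sum>i\<in>F. f i x)))\<^sup>2 \<partial>M) = (\<integral>x. (norm (h x))\<^sup>2 \<partial>M) - b F"
    if F: "finite F" "F \<subseteq> A" for F
    unfolding b_def
    by (rule bessel_identity(2)[OF F(1) int_h(1)];
        (assumption | rule int_h(2) int_ff orth selfh subsetD[OF F(2)])+)
  have b_le: "b F \<le> (\<integral>x. (norm (h x))\<^sup>2 \<partial>M)" if "finite F" "F \<subseteq> A" for F
  proof -
    have "0 \<le> (\<integral>x. (norm (h x - (\<Sum>i\<in>F. f i x)))\<^sup>2 \<partial>M)" by simp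
    then show ?thesis unfolding besselh[OF that] by simp
  qed
  have b_mono: "b F \<le> b F'" if "F \<subseteq> F'" "finite F'" for F F'
    unfolding b_def using that by (intro sum_mono2) auto
  have lime: "(\<lambda>N. e (FN N)) \<longlonglongrightarrow> 0"
    using lim by (simp only: e_def)
  have g_le: "(\<integral>x. (norm (g x))\<^sup>2 \<partial>M) \<le> (\<integral>x. (norm (h x))\<^sup>2 \<partial>M)"
  proof (rule LIMSEQ_le_const)
    show "(\<lambda>N. e (FN N) + (\<integral>x. (norm (h x))\<^sup>2 \<partial>M)) \<longlonglongrightarrow> (\<integral>x. (norm (h x))\<^sup>2 \<partial>M)"
      using tendsto_add[OF lime tendsto_const] by simp
    show "\<exists>N. \<forall>n\<ge>N. (\<integral>x. (norm (g x))\<^sup>2 \<partial>M) \<le> e (FN n) + (\<integral>x. (norm (h x))\<^sup>2 \<partial>M)"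
      using besselg(2)[OF FN(1) FN(2)] b_le[OF FN(1) FN(2)] by auto
  qed
  have lim_e: "(e \<longlongrightarrow> 0) (finite_subsets_at_top A)"
  proof (rule order_tendstoI)
    fix a :: real assume "a < 0"
    then have "a < e F" for F unfolding e_def by (rule less_le_trans) simp
    then show "\<forall>\<^sub>F F in finite_subsets_at_top A. a < e F" by simp
  next
    fix a :: real assume a: "0 < a"
    then obtain N where N: "e (FN N) < a"
      using order_tendstoD(2)[OF lime a] unfolding eventually_sequentially by blast
    have "e F < a" if "finite F" "FN N \<subseteq> F" "F \<subseteq> A" for F
      using besselg(2)[OF that(1,3)] besselg(2)[OF FN(1) FN(2), of N] b_mono[OF that(2,1)] N by linarith
    then show "\<forall>\<^sub>F F in finite_subsets_at_top A. e F < a"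
      unfolding eventually_finite_subsets_at_top using FN[of N] by (intro exI[of _ "FN N"]) simp
  qed
  have L2e: "L2_norm_sq M (\<lambda>x. (\<Sum>i\<in>F. f i x) - g x) = ennreal (e F)" if "finite F" "F \<subseteq> A" for F
    unfolding L2_norm_sq_def e_def norm_minus_commute[of _ "g _"]
    using besselg(1)[OF that] by (intro nn_integral_eq_integral) auto
  have "L2_norm_sq M (L2_sum M f A) = L2_norm_sq M g"
  proof (rule L2_sum_norm_eq)
    have "((\<lambda>F. ennreal (e F)) \<longlongrightarrow> ennreal 0) (finite_subsets_at_top A)"
      by (rule tendsto_ennrealI[OF lim_e])
    moreover have "eventually (\<lambda>F. ennreal (e F) = L2_norm_sq M (\<lambda>x. (\<Sum>i\<in>F. f i x) - g x)) (finite_subsets_at_top A)"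
      using L2e by (intro eventually_finite_subsets_at_top_weakI) auto
    ultimately show "((\<lambda>F. L2_norm_sq M (\<lambda>x. (\<Sum>i\<in>F. f i x) - g x)) \<longlongrightarrow> 0) (finite_subsets_at_top A)"
      using Lim_transform_eventually by fastforce
  qed (use f g in auto)
  also have "\<dots> = ennreal (\<integral>x. (norm (g x))\<^sup>2 \<partial>M)"
    unfolding L2_norm_sq_def using besselg(1)[of "{}"] by (intro nn_integral_eq_integral) auto
  also have "\<dots> \<le> ennreal (\<integral>x. (norm (h x))\<^sup>2 \<partial>M)" by (intro ennreal_leI g_le)
  finally show ?thesis .
qed

context
  fixes \<mu> :: "(real ^ 'n::finite) measure"
  assumes \<mu>: "locally_finite_borel \<mu>"
begin

private abbreviation "V J \<equiv> cube_avg \<mu> J (\<lambda>x. x)"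

private lemma sets: "sets \<mu> = sets borel"
  by (rule locally_finite_sets[OF \<mu>])

lemma integrable_indicator_cube:
  fixes f :: "real ^ 'n \<Rightarrow> 'b::{banach, second_countable_topology}"
  assumes [measurable]: "f \<in> borel_measurable borel" and "\<And>x. x \<in> cube_set K \<Longrightarrow> norm (f x) \<le> B"
  shows "integrable \<mu> (\<lambda>x. indicator (cube_set K) x *\<^sub>R f x)"
  by (rule integrable_bounded_cube[OF \<mu>, where K = K and B = B]) (use assms(2) in auto)

lemma integrable_id_cube: "integrable \<mu> (\<lambda>x. indicator (cube_set K) x *\<^sub>R x)"
  by (rule integrable_indicator_cube[where B = "real CARD('n) * side K + norm (cube_center K)"])
     (auto intro: norm_cube_bound)

lemma integral_const_cube: "(\<integral>x. indicator (cube_set K) x *\<^sub>R v \<partial>\<mu>) = measure \<mu> (cube_set K) *\<^sub>R (v :: real ^ 'n)"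
  using emeasure_cube_finite[OF \<mu>, of K]
  by (subst integral_scaleR_left) (auto simp: sets sets_eq_imp_space_eq[OF sets] intro!: integrable_real_indicator)

text \<open>
  Null cubes are included: there the average is \<open>0\<close> by convention and both sides vanish.
\<close>

lemma measure_scale_avg:
  "measure \<mu> (cube_set K) *\<^sub>R V K = (\<integral>x. indicator (cube_set K) x *\<^sub>R x \<partial>\<mu>)"
proof (cases "measure \<mu> (cube_set K) = 0")
  case True
  then have "emeasure \<mu> (cube_set K) = 0"
    using emeasure_cube_finite[OF \<mu>, of K] by (auto simp: measure_def enn2real_eq_0_iff)
  then have "AE x in \<mu>. x \<notin> cube_set K"
    by (intro AE_not_in) (simp add: null_sets_def sets)
  then have "(\<integral>x. indicator (cube_set K) x *\<^sub>R x \<partial>\<mu>) = (\<integral>x. 0 \<partial>\<mu>)"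
    by (intro integral_cong_AE borel_measurable_integrable[OF integrable_id_cube]) auto
  then show ?thesis using True by simp
next
  case False
  have "(\<integral>x. indicator (cube_set K) x *\<^sub>R x \<partial>\<mu>) $ i = (\<integral>x. (indicator (cube_set K) x *\<^sub>R x) $ i \<partial>\<mu>)" for i
    using integral_bounded_linear[OF bounded_linear_vec_nth integrable_id_cube[of K], of i] by simp
  with False show ?thesis
    by (simp add: vec_eq_iff cube_avg_def set_lebesgue_integral_def)
qed

lemma avg_dist_le:
  assumes Q: "x \<in> cube_set Q" and pos: "measure \<mu> (cube_set Q) \<noteq> 0"
  shows "norm (x - V Q) \<le> real CARD('n) * side Q"
proof -
  let ?m = "measure \<mu> (cube_set Q)"
  have m: "0 < ?m" using pos by (simp add: zero_less_measure_iff)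
  have "?m *\<^sub>R (x - V Q) = (\<integral>y. indicator (cube_set Q) y *\<^sub>R x \<partial>\<mu>) - (\<integral>y. indicator (cube_set Q) y *\<^sub>R y \<partial>\<mu>)"
    unfolding integral_const_cube measure_scale_avg[symmetric] by (simp add: algebra_simps)
  also have "\<dots> = (\<integral>y. indicator (cube_set Q) y *\<^sub>R x - indicator (cube_set Q) y *\<^sub>R y \<partial>\<mu>)"
    by (intro Bochner_Integration.integral_diff[symmetric] integrable_id_cube integrable_indicator_cube[where B = "norm x"]) auto
  finally have eq: "?m *\<^sub>R (x - V Q) = (\<integral>y. indicator (cube_set Q) y *\<^sub>R x - indicator (cube_set Q) y *\<^sub>R y \<partial>\<mu>)" .
  have "norm (?m *\<^sub>R (x - V Q)) \<le> (\<integral>y. norm (indicator (cube_set Q) y *\<^sub>R x - indicator (cube_set Q) y *\<^sub>R y) \<partial>\<mu>)"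
    unfolding eq by (rule integral_norm_bound)
  also have "\<dots> \<le> (\<integral>y. indicator (cube_set Q) y *\<^sub>R (real CARD('n) * side Q) \<partial>\<mu>)"
  proof (rule integral_mono)
    show "integrable \<mu> (\<lambda>y. norm (indicat_real (cube_set Q) y *\<^sub>R x - indicat_real (cube_set Q) y *\<^sub>R y))"
      by (intro integrable_norm Bochner_Integration.integrable_diff integrable_id_cube integrable_indicator_cube[where B = "norm x"]) auto
    show "integrable \<mu> (\<lambda>y. indicator (cube_set Q) y *\<^sub>R (real CARD('n) * side Q))"
      by (intro integrable_indicator_cube[where B = "\<bar>real CARD('n) * side Q\<bar>"]) auto
    show "norm (indicat_real (cube_set Q) y *\<^sub>R x - indicat_real (cube_set Q) y *\<^sub>R y)
        \<le> indicat_real (cube_set Q) y *\<^sub>R (real CARD('n) * side Q)" for y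
      using norm_diff_cube_le[OF Q, of y] by (auto simp: indicator_def)
  qed
  also have "\<dots> = ?m * (real CARD('n) * side Q)"
    using emeasure_cube_finite[OF \<mu>, of Q] by (simp add: sets)
  finally show ?thesis using m by simp
qed

context
  fixes D :: "'n cube set"
  assumes D: "dyadic_grid D"
begin

private abbreviation "haar J \<equiv> haar_diff D \<mu> J (\<lambda>x. x)"

lemma haar_on_child:
  assumes J: "J \<in> D" and C: "C \<in> children D J" "x \<in> cube_set C"
  shows "haar J x = V C - V J"
proof -
  have "x \<in> cube_set J" using C by (auto simp: children_def)
  then show ?thesis using child_indicator_sum[OF D assms, of V] by (simp add: haar_diff_def)
qed

lemma haar_outside: "J \<in> D \<Longrightarrow> x \<notin> cube_set J \<Longrightarrow> haar J x = 0"
  using child_indicator_sum'[OF D, of J x V] by (simp add: haar_diff_def)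

lemma haar_measurable [measurable]: "haar J \<in> borel_measurable borel"
  unfolding haar_diff_def by measurable

lemma haar_bounded: "\<exists>B. \<forall>x. norm (haar J x) \<le> B"
proof (intro exI allI)
  fix x
  show "norm (haar J x) \<le> (\<Sum>C\<in>children D J. norm (V C)) + norm (V J)"
    unfolding haar_diff_def
    by (intro order_trans[OF norm_triangle_ineq4] add_mono sum_norm_le) (auto simp: indicator_def)
qed

lemma child_integrable:
  fixes h :: "real ^ 'n \<Rightarrow> real ^ 'n"
  assumes C: "C \<in> children D J" and h: "integrable \<mu> (\<lambda>x. indicator (cube_set J) x *\<^sub>R h x)"
  shows "integrable \<mu> (\<lambda>x. indicator (cube_set C) x *\<^sub>R h x)"
proof -
  have "integrable \<mu> (\<lambda>x. indicator (cube_set C) x *\<^sub>R (indicator (cube_set J) x *\<^sub>R h x))"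
    by (rule integrable_mult_indicator[OF _ h]) (simp add: sets)
  moreover have "indicator (cube_set C) x *\<^sub>R (indicator (cube_set J) x *\<^sub>R h x) = indicator (cube_set C) x *\<^sub>R h x" for x
    using C by (auto simp: children_def indicator_def)
  ultimately show ?thesis by (simp only:)
qed

text \<open>
  The Haar difference is constant on every child of \<open>J\<close>, so a pairing with it depends only on the
  integrals over the children. Mean zero, orthogonality and the self-pairing all follow from this.
\<close>

lemma haar_pairing:
  assumes J: "J \<in> D" and h: "integrable \<mu> (\<lambda>x. indicator (cube_set J) x *\<^sub>R h x)"
  shows "(\<integral>x. h x \<bullet> haar J x \<partial>\<mu>) =
    (\<Sum>C\<in>children D J. (\<integral>x. indicator (cube_set C) x *\<^sub>R h x \<partial>\<mu>) \<bullet> (V C - V J))"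
proof -
  have "h x \<bullet> haar J x = (\<Sum>C\<in>children D J. (indicator (cube_set C) x *\<^sub>R h x) \<bullet> (V C - V J))" for x
  proof (cases "x \<in> cube_set J")
    case True
    then obtain C where C: "C \<in> children D J" "x \<in> cube_set C" using grid_children(2)[OF D J] by blast
    then show ?thesis
      using child_indicator_sum[OF D J C, of "\<lambda>C. h x \<bullet> (V C - V J)"] haar_on_child[OF J C] by simp
  next
    case False
    then show ?thesis
      using child_indicator_sum'[OF D J False, of "\<lambda>C. h x \<bullet> (V C - V J)"] haar_outside[OF J False] by simp
  qed
  then have "(\<integral>x. h x \<bullet> haar J x \<partial>\<mu>) =
      (\<integral>x. (\<Sum>C\<in>children D J. (indicator (cube_set C) x *\<^sub>R h x) \<bullet> (V C - V J)) \<partial>\<mu>)" by simp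
  also have "\<dots> = (\<Sum>C\<in>children D J. (\<integral>x. (indicator (cube_set C) x *\<^sub>R h x) \<bullet> (V C - V J) \<partial>\<mu>))"
    by (intro Bochner_Integration.integral_sum integrable_inner_left child_integrable[OF _ h])
  also have "\<dots> = (\<Sum>C\<in>children D J. (\<integral>x. indicator (cube_set C) x *\<^sub>R h x \<partial>\<mu>) \<bullet> (V C - V J))"
    by (intro sum.cong refl integral_inner_left child_integrable[OF _ h])
  finally show ?thesis .
qed

lemma haar_mean_zero:
  assumes J: "J \<in> D"
  shows "(\<Sum>C\<in>children D J. measure \<mu> (cube_set C) *\<^sub>R (V C - V J)) = 0"
proof -
  have int: "integrable \<mu> (\<lambda>x. indicator (cube_set J) x *\<^sub>R (x - V J))"
    by (rule integrable_indicator_cube[where B = "real CARD('n) * side J + norm (cube_center J) + norm (V J)"])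
      (auto intro!: order_trans[OF norm_triangle_ineq4] add_mono norm_cube_bound)
  have sub: "(\<integral>x. indicator (cube_set C) x *\<^sub>R (x - V J) \<partial>\<mu>) = measure \<mu> (cube_set C) *\<^sub>R (V C - V J)" for C
  proof -
    have "(\<integral>x. indicator (cube_set C) x *\<^sub>R (x - V J) \<partial>\<mu>) =
      (\<integral>x. indicator (cube_set C) x *\<^sub>R x - indicator (cube_set C) x *\<^sub>R V J \<partial>\<mu>)"
      by (simp add: algebra_simps)
    also have "\<dots> = (\<integral>x. indicator (cube_set C) x *\<^sub>R x \<partial>\<mu>) - (\<integral>x. indicator (cube_set C) x *\<^sub>R V J \<partial>\<mu>)"
      by (intro Bochner_Integration.integral_diff integrable_id_cube integrable_indicator_cube[where B = "norm (V J)"]) auto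
    also have "\<dots> = measure \<mu> (cube_set C) *\<^sub>R (V C - V J)"
      unfolding measure_scale_avg[symmetric] integral_const_cube by (simp add: algebra_simps)
    finally show ?thesis .
  qed
  have "(\<Sum>C\<in>children D J. measure \<mu> (cube_set C) *\<^sub>R (V C - V J)) =
      (\<Sum>C\<in>children D J. \<integral>x. indicator (cube_set C) x *\<^sub>R (x - V J) \<partial>\<mu>)"
    by (simp add: sub)
  also have "\<dots> = (\<integral>x. (\<Sum>C\<in>children D J. indicator (cube_set C) x *\<^sub>R (x - V J)) \<partial>\<mu>)"
    by (intro Bochner_Integration.integral_sum[symmetric] child_integrable[OF _ int])
  also have "\<dots> = (\<integral>x. indicator (cube_set J) x *\<^sub>R (x - V J) \<partial>\<mu>)"
    using child_split[OF D J, of _ "\<lambda>x. x - V J"] by simp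
  also have "\<dots> = 0" by (simp add: sub)
  finally show ?thesis .
qed

lemma integrable_haar_cube: "integrable \<mu> (\<lambda>x. indicator (cube_set K) x *\<^sub>R haar J x)"
proof -
  obtain B where "\<forall>x. norm (haar J x) \<le> B" using haar_bounded by blast
  then show ?thesis by (intro integrable_indicator_cube[where B = B]) auto
qed

text \<open>
  On every child of \<open>J\<close> the integrals of \<open>g\<close> and of the Haar difference differ by a fixed vector times the
  measure of the child, and fixed vectors pair to zero with the Haar difference by \<open>haar_mean_zero\<close>.
\<close>

lemma haar_self_pairing:
  assumes J: "J \<in> D" and g: "\<And>x. x \<in> cube_set J \<Longrightarrow> g x = x - v"
  shows "(\<integral>x. g x \<bullet> haar J x \<partial>\<mu>) = (\<integral>x. haar J x \<bullet> haar J x \<partial>\<mu>)"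
proof -
  have intc: "integrable \<mu> (\<lambda>x. indicator (cube_set C) x *\<^sub>R (w :: real ^ 'n))" for C w
    by (intro integrable_indicator_cube[where B = "norm w"]) auto
  have geq: "indicator (cube_set C) x *\<^sub>R g x = indicator (cube_set C) x *\<^sub>R x - indicator (cube_set C) x *\<^sub>R v"
    if "cube_set C \<subseteq> cube_set J" for C x
    using g that by (auto simp: indicator_def)
  have gi: "integrable \<mu> (\<lambda>x. indicator (cube_set J) x *\<^sub>R g x)"
    unfolding geq[OF order_refl] by (intro Bochner_Integration.integrable_diff intc integrable_id_cube)
  have gC: "(\<integral>x. indicator (cube_set C) x *\<^sub>R g x \<partial>\<mu>) = measure \<mu> (cube_set C) *\<^sub>R (V C - v)"
    if "C \<in> children D J" for C
  proof -
    have sub: "cube_set C \<subseteq> cube_set J" using that by (simp add: children_def)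
    have "(\<integral>x. indicator (cube_set C) x *\<^sub>R g x \<partial>\<mu>) =
        (\<integral>x. indicator (cube_set C) x *\<^sub>R x \<partial>\<mu>) - (\<integral>x. indicator (cube_set C) x *\<^sub>R v \<partial>\<mu>)"
      unfolding geq[OF sub] by (intro Bochner_Integration.integral_diff intc integrable_id_cube)
    then show ?thesis unfolding measure_scale_avg[symmetric] integral_const_cube by (simp add: algebra_simps)
  qed
  have hC: "(\<integral>x. indicator (cube_set C) x *\<^sub>R haar J x \<partial>\<mu>) = measure \<mu> (cube_set C) *\<^sub>R (V C - V J)"
    if "C \<in> children D J" for C
  proof -
    have "(\<integral>x. indicator (cube_set C) x *\<^sub>R haar J x \<partial>\<mu>) = (\<integral>x. indicator (cube_set C) x *\<^sub>R (V C - V J) \<partial>\<mu>)"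
      using haar_on_child[OF J that] by (intro Bochner_Integration.integral_cong) (auto simp: indicator_def)
    then show ?thesis unfolding integral_const_cube .
  qed
  have "(\<integral>x. g x \<bullet> haar J x \<partial>\<mu>) - (\<integral>x. haar J x \<bullet> haar J x \<partial>\<mu>) =
     (\<Sum>C\<in>children D J. (measure \<mu> (cube_set C) *\<^sub>R (V C - v)) \<bullet> (V C - V J)) -
     (\<Sum>C\<in>children D J. (measure \<mu> (cube_set C) *\<^sub>R (V C - V J)) \<bullet> (V C - V J))"
    unfolding haar_pairing[OF J gi] haar_pairing[OF J integrable_haar_cube] using gC hC by simp
  also have "\<dots> = (\<Sum>C\<in>children D J. (V J - v) \<bullet> (measure \<mu> (cube_set C) *\<^sub>R (V C - V J)))"
    unfolding sum_subtractf[symmetric] by (intro sum.cong) (simp_all add: inner_diff_left inner_diff_right algebra_simps)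
  also have "\<dots> = (V J - v) \<bullet> (\<Sum>C\<in>children D J. measure \<mu> (cube_set C) *\<^sub>R (V C - V J))"
    by (simp add: inner_sum_right)
  also have "\<dots> = 0" unfolding haar_mean_zero[OF J] by simp
  finally show ?thesis by simp
qed

text \<open>
  On \<open>J\<close> the Haar difference of the larger cube is constant, and the one of \<open>J\<close> has mean zero.
\<close>

lemma haar_orthogonal_nested:
  assumes J: "J \<in> D" and J': "J' \<in> D" and C: "C \<in> children D J'" "cube_set J \<subseteq> cube_set C"
  shows "(\<integral>x. haar J' x \<bullet> haar J x \<partial>\<mu>) = 0"
proof -
  have "(\<integral>x. indicator (cube_set B) x *\<^sub>R haar J' x \<partial>\<mu>) = measure \<mu> (cube_set B) *\<^sub>R (V C - V J')"
    if "B \<in> children D J" for B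
  proof -
    have "cube_set B \<subseteq> cube_set C" using that C by (auto simp: children_def)
    then have "(\<integral>x. indicator (cube_set B) x *\<^sub>R haar J' x \<partial>\<mu>) = (\<integral>x. indicator (cube_set B) x *\<^sub>R (V C - V J') \<partial>\<mu>)"
      using haar_on_child[OF J' C(1)] by (intro Bochner_Integration.integral_cong) (auto simp: indicator_def)
    then show ?thesis unfolding integral_const_cube .
  qed
  then have "(\<integral>x. haar J' x \<bullet> haar J x \<partial>\<mu>) = (\<Sum>B\<in>children D J. (V C - V J') \<bullet> (measure \<mu> (cube_set B) *\<^sub>R (V B - V J)))"
    unfolding haar_pairing[OF J integrable_haar_cube] by (intro sum.cong) simp_all
  also have "\<dots> = (V C - V J') \<bullet> (\<Sum>B\<in>children D J. measure \<mu> (cube_set B) *\<^sub>R (V B - V J))"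
    by (simp add: inner_sum_right)
  finally show ?thesis unfolding haar_mean_zero[OF J] by simp
qed

lemma haar_orthogonal:
  assumes J: "J \<in> D" and J': "J' \<in> D" and ne: "J \<noteq> J'"
  shows "(\<integral>x. haar J x \<bullet> haar J' x \<partial>\<mu>) = 0"
proof -
  have *: "(\<integral>x. haar J' x \<bullet> haar J x \<partial>\<mu>) = 0"
    if J: "J \<in> D" and J': "J' \<in> D" and ne: "J \<noteq> J'" and sub: "cube_set J \<subseteq> cube_set J'" for J J'
  proof -
    have f: "fst J \<in> cube_set J" "fst J \<in> cube_set J'"
      using cube_corner_mem[OF grid_side_pos[OF D J]] sub by auto
    obtain j where j: "side J' = 2 ^ j * side J"
      using grid_side_ratio[OF D J J' cube_subset_side_le[OF grid_side_pos[OF D J] sub]] by blast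
    have "j \<noteq> 0"
    proof
      assume "j = 0"
      then have "side J = side J'" using j by simp
      then show False using grid_same_side[OF D J J' _ f] ne by blast
    qed
    then obtain i where i: "j = Suc i" by (cases j) auto
    obtain C where C: "C \<in> children D J'" "fst J \<in> cube_set C" using grid_children(2)[OF D J'] f by blast
    have "side C = 2 ^ i * side J" using C j i by (simp add: children_def)
    moreover have "(1::real) \<le> 2 ^ i" by simp
    then have "1 * side J \<le> 2 ^ i * side J" using grid_side_pos[OF D J] by (intro mult_right_mono) auto
    ultimately have "cube_set J \<subseteq> cube_set C"
      using C f by (intro grid_nested[OF D J, of C "fst J"]) (auto simp: children_def)
    then show ?thesis using haar_orthogonal_nested[OF J J' C(1)] by blast
  qed
  consider "cube_set J \<subseteq> cube_set J'" | "cube_set J' \<subseteq> cube_set J" | "cube_set J \<inter> cube_set J' = {}"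
    using grid_nested_or_disjoint[OF D J J'] by blast
  then show ?thesis
  proof cases
    case 1 then show ?thesis using *[OF J J' ne] by (simp add: inner_commute)
  next
    case 2 then show ?thesis using *[OF J' J ne[symmetric]] by simp
  next
    case 3
    then have "haar J x \<bullet> haar J' x = 0" for x
      using haar_outside[OF J, of x] haar_outside[OF J', of x] by (metis disjoint_iff inner_zero_left inner_zero_right)
    then show ?thesis by simp
  qed
qed

text \<open>
  At \<open>x\<close> the Haar difference of a cube is the average over the child containing \<open>x\<close> minus the average
  over the cube, so the sum along the chain from \<open>J\<close> down to \<open>Q\<close> telescopes.
\<close>

lemma haar_telescope:
  assumes J: "J \<in> D"
  shows "Q \<in> D \<Longrightarrow> side J = 2 ^ j * side Q \<Longrightarrow> x \<in> cube_set Q \<Longrightarrow> x \<in> cube_set J \<Longrightarrow>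
    (\<Sum>J'\<in>{J' \<in> D. x \<in> cube_set J' \<and> cube_set J' \<subseteq> cube_set J \<and> side Q < side J'}. haar J' x) = V Q - V J"
proof (induction j arbitrary: Q)
  case 0
  then have "Q = J" using grid_same_side[OF D 0(1) J _ 0(3,4)] by simp
  moreover have "\<not> side J < side J'" if "J' \<in> D" "cube_set J' \<subseteq> cube_set J" for J'
    using cube_subset_side_le[OF grid_side_pos[OF D that(1)] that(2)] by simp
  then have "{J' \<in> D. x \<in> cube_set J' \<and> cube_set J' \<subseteq> cube_set J \<and> side J < side J'} = {}"
    by blast
  ultimately show ?case by (simp only: sum.empty diff_self)
next
  case (Suc j)
  obtain P where P: "P \<in> D" "side P = 2 * side Q" "cube_set Q \<subseteq> cube_set P" using grid_parent[OF D Suc.prems(1)] .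
  have posQ: "0 < side Q" using grid_side_pos[OF D Suc.prems(1)] .
  have xP: "x \<in> cube_set P" using P Suc.prems by blast
  have sJ: "side J = 2 ^ j * side P" using P Suc.prems by simp
  have "(1::real) \<le> 2 ^ j" by simp
  then have "1 * side P \<le> 2 ^ j * side P" using P posQ by (intro mult_right_mono) auto
  then have PJ: "cube_set P \<subseteq> cube_set J" using grid_nested[OF D P(1) J _ xP Suc.prems(4)] sJ by simp
  let ?B = "\<lambda>Q. {J' \<in> D. x \<in> cube_set J' \<and> cube_set J' \<subseteq> cube_set J \<and> side Q < side J'}"
  have "?B Q = insert P (?B P)"
  proof (intro set_eqI iffI)
    fix J' assume a: "J' \<in> ?B Q"
    then have J': "J' \<in> D" "x \<in> cube_set J'" "cube_set J' \<subseteq> cube_set J" "side Q < side J'" by auto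
    obtain i where i: "side J' = 2 ^ i * side Q"
      using grid_side_ratio[OF D Suc.prems(1) J'(1)] J'(4) by (metis less_imp_le)
    have "i \<noteq> 0" using i J'(4) by (cases i) auto
    then obtain i' where "i = Suc i'" by (cases i) auto
    then have i': "side J' = 2 ^ i' * side P" using i P by simp
    show "J' \<in> insert P (?B P)"
    proof (cases "i' = 0")
      case True
      then have "J' = P" using grid_same_side[OF D J'(1) P(1) _ J'(2) xP] i' by simp
      then show ?thesis by simp
    next
      case False
      then have "(1::real) < 2 ^ i'" by simp
      then have "side P < side J'" using i' P(2) posQ by simp
      then show ?thesis using J' by simp
    qed
  next
    fix J' assume "J' \<in> insert P (?B P)"
    then show "J' \<in> ?B Q" using P xP PJ posQ by auto
  qed
  moreover have "P \<notin> ?B P" by simp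
  moreover have "finite (?B P)"
  proof (rule finite_subset[OF _ finite_grid_subcubes[OF D J, of j]])
    show "?B P \<subseteq> {J' \<in> D. cube_set J' \<subseteq> cube_set J \<and> side J \<le> 2 ^ j * side J'}" using sJ by auto
  qed
  ultimately have "(\<Sum>J'\<in>?B Q. haar J' x) = haar P x + (\<Sum>J'\<in>?B P. haar J' x)" by simp
  also have "(\<Sum>J'\<in>?B P. haar J' x) = V P - V J" by (rule Suc.IH[OF P(1) sJ xP Suc.prems(4)])
  also have "haar P x = V Q - V P"
    using Suc.prems(1,3) P by (intro haar_on_child) (auto simp: children_def)
  finally show ?case by simp
qed

end

end


text \<open>
  The partial sum over all cubes of side at least \<open>2^(-N) side K\<close> is, at a point of \<open>J0\<close>, the average over
  a cube of side \<open>2^(-N - 1) side K\<close> minus the average over \<open>J0\<close>; it is zero when \<open>J0\<close> itself is too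
  small. In both cases the remainder is the deviation of \<open>x\<close> from the average over a cube that contains
  \<open>x\<close> and has side at most \<open>2^(-N) side K\<close>.
\<close>

lemma haar_partial_sum:
  fixes D :: "'n::finite cube set" and \<mu> :: "(real ^ 'n) measure"
  assumes D: "dyadic_grid D" and \<mu>: "locally_finite_borel \<mu>" and K: "K \<in> D"
    and M: "M \<subseteq> {J \<in> D. cube_set J \<subseteq> cube_set K}"
    and disj: "disjoint_family_on cube_set M"
    and J0: "J0 \<in> M" "x \<in> cube_set J0"
    and pos: "\<And>Q. Q \<in> D \<Longrightarrow> cube_set Q \<subseteq> cube_set K \<Longrightarrow> x \<in> cube_set Q \<Longrightarrow> measure \<mu> (cube_set Q) \<noteq> 0"
    and F: "F = {(J, J'). J \<in> M \<and> J' \<in> D \<and> cube_set J' \<subseteq> cube_set J \<and> side K \<le> 2 ^ N * side J'}" "finite F"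
  shows "norm (x - cube_avg \<mu> J0 (\<lambda>x. x) - (\<Sum>(J, J')\<in>F. haar_diff D \<mu> J' (\<lambda>x. x) x))
           \<le> real CARD('n) * (side K / 2 ^ N)"
proof -
  have J0D: "J0 \<in> D" and J0K: "cube_set J0 \<subseteq> cube_set K" using M J0 by auto
  have xK: "x \<in> cube_set K" using J0 J0K by auto
  define B where "B = {J' \<in> D. x \<in> cube_set J' \<and> cube_set J' \<subseteq> cube_set J0 \<and> side K \<le> 2 ^ N * side J'}"
  have "(\<Sum>(J, J')\<in>F. haar_diff D \<mu> J' (\<lambda>x. x) x) = (\<Sum>(J, J')\<in>Pair J0 ` B. haar_diff D \<mu> J' (\<lambda>x. x) x)"
  proof (rule sum.mono_neutral_right[OF F(2)])
    show "Pair J0 ` B \<subseteq> F" using J0 by (auto simp: F(1) B_def)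
    have "haar_diff D \<mu> J' (\<lambda>x. x) x = 0" if i: "(J, J') \<in> F" "(J, J') \<notin> Pair J0 ` B" for J J'
    proof (rule haar_outside[OF \<mu> D])
      show "J' \<in> D" using i by (simp add: F(1))
      show "x \<notin> cube_set J'"
      proof
        assume x: "x \<in> cube_set J'"
        then have "x \<in> cube_set J" using i by (auto simp: F(1))
        then have "J = J0" using disj J0 i by (auto simp: F(1) disjoint_family_on_def)
        then show False using i x by (auto simp: F(1) B_def)
      qed
    qed
    then show "\<forall>i\<in>F - Pair J0 ` B. (case i of (J, J') \<Rightarrow> haar_diff D \<mu> J' (\<lambda>x. x) x) = 0" by fastforce
  qed
  also have "\<dots> = (\<Sum>J'\<in>B. haar_diff D \<mu> J' (\<lambda>x. x) x)"
    by (subst sum.reindex) (auto simp: inj_on_def)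
  finally have sum_eq: "(\<Sum>(J, J')\<in>F. haar_diff D \<mu> J' (\<lambda>x. x) x) = (\<Sum>J'\<in>B. haar_diff D \<mu> J' (\<lambda>x. x) x)" .
  show ?thesis
  proof (cases "side K \<le> 2 ^ N * side J0")
    case False
    have "B = {}"
    proof -
      have "\<not> side K \<le> 2 ^ N * side J'" if "J' \<in> D" "cube_set J' \<subseteq> cube_set J0" for J'
      proof -
        have "side J' \<le> side J0" using cube_subset_side_le[OF grid_side_pos[OF D that(1)] that(2)] .
        then have "2 ^ N * side J' \<le> 2 ^ N * side J0" by simp
        then show ?thesis using False by linarith
      qed
      then show ?thesis by (auto simp: B_def)
    qed
    then have z: "(\<Sum>(J, J')\<in>F. haar_diff D \<mu> J' (\<lambda>x. x) x) = 0" using sum_eq by simp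
    have "norm (x - cube_avg \<mu> J0 (\<lambda>x. x)) \<le> real CARD('n) * side J0"
      by (rule avg_dist_le[OF \<mu> J0(2) pos[OF J0D J0K J0(2)]])
    also have "\<dots> \<le> real CARD('n) * (side K / 2 ^ N)"
      using False by (intro mult_left_mono) (auto simp: field_simps)
    finally show ?thesis using z by simp
  next
    case True
    obtain k :: int where k: "side K = 2 powi k" using grid_side_powi[OF D K] by blast
    obtain Q where Q: "Q \<in> D" "side Q = 2 powi (k - int (Suc N))" "x \<in> cube_set Q" using grid_point[OF D] by metis
    have sQ: "side K = 2 ^ Suc N * side Q"
      by (simp add: Q(2) k power_int_diff del: power_Suc of_nat_Suc)
    have posQ: "0 < side Q" using grid_side_pos[OF D Q(1)] .
    have half: "2 * side Q \<le> side J' \<longleftrightarrow> side K \<le> 2 ^ N * side J'" for J' :: "'n cube"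
      using sQ by simp
    have Q_le: "2 * side Q \<le> side J0" using True half by blast
    then obtain j where j: "side J0 = 2 ^ j * side Q" using grid_side_ratio[OF D Q(1) J0D] posQ by auto
    have "B = {J' \<in> D. x \<in> cube_set J' \<and> cube_set J' \<subseteq> cube_set J0 \<and> side Q < side J'}"
    proof -
      have "side K \<le> 2 ^ N * side J' \<longleftrightarrow> side Q < side J'" if J': "J' \<in> D" for J'
      proof
        assume "side K \<le> 2 ^ N * side J'"
        then have "2 * side Q \<le> side J'" using half by blast
        then show "side Q < side J'" using posQ by simp
      next
        assume less: "side Q < side J'"
        then obtain i where i: "side J' = 2 ^ i * side Q" using grid_side_ratio[OF D Q(1) J'] by auto
        with less have "i \<noteq> 0" by (cases i) auto
        then have "(2::real) ^ 1 \<le> 2 ^ i" by (intro power_increasing) auto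
        then have "2 * side Q \<le> side J'" using i posQ by simp
        then show "side K \<le> 2 ^ N * side J'" using half by blast
      qed
      then show ?thesis by (auto simp: B_def)
    qed
    then have "(\<Sum>(J, J')\<in>F. haar_diff D \<mu> J' (\<lambda>x. x) x) = cube_avg \<mu> Q (\<lambda>x. x) - cube_avg \<mu> J0 (\<lambda>x. x)"
      using sum_eq haar_telescope[OF \<mu> D J0D Q(1) j Q(3) J0(2)] by simp
    then have "norm (x - cube_avg \<mu> J0 (\<lambda>x. x) - (\<Sum>(J, J')\<in>F. haar_diff D \<mu> J' (\<lambda>x. x) x)) = norm (x - cube_avg \<mu> Q (\<lambda>x. x))"
      by simp
    also have "\<dots> \<le> real CARD('n) * side Q"
    proof (rule avg_dist_le[OF \<mu> Q(3)], rule pos[OF Q(1) _ Q(3)])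
      have "side Q \<le> side K" using half[of K] Q_le cube_subset_side_le[OF grid_side_pos[OF D J0D] J0K] posQ by simp
      then show "cube_set Q \<subseteq> cube_set K" by (rule grid_nested[OF D Q(1) K _ Q(3) xK])
    qed
    also have "\<dots> \<le> real CARD('n) * (side K / 2 ^ N)"
      using sQ posQ by (intro mult_left_mono) auto
    finally show ?thesis .
  qed
qed

text \<open>
  The limit of the Haar sum over the subcubes of the cubes of a disjoint family \<open>M\<close>: on every member of
  \<open>M\<close> the identity map minus its average there.
\<close>

definition deviation :: "(real ^ 'n::finite) measure \<Rightarrow> 'n cube set \<Rightarrow> real ^ 'n \<Rightarrow> real ^ 'n" where
  "deviation \<mu> M x =
     (if \<exists>J\<in>M. x \<in> cube_set J
      then x - cube_avg \<mu> (THE J. J \<in> M \<and> x \<in> cube_set J) (\<lambda>x. x) else 0)"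

lemma deviation_on:
  assumes "disjoint_family_on cube_set M" and J: "J \<in> M" "x \<in> cube_set J"
  shows "deviation \<mu> M x = x - cube_avg \<mu> J (\<lambda>x. x)"
proof -
  have "(THE J. J \<in> M \<and> x \<in> cube_set J) = J"
    using assms unfolding disjoint_family_on_def by (intro the_equality) (blast | metis disjoint_iff)+
  then show ?thesis using J by (auto simp: deviation_def)
qed

lemma deviation_off: "(\<And>J. J \<in> M \<Longrightarrow> x \<notin> cube_set J) \<Longrightarrow> deviation \<mu> M x = 0"
  by (auto simp: deviation_def)

text \<open>
  Only finitely many members of \<open>M\<close> have side at least \<open>2^(-N) side K\<close>; the function is the pointwise
  limit of its restrictions to their unions.
\<close>

lemma deviation_measurable:
  fixes D :: "'n::finite cube set"
  assumes D: "dyadic_grid D" and K: "K \<in> D" and M: "M \<subseteq> {J \<in> D. cube_set J \<subseteq> cube_set K}"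
    and disj: "disjoint_family_on cube_set M"
  shows "deviation \<mu> M \<in> borel_measurable borel"
proof -
  let ?V = "\<lambda>J. cube_avg \<mu> J (\<lambda>x. x)"
  define MN where "MN = (\<lambda>N. {J \<in> M. side K \<le> 2 ^ N * side J})"
  have MD: "J \<in> D" "cube_set J \<subseteq> cube_set K" if "J \<in> M" for J using M that by auto
  have finMN: "finite (MN N)" for N
    by (rule finite_subset[OF _ finite_grid_subcubes[OF D K, of N]]) (use MD in \<open>unfold MN_def, blast\<close>)
  show ?thesis
  proof (rule borel_measurable_LIMSEQ_metric)
    fix N
    show "(\<lambda>x. \<Sum>J\<in>MN N. indicator (cube_set J) x *\<^sub>R (x - ?V J)) \<in> borel_measurable borel" by measurable
  next
    fix x
    show "(\<lambda>N. \<Sum>J\<in>MN N. indicator (cube_set J) x *\<^sub>R (x - ?V J)) \<longlonglongrightarrow> deviation \<mu> M x"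
    proof (cases "\<exists>J\<in>M. x \<in> cube_set J")
      case False
      then have "indicator (cube_set J) x *\<^sub>R (x - ?V J) = 0" if "J \<in> M" for J
        using that by (auto simp: indicator_def)
      then have "(\<Sum>J\<in>MN N. indicator (cube_set J) x *\<^sub>R (x - ?V J)) = 0" for N
        by (intro sum.neutral) (auto simp: MN_def)
      then show ?thesis using deviation_off[of M x \<mu>] False by simp
    next
      case True
      then obtain J where J: "J \<in> M" "x \<in> cube_set J" by blast
      obtain j where j: "side K = 2 ^ j * side J"
        using grid_side_ratio[OF D MD(1)[OF J(1)] K] cube_subset_side_le[OF grid_side_pos[OF D MD(1)[OF J(1)]] MD(2)[OF J(1)]] by metis
      have "(\<Sum>J\<in>MN N. indicator (cube_set J) x *\<^sub>R (x - ?V J)) = deviation \<mu> M x" if N: "j \<le> N" for N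
      proof -
        have "(2::real) ^ j \<le> 2 ^ N" using N by (intro power_increasing) auto
        then have "side K \<le> 2 ^ N * side J"
          using j grid_side_pos[OF D MD(1)[OF J(1)]] by simp
        then have JN: "J \<in> MN N" using J by (simp add: MN_def)
        have "(\<Sum>J\<in>MN N. indicator (cube_set J) x *\<^sub>R (x - ?V J)) = (\<Sum>J\<in>{J}. indicator (cube_set J) x *\<^sub>R (x - ?V J))"
        proof (rule sum.mono_neutral_right[OF finMN])
          show "\<forall>J'\<in>MN N - {J}. indicator (cube_set J') x *\<^sub>R (x - ?V J') = 0"
          proof
            fix J' assume J': "J' \<in> MN N - {J}"
            then have "x \<notin> cube_set J'" using disj J unfolding MN_def disjoint_family_on_def by blast
            then show "indicator (cube_set J') x *\<^sub>R (x - ?V J') = 0" by simp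
          qed
        qed (use JN in auto)
        then show ?thesis using J deviation_on[OF disj J] by simp
      qed
      then have "eventually (\<lambda>N. (\<Sum>J\<in>MN N. indicator (cube_set J) x *\<^sub>R (x - ?V J)) = deviation \<mu> M x) sequentially"
        using eventually_sequentially by blast
      then show ?thesis by (rule tendsto_eventually)
    qed
  qed
qed

lemma deviation_bound:
  fixes D :: "'n::finite cube set"
  assumes D: "dyadic_grid D" and \<mu>: "locally_finite_borel \<mu>" and K: "K \<in> D"
    and M: "M \<subseteq> {J \<in> D. cube_set J \<subseteq> cube_set K}" and disj: "disjoint_family_on cube_set M"
  shows "norm (deviation \<mu> M x) \<le> real CARD('n) * side K + norm (cube_center K)"
proof (cases "\<exists>J\<in>M. x \<in> cube_set J")
  case False
  then show ?thesis using deviation_off[of M x \<mu>] grid_side_pos[OF D K] by auto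
next
  case True
  then obtain J where J: "J \<in> M" "x \<in> cube_set J" by blast
  have JD: "J \<in> D" "cube_set J \<subseteq> cube_set K" using J(1) M by auto
  from J have xK: "x \<in> cube_set K" using M by blast
  show ?thesis
  proof (cases "measure \<mu> (cube_set J) = 0")
    case True
    then have "cube_avg \<mu> J (\<lambda>x. x) = 0" by (simp add: cube_avg_def vec_eq_iff)
    then show ?thesis using deviation_on[OF disj J] norm_cube_bound[OF xK] by simp
  next
    case False
    have "norm (deviation \<mu> M x) \<le> real CARD('n) * side J" unfolding deviation_on[OF disj J] by (rule avg_dist_le[OF \<mu> J(2) False])
    also have "\<dots> \<le> real CARD('n) * side K"
      using cube_subset_side_le[OF grid_side_pos[OF D JD(1)] JD(2)] by (intro mult_left_mono) auto
    finally show ?thesis by (smt (verit) norm_ge_zero)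
  qed
qed

text \<open>
  Both the deviation from the averages on the members of \<open>M\<close> and the function \<open>x - z\<close> on \<open>K\<close> have the Haar
  differences as their projections, because on each cube involved they are the identity map up to a
  constant. The first is the limit of the Haar sum, the second supplies the upper bound.
\<close>

lemma haar_sum_energy_le:
  fixes D :: "'n::finite cube set" and \<mu> :: "(real ^ 'n) measure"
  assumes D: "dyadic_grid D" and \<mu>: "locally_finite_borel \<mu>" and K: "K \<in> D"
    and M: "M \<subseteq> {J \<in> D. cube_set J \<subseteq> cube_set K}" and disj: "disjoint_family_on cube_set M"
  shows "L2_norm_sq \<mu> (L2_sum \<mu> (\<lambda>(J, J'). haar_diff D \<mu> J' (\<lambda>x. x)) (SIGMA J:M. {J'\<in>D. cube_set J' \<subseteq> cube_set J}))
           \<le> (\<integral>\<^sup>+x\<in>cube_set K. ennreal ((norm (x - z))\<^sup>2) \<partial>\<mu>)"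
proof -
  define A where "A = (SIGMA J:M. {J'\<in>D. cube_set J' \<subseteq> cube_set J})"
  define f where "f = (\<lambda>(J :: 'n cube, J'). haar_diff D \<mu> J' (\<lambda>x. x))"
  define FN where "FN = (\<lambda>N. {(J, J'). J \<in> M \<and> J' \<in> D \<and> cube_set J' \<subseteq> cube_set J \<and> side K \<le> 2 ^ N * side J'})"
  define g where "g = deviation \<mu> M"
  note [measurable_cong] = locally_finite_sets[OF \<mu>]
  have MD: "J \<in> D" "cube_set J \<subseteq> cube_set K" if "J \<in> M" for J using M that by auto
  have gJ: "g x = x - cube_avg \<mu> J (\<lambda>x. x)" if "J \<in> M" "x \<in> cube_set J" for x J
    unfolding g_def by (rule deviation_on[OF disj that])
  have g0: "g x = 0" if "\<And>J. J \<in> M \<Longrightarrow> x \<notin> cube_set J" for x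
    unfolding g_def by (rule deviation_off[OF that])
  have finFN: "finite (FN N)" for N
  proof (rule finite_subset)
    let ?S = "{J \<in> D. cube_set J \<subseteq> cube_set K \<and> side K \<le> 2 ^ N * side J}"
    show "finite (?S \<times> ?S)" using finite_grid_subcubes[OF D K] by blast
    show "FN N \<subseteq> ?S \<times> ?S"
    proof
      fix p assume "p \<in> FN N"
      then obtain J J' where p: "p = (J, J')" "J \<in> M" "J' \<in> D" "cube_set J' \<subseteq> cube_set J" "side K \<le> 2 ^ N * side J'"
        by (auto simp: FN_def)
      have "side J' \<le> side J" using cube_subset_side_le[OF grid_side_pos[OF D p(3)] p(4)] .
      then have "2 ^ N * side J' \<le> 2 ^ N * side J" by simp
      then have "side K \<le> 2 ^ N * side J" using p by linarith
      then show "p \<in> ?S \<times> ?S" using p MD[OF p(2)] by auto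
    qed
  qed
  have FNA: "FN N \<subseteq> A" for N by (auto simp: FN_def A_def)
  have g_meas [measurable]: "g \<in> borel_measurable borel"
    unfolding g_def by (rule deviation_measurable[OF D K M disj])
  have gK: "g x = 0" if "x \<notin> cube_set K" for x
    using g0 MD(2) that by blast
  define Bg where "Bg = real CARD('n) * side K + norm (cube_center K)"
  have Bg: "norm (g x) \<le> Bg" for x
    unfolding g_def Bg_def by (rule deviation_bound[OF D \<mu> K M disj])
  define h where "h = (\<lambda>x. indicator (cube_set K) x *\<^sub>R (x - z))"
  have h_meas [measurable]: "h \<in> borel_measurable borel" unfolding h_def by measurable
  have hK: "h x = 0" if "x \<notin> cube_set K" for x using that by (simp add: h_def)
  have Bh: "norm (h x) \<le> Bg + norm z" for x
  proof (cases "x \<in> cube_set K")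
    case True
    then show ?thesis using norm_cube_bound[OF True] norm_triangle_ineq4[of x z] by (simp add: h_def Bg_def)
  next
    case False
    have "0 \<le> Bg" using Bg[of x] norm_ge_zero order_trans by blast
    then show ?thesis using hK[OF False] by simp
  qed
  have f_meas [measurable]: "f i \<in> borel_measurable borel" for i
    unfolding f_def by (cases i) (simp add: haar_measurable[OF \<mu> D])
  have fb: "\<exists>B. \<forall>x. norm (f i x) \<le> B" for i
    unfolding f_def using haar_bounded[OF \<mu> D] by (cases i) auto
  have fK: "f i x = 0" if "i \<in> A" "x \<notin> cube_set K" for i x
  proof -
    obtain J J' where i: "i = (J, J')" by (cases i)
    then have "J \<in> M" "J' \<in> D" "cube_set J' \<subseteq> cube_set J" using that by (auto simp: A_def)
    then show ?thesis using MD[of J] that by (auto simp: f_def i intro!: haar_outside[OF \<mu> D])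
  qed
  have intprod: "integrable \<mu> (\<lambda>x. u x \<bullet> v x)"
    if [measurable]: "u \<in> borel_measurable borel" "v \<in> borel_measurable borel"
      and u: "\<exists>B. \<forall>x. norm (u x) \<le> B" and v: "\<exists>B. \<forall>x. norm (v x) \<le> B" and uK: "\<And>x. x \<notin> cube_set K \<Longrightarrow> u x = 0"
    for u v :: "real ^ 'n \<Rightarrow> real ^ 'n"
  proof -
    obtain B B' where B: "\<And>x. norm (u x) \<le> B" "\<And>x. norm (v x) \<le> B'" using u v by blast
    show ?thesis
    proof (rule integrable_bounded_cube[OF \<mu>, where K = K and B = "B * B'"])
      show "norm (u x \<bullet> v x) \<le> B * B'" for x
        using Cauchy_Schwarz_ineq2[of "u x" "v x"] mult_mono[OF B(1)[of x] B(2)[of x]] B(1)[of x]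
          norm_ge_zero[of "u x"] by (smt (verit) norm_ge_zero real_norm_def)
    qed (use uK in auto)
  qed
  have orth: "(\<integral>x. f i x \<bullet> f j x \<partial>\<mu>) = 0" if "i \<in> A" "j \<in> A" "i \<noteq> j" for i j
  proof -
    obtain I I' J J' where ij: "i = (I, I')" "j = (J, J')" by (cases i, cases j)
    have *: "I \<in> M" "I' \<in> D" "cube_set I' \<subseteq> cube_set I" "J \<in> M" "J' \<in> D" "cube_set J' \<subseteq> cube_set J"
      using that by (auto simp: A_def ij)
    have "I' \<noteq> J'"
    proof
      assume e: "I' = J'"
      then have "fst I' \<in> cube_set I \<inter> cube_set J"
        using * cube_corner_mem[OF grid_side_pos[OF D *(2)]] by auto
      then have "I = J" using disj *(1,4) unfolding disjoint_family_on_def by blast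
      then show False using e ij that by simp
    qed
    then show ?thesis unfolding f_def ij using haar_orthogonal[OF \<mu> D *(2,5)] by simp
  qed
  have self: "(\<integral>x. u x \<bullet> f i x \<partial>\<mu>) = (\<integral>x. f i x \<bullet> f i x \<partial>\<mu>)"
    if i: "i \<in> A" and u: "\<And>J. J \<in> M \<Longrightarrow> \<exists>v. \<forall>x\<in>cube_set J. u x = x - v" for i u
  proof -
    obtain J J' where ij: "i = (J, J')" by (cases i)
    have *: "J \<in> M" "J' \<in> D" "cube_set J' \<subseteq> cube_set J" using that by (auto simp: A_def ij)
    obtain v where "\<forall>x\<in>cube_set J. u x = x - v" using u[OF *(1)] by blast
    then have "u x = x - v" if "x \<in> cube_set J'" for x using * that by blast
    then show ?thesis unfolding f_def ij using haar_self_pairing[OF \<mu> D *(2)] by simp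
  qed
  have selfg: "(\<integral>x. g x \<bullet> f i x \<partial>\<mu>) = (\<integral>x. f i x \<bullet> f i x \<partial>\<mu>)" if "i \<in> A" for i
    by (rule self[OF that]) (use gJ in blast)
  have selfh: "(\<integral>x. h x \<bullet> f i x \<partial>\<mu>) = (\<integral>x. f i x \<bullet> f i x \<partial>\<mu>)" if "i \<in> A" for i
  proof (rule self[OF that])
    fix J assume "J \<in> M"
    then have "\<forall>x\<in>cube_set J. h x = x - z" using MD(2)[of J] by (auto simp: h_def indicator_def)
    then show "\<exists>v. \<forall>x\<in>cube_set J. h x = x - v" by blast
  qed
  have int_ff: "integrable \<mu> (\<lambda>x. f i x \<bullet> f j x)" if "i \<in> A" for i j
    by (rule intprod[OF f_meas f_meas fb fb fK[OF that]])
  have int_g: "integrable \<mu> (\<lambda>x. g x \<bullet> g x)" "integrable \<mu> (\<lambda>x. g x \<bullet> f i x)" for i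
    using Bg by (intro intprod[OF g_meas _ _ _ gK] g_meas f_meas fb; blast)+
  have int_h: "integrable \<mu> (\<lambda>x. h x \<bullet> h x)" "integrable \<mu> (\<lambda>x. h x \<bullet> f i x)" for i
    using Bh by (intro intprod[OF h_meas _ _ _ hK] h_meas f_meas fb; blast)+
  \<comment> \<open>Points of null cubes have to be discarded, since the average over a null cube is set to \<open>0\<close>.\<close>
  have AEpos: "AE x in \<mu>. \<forall>Q\<in>{Q \<in> D. cube_set Q \<subseteq> cube_set K}. x \<in> cube_set Q \<longrightarrow> measure \<mu> (cube_set Q) \<noteq> 0"
  proof (subst AE_ball_countable)
    have "{Q \<in> D. cube_set Q \<subseteq> cube_set K} \<subseteq> (\<Union>j. {J \<in> D. cube_set J \<subseteq> cube_set K \<and> side K \<le> 2 ^ j * side J})"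
    proof
      fix Q assume Q: "Q \<in> {Q \<in> D. cube_set Q \<subseteq> cube_set K}"
      then have "side Q \<le> side K" using cube_subset_side_le[OF grid_side_pos[OF D]] by blast
      then obtain j where "side K = 2 ^ j * side Q" using grid_side_ratio[OF D _ K] Q by blast
      then show "Q \<in> (\<Union>j. {J \<in> D. cube_set J \<subseteq> cube_set K \<and> side K \<le> 2 ^ j * side J})" using Q by auto
    qed
    moreover have "countable (\<Union>j. {J \<in> D. cube_set J \<subseteq> cube_set K \<and> side K \<le> 2 ^ j * side J})"
      using finite_grid_subcubes[OF D K] by (intro countable_UN) (auto intro: countable_finite)
    ultimately show "countable {Q \<in> D. cube_set Q \<subseteq> cube_set K}" by (rule countable_subset)
    show "\<forall>Q\<in>{Q \<in> D. cube_set Q \<subseteq> cube_set K}. AE x in \<mu>. x \<in> cube_set Q \<longrightarrow> measure \<mu> (cube_set Q) \<noteq> 0"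
    proof
      fix Q
      show "AE x in \<mu>. x \<in> cube_set Q \<longrightarrow> measure \<mu> (cube_set Q) \<noteq> 0"
      proof (cases "measure \<mu> (cube_set Q) = 0")
        case True
        then have "emeasure \<mu> (cube_set Q) = 0"
          using emeasure_cube_finite[OF \<mu>, of Q] by (auto simp: measure_def enn2real_eq_0_iff)
        then have "AE x in \<mu>. x \<notin> cube_set Q"
          by (intro AE_not_in) (simp add: null_sets_def locally_finite_sets[OF \<mu>])
        then show ?thesis by eventually_elim simp
      qed simp
    qed
  qed
  have e_le: "(\<integral>x. (norm (g x - (\<Sum>i\<in>FN N. f i x)))\<^sup>2 \<partial>\<mu>)
      \<le> (real CARD('n) * (side K / 2 ^ N))\<^sup>2 * measure \<mu> (cube_set K)" for N
  proof -
    let ?c = "(real CARD('n) * (side K / 2 ^ N))\<^sup>2"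
    have "(\<integral>x. (norm (g x - (\<Sum>i\<in>FN N. f i x)))\<^sup>2 \<partial>\<mu>) \<le> (\<integral>x. indicator (cube_set K) x *\<^sub>R ?c \<partial>\<mu>)"
    proof (rule integral_mono_AE)
      show "integrable \<mu> (\<lambda>x. (norm (g x - (\<Sum>i\<in>FN N. f i x)))\<^sup>2)"
        by (rule bessel_identity(1)[OF finFN int_g];
            (assumption | rule int_ff orth selfg subsetD[OF FNA])+)
      show "integrable \<mu> (\<lambda>x. indicator (cube_set K) x *\<^sub>R ?c)"
        by (intro integrable_indicator_cube[OF \<mu>, where B = "\<bar>?c\<bar>"]) auto
      show "AE x in \<mu>. (norm (g x - (\<Sum>i\<in>FN N. f i x)))\<^sup>2 \<le> indicator (cube_set K) x *\<^sub>R ?c"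
        using AEpos
      proof eventually_elim
        case (elim x)
        show ?case
        proof (cases "\<exists>J\<in>M. x \<in> cube_set J")
          case False
          have "f i x = 0" if "i \<in> FN N" for i
          proof -
            obtain J J' where i: "i = (J, J')" by (cases i)
            then have "J \<in> M" "J' \<in> D" "cube_set J' \<subseteq> cube_set J" using that by (auto simp: FN_def)
            then show ?thesis using False by (auto simp: f_def i intro!: haar_outside[OF \<mu> D])
          qed
          then have "(\<Sum>i\<in>FN N. f i x) = 0" by (intro sum.neutral) auto
          then show ?thesis using False g0[of x] by simp
        next
          case True
          then obtain J where J: "J \<in> M" "x \<in> cube_set J" by blast
          have "norm (x - cube_avg \<mu> J (\<lambda>x. x) - (\<Sum>(J, J')\<in>FN N. haar_diff D \<mu> J' (\<lambda>x. x) x))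
              \<le> real CARD('n) * (side K / 2 ^ N)"
            by (rule haar_partial_sum[OF D \<mu> K M disj J _ _ finFN]) (use elim in \<open>auto simp: FN_def\<close>)
          moreover have "(\<Sum>(J, J')\<in>FN N. haar_diff D \<mu> J' (\<lambda>x. x) x) = (\<Sum>i\<in>FN N. f i x)"
            by (intro sum.cong) (auto simp: f_def)
          ultimately have "norm (g x - (\<Sum>i\<in>FN N. f i x)) \<le> real CARD('n) * (side K / 2 ^ N)"
            by (simp add: gJ[OF J])
          moreover have "x \<in> cube_set K" using J MD by blast
          ultimately show ?thesis by (simp add: power_mono)
        qed
      qed
    qed
    also have "\<dots> = ?c * measure \<mu> (cube_set K)"
      using emeasure_cube_finite[OF \<mu>, of K] by (simp add: locally_finite_sets[OF \<mu>])
    finally show ?thesis .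
  qed
  have lim0: "(\<lambda>N. (real CARD('n) * (side K / 2 ^ N))\<^sup>2 * measure \<mu> (cube_set K)) \<longlonglongrightarrow> 0"
  proof -
    have "(\<lambda>N. (real CARD('n) * (side K * (1 / 2) ^ N))\<^sup>2 * measure \<mu> (cube_set K)) \<longlonglongrightarrow> (real CARD('n) * (side K * 0))\<^sup>2 * measure \<mu> (cube_set K)"
      by (intro tendsto_intros LIMSEQ_power_zero) auto
    then show ?thesis by (simp add: power_divide)
  qed
  have lime: "(\<lambda>N. \<integral>x. (norm (g x - (\<Sum>i\<in>FN N. f i x)))\<^sup>2 \<partial>\<mu>) \<longlonglongrightarrow> 0"
  proof (rule tendsto_sandwich[OF _ _ tendsto_const lim0])
    show "\<forall>\<^sub>F N in sequentially. 0 \<le> (\<integral>x. (norm (g x - (\<Sum>i\<in>FN N. f i x)))\<^sup>2 \<partial>\<mu>)" by simp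
    show "\<forall>\<^sub>F N in sequentially. (\<integral>x. (norm (g x - (\<Sum>i\<in>FN N. f i x)))\<^sup>2 \<partial>\<mu>)
        \<le> (real CARD('n) * (side K / 2 ^ N))\<^sup>2 * measure \<mu> (cube_set K)"
      using e_le by (intro always_eventually allI)
  qed
  have "L2_norm_sq \<mu> (L2_sum \<mu> f A) \<le> ennreal (\<integral>x. (norm (h x))\<^sup>2 \<partial>\<mu>)"
    by (rule orthogonal_L2_sum_le[OF _ _ int_ff int_g int_h orth selfg selfh finFN FNA lime];
        (assumption | simp only: measurable_cong_sets[OF locally_finite_sets[OF \<mu>] refl] f_meas g_meas))
  also have "\<dots> = (\<integral>\<^sup>+x. ennreal ((norm (h x))\<^sup>2) \<partial>\<mu>)"
    using int_h(1) by (intro nn_integral_eq_integral[symmetric]) (auto simp: power2_norm_eq_inner)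
  also have "\<dots> = (\<integral>\<^sup>+x\<in>cube_set K. ennreal ((norm (x - z))\<^sup>2) \<partial>\<mu>)"
    by (intro nn_integral_cong) (auto simp: h_def indicator_def)
  finally show ?thesis unfolding A_def f_def .
qed

text \<open>
  The projection is controlled by the deviation from an arbitrary point \<open>z\<close>. What the maximal good cubes contribute is that they are
  disjoint grid cubes inside \<open>K\<close>.
\<close>

lemma subgood_energy_le:
  fixes D :: "'n::finite cube set"
  assumes D: "dyadic_grid D" and \<mu>: "locally_finite_borel \<mu>" and K: "K \<in> D"
  shows "L2_norm_sq \<mu> (subgood_proj D r \<epsilon> \<mu> K (\<lambda>x. x)) \<le> (\<integral>\<^sup>+x\<in>cube_set K. ennreal ((norm (x - z))\<^sup>2) \<partial>\<mu>)"
  unfolding subgood_proj_def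
proof (rule haar_sum_energy_le[OF D \<mu> K])
  show "M_good D r \<epsilon> K \<subseteq> {J \<in> D. cube_set J \<subseteq> cube_set K}"
    by (auto simp: M_good_def maximal_cubes_def)
  show "disjoint_family_on cube_set (M_good D r \<epsilon> K)"
    unfolding disjoint_family_on_def M_good_def by (intro ballI impI maximal_cubes_disjoint[OF D]) auto
qed


section \<open>Bounded overlap of the dilated deeply embedded cubes\<close>

text \<open>
  The depth \<open>r\<close> is so large that the distance of a deeply embedded cube to the boundary exceeds a large
  multiple of the diameter of its dilate.
\<close>

definition admissible_depth :: "'n::finite itself \<Rightarrow> real \<Rightarrow> real \<Rightarrow> nat \<Rightarrow> bool" where
  "admissible_depth _ \<gamma> \<epsilon> r \<longleftrightarrow> 8 * real CARD('n) * \<gamma> \<le> 2 powr (real r * (1 - \<epsilon>))"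

lemma admissible_depth_eventually:
  assumes "\<epsilon> < 1"
  shows "\<exists>r0. \<forall>r\<ge>r0. admissible_depth TYPE('n::finite) \<gamma> \<epsilon> r"
proof -
  define q where "q = 2 powr (1 - \<epsilon>)"
  have q: "1 < q" using assms by (simp add: q_def)
  obtain r0 where r0: "8 * real CARD('n) * \<gamma> < q ^ r0" using real_arch_pow[OF q] by blast
  have "admissible_depth TYPE('n::finite) \<gamma> \<epsilon> r" if "r0 \<le> r" for r
  proof -
    have "q ^ r0 \<le> q ^ r" using that q by (intro power_increasing) auto
    also have "q ^ r = 2 powr (real r * (1 - \<epsilon>))"
      by (simp add: q_def powr_realpow[symmetric] powr_powr mult.commute)
    finally show ?thesis using r0 by (simp add: admissible_depth_def)
  qed
  then show ?thesis by blast
qed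

lemma deep_scale:
  assumes r: "admissible_depth TYPE('n::finite) \<gamma> \<epsilon> r" and "\<epsilon> < 1"
    and s: "0 < (s::real)" "s \<le> t / 2 ^ r"
  shows "8 * real CARD('n) * \<gamma> * s \<le> s powr \<epsilon> * t powr (1 - \<epsilon>)"
proof -
  have "2 ^ r * s \<le> t" using s by (simp add: field_simps)
  then have "(2 ^ r * s) powr (1 - \<epsilon>) \<le> t powr (1 - \<epsilon>)"
    using assms by (intro powr_mono2) auto
  moreover have "(2 ^ r * s) powr (1 - \<epsilon>) = 2 powr (real r * (1 - \<epsilon>)) * s powr (1 - \<epsilon>)"
    using s by (simp add: powr_mult powr_realpow[symmetric] powr_powr)
  ultimately have "s powr \<epsilon> * (2 powr (real r * (1 - \<epsilon>)) * s powr (1 - \<epsilon>)) \<le> s powr \<epsilon> * t powr (1 - \<epsilon>)"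
    by (intro mult_left_mono) auto
  moreover have "s powr \<epsilon> * (2 powr (real r * (1 - \<epsilon>)) * s powr (1 - \<epsilon>)) = 2 powr (real r * (1 - \<epsilon>)) * s"
    using s by (simp add: powr_add[symmetric] mult.left_commute)
  moreover have "8 * real CARD('n) * \<gamma> * s \<le> 2 powr (real r * (1 - \<epsilon>)) * s"
    using r s unfolding admissible_depth_def by (intro mult_right_mono) auto
  ultimately show ?thesis by linarith
qed

lemma center_dilate_dist:
  assumes "y \<in> cube_set (dilate t (J :: 'n::finite cube))"
  shows "norm (y - cube_center J) \<le> real CARD('n) * (t * side J / 2)"
proof (rule norm_le_card_mult)
  fix i
  have "cube_center J $ i - t * side J / 2 \<le> y $ i" "y $ i < cube_center J $ i + t * side J / 2"
    using assms unfolding mem_dilate by auto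
  then show "\<bar>(y - cube_center J) $ i\<bar> \<le> t * side J / 2"
    unfolding vector_minus_component by linarith
qed

lemma deep_dist_lower:
  fixes J K :: "'n::finite cube"
  assumes r: "admissible_depth TYPE('n) \<gamma> \<epsilon> r" and eps: "\<epsilon> < 1"
    and J: "0 < side J" "deeply_embedded r \<epsilon> J K"
    and y: "norm (y - cube_center J) \<le> real CARD('n) * (\<gamma> * side J / 2)"
  shows "side J powr \<epsilon> * side K powr (1 - \<epsilon>) / 4 \<le> setdist {y} (frontier (cube_set K))"
proof -
  let ?F = "frontier (cube_set K)"
  have s: "side J \<le> side K / 2 ^ r" and sd: "1/2 * side J powr \<epsilon> * side K powr (1 - \<epsilon>) \<le> setdist (cube_set J) ?F"
    using J(2) by (auto simp: deeply_embedded_def)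
  have "setdist (cube_set J) ?F \<le> setdist {cube_center J} ?F"
    using cube_center_mem[OF J(1)] by (intro setdist_subset_left) auto
  moreover have "setdist {cube_center J} ?F \<le> setdist {y} ?F + dist (cube_center J) y"
    using setdist_Lipschitz[of "cube_center J" ?F y] by linarith
  moreover have "dist (cube_center J) y \<le> real CARD('n) * (\<gamma> * side J / 2)"
    using y by (simp add: dist_norm norm_minus_commute)
  moreover have "8 * real CARD('n) * \<gamma> * side J \<le> side J powr \<epsilon> * side K powr (1 - \<epsilon>)"
    by (rule deep_scale[OF r eps J(1) s])
  moreover have "0 \<le> side J powr \<epsilon> * side K powr (1 - \<epsilon>)" by simp
  ultimately show ?thesis using sd by linarith
qed

text \<open>
  A segment from the center of \<open>J\<close> to a point outside \<open>K\<close> would meet the boundary of \<open>K\<close> within the size of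
  the dilate, which is too close.
\<close>

lemma dilate_deep_subset:
  fixes J K :: "'n::finite cube"
  assumes r: "admissible_depth TYPE('n) \<gamma> \<epsilon> r" and eps: "\<epsilon> < 1"
    and J: "0 < side J" "deeply_embedded r \<epsilon> J K"
  shows "cube_set (dilate \<gamma> J) \<subseteq> cube_set K"
proof
  fix y assume y: "y \<in> cube_set (dilate \<gamma> J)"
  show "y \<in> cube_set K"
  proof (rule ccontr)
    assume nK: "y \<notin> cube_set K"
    let ?c = "cube_center J"
    have sub: "cube_set J \<subseteq> cube_set K" and s: "side J \<le> side K / 2 ^ r" using J(2) by (auto simp: deeply_embedded_def)
    have c: "?c \<in> cube_set K" using sub cube_center_mem[OF J(1)] by blast
    have "closed_segment ?c y \<inter> frontier (cube_set K) \<noteq> {}"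
      by (rule connected_Int_frontier) (use c nK in auto)
    then obtain p where p: "p \<in> closed_segment ?c y" "p \<in> frontier (cube_set K)" by blast
    have "norm (p - ?c) \<le> norm (y - ?c)"
      using segment_bound(1)[OF p(1)] by simp
    also have "\<dots> \<le> real CARD('n) * (\<gamma> * side J / 2)" by (rule center_dilate_dist[OF y])
    finally have "side J powr \<epsilon> * side K powr (1 - \<epsilon>) / 4 \<le> setdist {p} (frontier (cube_set K))"
      by (rule deep_dist_lower[OF r eps J])
    also have "\<dots> = 0" using p(2) by (intro setdist_eq_0I) auto
    finally have "side J powr \<epsilon> * side K powr (1 - \<epsilon>) \<le> 0" by simp
    moreover have "0 < side K" using cube_subset_side_le[OF J(1) sub] J(1) by simp
    ultimately show False using J(1) by (simp add: mult_le_0_iff)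
  qed
qed

text \<open>
  Unless \<open>J\<close> has the largest side permitted, its parent has an admissible side but is not deeply
  embedded, as \<open>J\<close> is maximal; so the parent, and with it \<open>J\<close>, is near the boundary of \<open>K\<close>.
\<close>

lemma deep_dist_upper:
  fixes J K :: "'n::finite cube"
  assumes D: "dyadic_grid D" and K: "K \<in> D" and g: "1 \<le> \<gamma>"
    and r: "admissible_depth TYPE('n) \<gamma> \<epsilon> r" and eps: "0 < \<epsilon>" "\<epsilon> < 1"
    and J: "J \<in> M_deep D r \<epsilon> K" "2 * side J \<le> side K / 2 ^ r" and y: "y \<in> cube_set (dilate \<gamma> J)"
  shows "setdist {y} (frontier (cube_set K)) \<le> 2 * (side J powr \<epsilon> * side K powr (1 - \<epsilon>))"
proof -
  let ?F = "frontier (cube_set K)" and ?\<rho> = "side J powr \<epsilon> * side K powr (1 - \<epsilon>)"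
  have JD: "J \<in> D" and deep: "deeply_embedded r \<epsilon> J K"
    and max: "\<And>J'. J' \<in> D \<Longrightarrow> deeply_embedded r \<epsilon> J' K \<Longrightarrow> cube_set J \<subseteq> cube_set J' \<Longrightarrow> J' = J"
    using J(1) by (auto simp: M_deep_def maximal_cubes_def)
  have pos: "0 < side J" by (rule grid_side_pos[OF D JD])
  have sub: "cube_set J \<subseteq> cube_set K" and s: "side J \<le> side K / 2 ^ r"
    and sd: "1/2 * side J powr \<epsilon> * side K powr (1 - \<epsilon>) \<le> setdist (cube_set J) ?F"
    using deep by (auto simp: deeply_embedded_def)
  have posK: "0 < side K" by (rule grid_side_pos[OF D K])
  have \<rho>: "0 < ?\<rho>" using pos posK by simp
  have F: "?F \<noteq> {}" using sd \<rho> by auto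
  obtain P where P: "P \<in> D" "side P = 2 * side J" "cube_set J \<subseteq> cube_set P" using grid_parent[OF D JD] .
  have c: "cube_center J \<in> cube_set J" by (rule cube_center_mem[OF pos])
  have "(1::real) \<le> 2 ^ r" by simp
  then have "side K / 2 ^ r \<le> side K" using posK by (simp add: field_simps)
  then have "side P \<le> side K" using P(2) J(2) by linarith
  then have PK: "cube_set P \<subseteq> cube_set K"
    using grid_nested[OF D P(1) K, of "cube_center J"] c P sub by blast
  have "P \<noteq> J" using P(2) pos by auto
  then have "\<not> deeply_embedded r \<epsilon> P K" using max[OF P(1) _ P(3)] by blast
  then have "setdist (cube_set P) ?F < 1/2 * side P powr \<epsilon> * side K powr (1 - \<epsilon>)"
    using PK P(2) J(2) by (simp add: deeply_embedded_def not_le)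
  also have "side P powr \<epsilon> = 2 powr \<epsilon> * side J powr \<epsilon>" using P pos by (simp add: powr_mult)
  also have "1/2 * (2 powr \<epsilon> * side J powr \<epsilon>) * side K powr (1 - \<epsilon>) = (2 powr \<epsilon> / 2) * ?\<rho>" by simp
  also have "\<dots> \<le> 1 * ?\<rho>"
    using powr_mono[of \<epsilon> 1 2] eps \<rho> by (intro mult_right_mono) auto
  finally have "setdist (cube_set P) ?F < ?\<rho>" by simp
  then obtain p q where pq: "p \<in> cube_set P" "q \<in> ?F" "dist p q < ?\<rho>"
    using setdist_ltE[of "cube_set P" ?F ?\<rho>] F P(3) c by blast
  have "norm (p - cube_center J) \<le> real CARD('n) * side P"
    using c P(3) by (intro norm_diff_cube_le pq(1)) auto
  then have 1: "dist (cube_center J) p \<le> 2 * real CARD('n) * side J"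
    using P(2) by (simp add: dist_norm norm_minus_commute)
  have 2: "dist y (cube_center J) \<le> real CARD('n) * (\<gamma> * side J / 2)"
    using center_dilate_dist[OF y] by (simp add: dist_norm)
  have 3: "8 * real CARD('n) * \<gamma> * side J \<le> ?\<rho>"
    by (rule deep_scale[OF r eps(2) pos s])
  have 4: "real CARD('n) * side J * 1 \<le> real CARD('n) * side J * \<gamma>"
    using g pos by (intro mult_left_mono) auto
  have "setdist {y} ?F \<le> dist y q" using pq(2) by (intro setdist_le_dist) auto
  also have "\<dots> \<le> dist y (cube_center J) + dist (cube_center J) p + dist p q"
    by (meson add_mono dist_triangle dist_triangle_le order_refl order_trans)
  also have "\<dots> \<le> real CARD('n) * (\<gamma> * side J / 2) + 2 * real CARD('n) * side J + ?\<rho>"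
    using 1 2 pq(3) by linarith
  also have "\<dots> \<le> 2 * ?\<rho>"
  proof -
    have "a / 2 + 2 * b + c \<le> 2 * c" if "8 * a \<le> c" "b \<le> a" "0 < c" for a b c :: real
      using that by linarith
    from this[of "real CARD('n) * \<gamma> * side J" ?\<rho> "real CARD('n) * side J"] show ?thesis
      using 3 4 \<rho> by (simp add: mult_ac)
  qed
  finally show ?thesis .
qed

text \<open>
  The cubes are disjoint, have equal volume and lie in one cube of comparable side around \<open>y\<close>.
\<close>

lemma card_same_side:
  fixes D :: "'n::finite cube set"
  assumes D: "dyadic_grid D" and G: "finite G" "G \<subseteq> D" "\<And>J. J \<in> G \<Longrightarrow> side J = s"
    and y: "\<And>J. J \<in> G \<Longrightarrow> y \<in> cube_set (dilate \<gamma> J)" and s: "0 < s" and g: "1 \<le> \<gamma>"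
  shows "real (card G) \<le> (2 * (\<gamma> + 1)) ^ CARD('n)"
proof -
  define Q :: "'n cube" where "Q = ((\<chi> i. y $ i - (\<gamma> + 1) * s), 2 * (\<gamma> + 1) * s)"
  have sQ: "side Q = 2 * (\<gamma> + 1) * s" by (simp add: Q_def)
  have sub: "cube_set J \<subseteq> cube_set Q" if J: "J \<in> G" for J
  proof
    fix x assume x: "x \<in> cube_set J"
    have "fst Q $ i \<le> x $ i \<and> x $ i < fst Q $ i + side Q" for i
    proof -
      have "\<bar>x $ i - cube_center J $ i\<bar> \<le> s / 2" using center_dist_component[OF x, of i] G(3)[OF J] by simp
      moreover have "cube_center J $ i - \<gamma> * s / 2 \<le> y $ i" "y $ i < cube_center J $ i + \<gamma> * s / 2"
        using y[OF J] G(3)[OF J] unfolding mem_dilate by auto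
      moreover have "1 * s \<le> \<gamma> * s" using g s by (intro mult_right_mono) auto
      moreover have "fst Q $ i = y $ i - \<gamma> * s - s" "side Q = 2 * (\<gamma> * s) + 2 * s"
        by (simp_all add: Q_def algebra_simps)
      ultimately show ?thesis using s by linarith
    qed
    then show "x \<in> cube_set Q" by (simp add: mem_cube_set)
  qed
  have disj: "disjoint_family_on cube_set G"
    unfolding disjoint_family_on_def
  proof (intro ballI impI)
    fix J J' assume J: "J \<in> G" "J' \<in> G" "J \<noteq> J'"
    show "cube_set J \<inter> cube_set J' = {}"
    proof (rule ccontr)
      assume "cube_set J \<inter> cube_set J' \<noteq> {}"
      then obtain x where "x \<in> cube_set J" "x \<in> cube_set J'" by blast
      then have "J = J'" using grid_same_side[OF D, of J J' x] J G by auto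
      then show False using J by simp
    qed
  qed
  have "ennreal (real (card G) * s ^ CARD('n)) = (\<Sum>J\<in>G. ennreal (s ^ CARD('n)))"
    using s by (simp add: ennreal_mult ennreal_of_nat_eq_real_of_nat)
  also have "\<dots> = (\<Sum>J\<in>G. emeasure lborel (cube_set J))"
    using G(3) s by (intro sum.cong refl) (simp add: emeasure_cube)
  also have "\<dots> = emeasure lborel (\<Union>J\<in>G. cube_set J)"
    using disj by (intro sum_emeasure) (auto simp: G(1))
  also have "\<dots> \<le> emeasure lborel (cube_set Q)"
    using sub by (intro emeasure_mono) auto
  also have "\<dots> = ennreal ((2 * (\<gamma> + 1) * s) ^ CARD('n))"
    using s g by (simp add: emeasure_cube sQ)
  finally have "real (card G) * s ^ CARD('n) \<le> (2 * (\<gamma> + 1)) ^ CARD('n) * s ^ CARD('n)"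
    using s g by (simp add: ennreal_le_iff power_mult_distrib)
  then show ?thesis using s by simp
qed

lemma card_bounded_ratio:
  fixes D :: "'n::finite cube set"
  assumes D: "dyadic_grid D" and G: "finite G" "G \<subseteq> D"
    and ratio: "\<And>J J'. J \<in> G \<Longrightarrow> J' \<in> G \<Longrightarrow> side J' \<le> 2 ^ k * side J"
    and y: "\<And>J. J \<in> G \<Longrightarrow> y \<in> cube_set (dilate \<gamma> J)" and g: "1 \<le> \<gamma>"
  shows "real (card G) \<le> real (k + 1) * (2 * (\<gamma> + 1)) ^ CARD('n)"
proof (cases "G = {}")
  case True
  then show ?thesis using g by simp
next
  case False
  define s where "s = Min (side ` G)"
  have "s \<in> side ` G" unfolding s_def using G False by (intro Min_in) auto
  then obtain J0 where J0: "J0 \<in> G" "side J0 = s" by auto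
  have s0: "0 < s" using grid_side_pos[OF D] J0 G by blast
  have G_eq: "G = (\<Union>i\<in>{..k}. {J \<in> G. side J = 2 ^ i * s})"
  proof -
    have "\<exists>i\<le>k. side J = 2 ^ i * s" if J: "J \<in> G" for J
    proof -
      have "s \<le> side J" unfolding s_def using G J by (intro Min_le) auto
      then obtain i where i: "side J = 2 ^ i * s"
        using grid_side_ratio[OF D, of J0 J] J0 J G by auto
      then have "(2::real) ^ i \<le> 2 ^ k" using ratio[OF J0(1) J] J0(2) s0 by simp
      then show ?thesis using i by auto
    qed
    then show ?thesis by auto
  qed
  have "card (\<Union>i\<in>{..k}. {J \<in> G. side J = 2 ^ i * s}) \<le> (\<Sum>i\<in>{..k}. card {J \<in> G. side J = 2 ^ i * s})"
    by (rule card_UN_le) simp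
  then have "real (card G) \<le> real (\<Sum>i\<in>{..k}. card {J \<in> G. side J = 2 ^ i * s})"
    using arg_cong[OF G_eq, of card] by linarith
  also have "\<dots> = (\<Sum>i\<in>{..k}. real (card {J \<in> G. side J = 2 ^ i * s}))" by simp
  also have "\<dots> \<le> (\<Sum>i\<in>{..k}. (2 * (\<gamma> + 1)) ^ CARD('n))"
  proof (rule sum_mono)
    fix i
    show "real (card {J \<in> G. side J = 2 ^ i * s}) \<le> (2 * (\<gamma> + 1)) ^ CARD('n)"
      by (rule card_same_side[OF D, where s = "2 ^ i * s" and y = y]) (use G y g s0 in auto)
  qed
  finally show ?thesis by simp
qed

definition overlap_bound :: "'n::finite itself \<Rightarrow> real \<Rightarrow> real \<Rightarrow> real" where
  "overlap_bound _ \<gamma> \<epsilon> = (real (nat \<lceil>3 / \<epsilon>\<rceil>) + 3) * (2 * (\<gamma> + 1)) ^ CARD('n)"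

text \<open>
  If \<open>y\<close> is in the dilate of \<open>J\<close>, then its distance to the boundary of \<open>K\<close> is comparable to
  \<open>(side J)^\<epsilon> (side K)^(1 - \<epsilon>)\<close>. This determines the side of \<open>J\<close> up to a bounded factor, and for every
  fixed side there are boundedly many such cubes. The cubes without an upper distance bound, collected
  in \<open>G2\<close>, have sides within a factor of two of each other.
\<close>

lemma M_deep_overlap:
  fixes D :: "'n::finite cube set"
  assumes D: "dyadic_grid D" and K: "K \<in> D" and g: "1 \<le> \<gamma>"
    and r: "admissible_depth TYPE('n) \<gamma> \<epsilon> r" and eps: "0 < \<epsilon>" "\<epsilon> < 1"
    and G: "finite G" "G \<subseteq> M_deep D r \<epsilon> K" and y: "\<And>J. J \<in> G \<Longrightarrow> y \<in> cube_set (dilate \<gamma> J)"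
  shows "real (card G) \<le> overlap_bound TYPE('n) \<gamma> \<epsilon>"
proof -
  define k where "k = nat \<lceil>3 / \<epsilon>\<rceil>"
  define G1 where "G1 = {J \<in> G. 2 * side J \<le> side K / 2 ^ r}"
  define G2 where "G2 = {J \<in> G. \<not> 2 * side J \<le> side K / 2 ^ r}"
  have GD: "G \<subseteq> D" using G by (auto simp: M_deep_def maximal_cubes_def)
  have deep: "deeply_embedded r \<epsilon> J K" if "J \<in> G" for J using G that by (auto simp: M_deep_def maximal_cubes_def)
  have pos: "0 < side J" if "J \<in> G" for J using grid_side_pos[OF D] GD that by blast
  have posK: "0 < side K" by (rule grid_side_pos[OF D K])
  have ratio1: "side J' \<le> 2 ^ k * side J" if J: "J \<in> G1" and J': "J' \<in> G1" for J J'
  proof -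
    have JG: "J \<in> G" "J' \<in> G" using J J' by (auto simp: G1_def)
    let ?d = "setdist {y} (frontier (cube_set K))"
    have "side J' powr \<epsilon> * side K powr (1 - \<epsilon>) / 4 \<le> ?d"
      by (rule deep_dist_lower[OF r eps(2) pos[OF JG(2)] deep[OF JG(2)] center_dilate_dist[OF y[OF JG(2)]]])
    also have "\<dots> \<le> 2 * (side J powr \<epsilon> * side K powr (1 - \<epsilon>))"
      using deep_dist_upper[OF D K g r eps, of J y] J y G by (auto simp: G1_def)
    \<comment> \<open>The upper and the lower distance bound differ by the factor 8.\<close>
    finally have "side J' powr \<epsilon> * side K powr (1 - \<epsilon>) \<le> (8 * side J powr \<epsilon>) * side K powr (1 - \<epsilon>)" by simp
    then have "side J' powr \<epsilon> \<le> 8 * side J powr \<epsilon>" using posK by simp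
    then have "(side J' powr \<epsilon>) powr (1 / \<epsilon>) \<le> (8 * side J powr \<epsilon>) powr (1 / \<epsilon>)"
      using eps by (intro powr_mono2) auto
    then have "side J' \<le> 8 powr (1 / \<epsilon>) * side J"
      using eps pos JG by (simp add: powr_mult powr_powr less_imp_le)
    moreover have "8 powr (1 / \<epsilon>) \<le> (2::real) ^ k"
    proof -
      have "(8::real) powr (1 / \<epsilon>) = (2 powr 3) powr (1 / \<epsilon>)" by simp
      also have "\<dots> = 2 powr (3 / \<epsilon>)" by (simp only: powr_powr) simp
      also have "\<dots> \<le> 2 powr real k"
        unfolding k_def by (intro powr_mono) (use eps in \<open>auto intro: real_nat_ceiling_ge\<close>)
      finally show ?thesis by (simp add: powr_realpow)
    qed
    then have "8 powr (1 / \<epsilon>) * side J \<le> 2 ^ k * side J"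
      using pos[OF JG(1)] by (intro mult_right_mono) auto
    ultimately show ?thesis by linarith
  qed
  have ratio2: "side J' \<le> 2 ^ 1 * side J" if J: "J \<in> G2" and J': "J' \<in> G2" for J J'
  proof -
    have "side J' \<le> side K / 2 ^ r" using deep J' by (auto simp: G2_def deeply_embedded_def)
    then show ?thesis using J by (simp add: G2_def)
  qed
  have "real (card G1) \<le> real (k + 1) * (2 * (\<gamma> + 1)) ^ CARD('n)"
    by (rule card_bounded_ratio[OF D _ _ ratio1 y g]) (use G GD in \<open>auto simp: G1_def\<close>)
  moreover have "real (card G2) \<le> real (1 + 1) * (2 * (\<gamma> + 1)) ^ CARD('n)"
    by (rule card_bounded_ratio[OF D _ _ ratio2 y g]) (use G GD in \<open>auto simp: G2_def\<close>)
  moreover have "real (card G) \<le> real (card G1) + real (card G2)"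
  proof -
    have "G = G1 \<union> G2" by (auto simp: G1_def G2_def)
    then show ?thesis by (metis card_Un_le of_nat_add of_nat_le_iff)
  qed
  ultimately have "real (card G) \<le> real (k + 1) * (2 * (\<gamma> + 1)) ^ CARD('n) + real (1 + 1) * (2 * (\<gamma> + 1)) ^ CARD('n)"
    by linarith
  also have "\<dots> = overlap_bound TYPE('n) \<gamma> \<epsilon>"
    by (simp add: overlap_bound_def k_def algebra_simps)
  finally show ?thesis .
qed


section \<open>Tangent line truncations\<close>

definition tangent_line :: "real \<Rightarrow> real \<Rightarrow> real \<Rightarrow> real" where
  "tangent_line m a r = a powr (- m) - m * a powr (- m - 1) * (r - a)"

definition truncation_end :: "real \<Rightarrow> real \<Rightarrow> real" where
  "truncation_end m R = R + R / m"

text \<open>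
  The tangent line at \<open>R\<close> reaches zero at \<open>truncation_end m R\<close>.
\<close>

definition truncation :: "real \<Rightarrow> real \<Rightarrow> real \<Rightarrow> real \<Rightarrow> real" where
  "truncation m \<delta> R r =
     (if r \<le> \<delta> then tangent_line m \<delta> r
      else if r \<le> R then r powr (- m)
      else if r \<le> truncation_end m R then tangent_line m R r else 0)"

text \<open>
  Continuity of the derivative across \<open>a\<close> makes the two one-sided derivatives of the glued function agree.
\<close>

lemma glue_derivative:
  fixes f g :: "real \<Rightarrow> real"
  assumes "x \<le> a \<Longrightarrow> (f has_real_derivative f' x) (at x)" "a \<le> x \<Longrightarrow> (g has_real_derivative g' x) (at x)"
    and "f a = g a" "f' a = g' a"
  shows "((\<lambda>x. if x \<le> a then f x else g x) has_real_derivative (if x \<le> a then f' x else g' x)) (at x)"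
proof -
  have "((\<lambda>x. if x \<in> {..a} then f x else g x) has_vector_derivative (if x \<in> {..a} then f' x else g' x)) (at x within UNIV)"
  proof (rule has_vector_derivative_If_within_closures[where T = "{a<..}"])
    show "x \<in> {..a} \<union> {a<..}" "UNIV = {..a} \<union> {a<..}" by auto
    show "(f has_vector_derivative f' x) (at x within {..a} \<union> closure {..a} \<inter> closure {a<..})"
      if "x \<in> {..a} \<union> closure {..a} \<inter> closure {a<..}"
    proof -
      have "x \<le> a" using that by auto
      from assms(1)[OF this] show ?thesis
        unfolding has_real_derivative_iff_has_vector_derivative by (rule has_vector_derivative_at_within)
    qed
    show "(g has_vector_derivative g' x) (at x within {a<..} \<union> closure {..a} \<inter> closure {a<..})"
      if "x \<in> {a<..} \<union> closure {..a} \<inter> closure {a<..}"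
    proof -
      have "a \<le> x" using that by auto
      from assms(2)[OF this] show ?thesis
        unfolding has_real_derivative_iff_has_vector_derivative by (rule has_vector_derivative_at_within)
    qed
    show "f x = g x" "f' x = g' x" if "x \<in> closure {..a}" "x \<in> closure {a<..}"
    proof -
      have "x = a" using that by auto
      then show "f x = g x" "f' x = g' x" using assms(3,4) by (simp_all only:)
    qed
  qed
  then show ?thesis by (simp add: has_real_derivative_iff_has_vector_derivative)
qed

lemma truncation_derivative:
  assumes m: "0 < m" and d: "0 < \<delta>" "\<delta> < R" and x: "x \<in> {0<..<truncation_end m R}"
  shows "(truncation m \<delta> R has_real_derivative - m * (max \<delta> (min x R)) powr (- m - 1)) (at x)"
proof -
  have lin: "(tangent_line m a has_real_derivative - m * a powr (- m - 1)) (at y)" for a y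
    unfolding tangent_line_def by (auto intro!: derivative_eq_intros)
  have pw: "((\<lambda>r. r powr (- m)) has_real_derivative - m * y powr (- m - 1)) (at y)" if "0 < y" for y
    using that by (auto intro!: derivative_eq_intros)
  have tl: "tangent_line m a a = a powr (- m)" for a by (simp add: tangent_line_def)
  define g where "g = (\<lambda>r. if r \<le> R then r powr (- m) else tangent_line m R r)"
  have g: "(g has_real_derivative (if y \<le> R then - m * y powr (- m - 1) else - m * R powr (- m - 1))) (at y)"
    if "\<delta> \<le> y" for y
    unfolding g_def
    by (rule glue_derivative[where f' = "\<lambda>y. - m * y powr (- m - 1)" and g' = "\<lambda>_. - m * R powr (- m - 1)"])
       (use that d pw lin tl in auto)
  have "((\<lambda>r. if r \<le> \<delta> then tangent_line m \<delta> r else g r) has_real_derivative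
      (if x \<le> \<delta> then - m * \<delta> powr (- m - 1) else (if x \<le> R then - m * x powr (- m - 1) else - m * R powr (- m - 1)))) (at x)"
    by (rule glue_derivative[where f' = "\<lambda>_. - m * \<delta> powr (- m - 1)"
          and g' = "\<lambda>y. if y \<le> R then - m * y powr (- m - 1) else - m * R powr (- m - 1)"])
       (use d lin g tl in \<open>auto simp: fun_cong[OF g_def, of \<delta>]\<close>)
  also have "(if x \<le> \<delta> then - m * \<delta> powr (- m - 1) else (if x \<le> R then - m * x powr (- m - 1) else - m * R powr (- m - 1)))
      = - m * (max \<delta> (min x R)) powr (- m - 1)"
    using d by (auto simp: max_def min_def)
  finally have "((\<lambda>r. if r \<le> \<delta> then tangent_line m \<delta> r else g r) has_real_derivative
      - m * (max \<delta> (min x R)) powr (- m - 1)) (at x)" .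
  then show ?thesis
    by (rule has_field_derivative_transform_within_open[where S = "{0<..<truncation_end m R}"])
       (use x in \<open>auto simp: truncation_def g_def\<close>)
qed

lemma truncation_end_gt: "0 < m \<Longrightarrow> 0 < R \<Longrightarrow> R < truncation_end m R"
  by (simp add: truncation_end_def)

lemma tangent_line_end:
  assumes "0 < m" "0 < R"
  shows "tangent_line m R (truncation_end m R) = 0"
proof -
  have "R powr (- m - 1) * R = R powr (- m)"
    using powr_add[of R "- m - 1" 1] assms by simp
  then show ?thesis using assms by (simp add: tangent_line_def truncation_end_def mult_ac)
qed

lemma truncation_is_tangent_line_truncation:
  fixes \<alpha> :: real
  assumes a: "\<alpha> < real n" and d: "0 < \<delta>" "\<delta> < R"
  shows "tangent_line_truncation n \<alpha> \<delta> R (truncation (real n - \<alpha>) \<delta> R)"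
proof -
  define m where "m = real n - \<alpha>"
  define S where "S = truncation_end m R"
  have m: "0 < m" and R: "0 < R" using a d by (auto simp: m_def)
  have S: "R < S" using truncation_end_gt[OF m R] by (simp add: S_def)
  let ?\<psi> = "truncation m \<delta> R"
  have der: "(?\<psi> has_real_derivative - m * (max \<delta> (min x R)) powr (- m - 1)) (at x)" if "x \<in> {0<..<S}" for x
    using truncation_derivative[OF m d] that by (simp add: S_def)
  have "?\<psi> C1_differentiable_on {0<..<S}"
    unfolding C1_differentiable_on_def
  proof (intro exI conjI ballI)
    show "(?\<psi> has_vector_derivative - m * (max \<delta> (min x R)) powr (- m - 1)) (at x)" if "x \<in> {0<..<S}" for x
      using der[OF that] by (simp add: has_real_derivative_iff_has_vector_derivative)
    show "continuous_on {0<..<S} (\<lambda>x. - m * (max \<delta> (min x R)) powr (- m - 1))"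
      using d by (intro continuous_intros) (auto simp: max_def)
  qed
  moreover have "\<forall>r\<in>{\<delta>..R}. ?\<psi> r = r powr (\<alpha> - real n)"
    by (auto simp: truncation_def tangent_line_def m_def)
  moreover have "\<exists>k. \<forall>r\<in>{0<..<\<delta>}. (?\<psi> has_real_derivative k) (at r)"
    using der d S by (intro exI[of _ "- m * \<delta> powr (- m - 1)"]) (fastforce simp: max_def min_def)
  moreover have "\<exists>k. \<forall>r\<in>{R<..<S}. (?\<psi> has_real_derivative k) (at r)"
  proof (intro exI[of _ "- m * R powr (- m - 1)"] ballI)
    fix r assume r: "r \<in> {R<..<S}"
    then have "max \<delta> (min r R) = R" using d by auto
    then show "(?\<psi> has_real_derivative - m * R powr (- m - 1)) (at r)" using der[of r] r R by simp
  qed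
  moreover have "\<forall>r\<ge>S. ?\<psi> r = 0"
    using d S tangent_line_end[OF m R] by (auto simp: truncation_def S_def)
  moreover have "isCont ?\<psi> S"
  proof -
    have "(?\<psi> \<longlongrightarrow> 0) (at S)"
    proof (rule filterlim_split_at)
      have "(tangent_line m R \<longlongrightarrow> tangent_line m R S) (at_left S)"
        unfolding tangent_line_def by (intro tendsto_intros)
      then have "(tangent_line m R \<longlongrightarrow> 0) (at_left S)"
        using tangent_line_end[OF m R] by (simp add: S_def)
      moreover have "eventually (\<lambda>r. tangent_line m R r = ?\<psi> r) (at_left S)"
        unfolding eventually_at_left_field using S d
        by (intro exI[of _ R]) (auto simp: truncation_def S_def)
      ultimately show "(?\<psi> \<longlongrightarrow> 0) (at_left S)"
        by (rule Lim_transform_eventually)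
      have "eventually (\<lambda>r. 0 = ?\<psi> r) (at_right S)"
        unfolding eventually_at_right_field using S d
        by (intro exI[of _ "S + 1"]) (auto simp: truncation_def S_def)
      then show "(?\<psi> \<longlongrightarrow> 0) (at_right S)"
        by (rule Lim_transform_eventually[OF tendsto_const])
    qed
    moreover have "?\<psi> S = 0" using d S tangent_line_end[OF m R] by (auto simp: truncation_def S_def)
    ultimately show ?thesis by (simp add: isCont_def)
  qed
  ultimately show ?thesis using S unfolding tangent_line_truncation_def m_def by blast
qed

lemma truncation_eq: "\<delta> \<le> r \<Longrightarrow> r \<le> R \<Longrightarrow> truncation m \<delta> R r = r powr (- m)"
  by (auto simp: truncation_def tangent_line_def)

lemma truncation_bounds:
  assumes m: "0 < m" and d: "0 < \<delta>" "\<delta> < R" and r: "0 \<le> r"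
  shows "0 \<le> truncation m \<delta> R r" "truncation m \<delta> R r \<le> (1 + m) * \<delta> powr (- m)"
proof -
  have p1: "a powr (- m - 1) * a = a powr (- m)" if "0 < a" for a
    using powr_add[of a "- m - 1" 1] that by simp
  have R: "0 < R" using d by simp
  have le: "a powr (- m) \<le> \<delta> powr (- m)" if "\<delta> \<le> a" for a
    using that d m by (intro powr_mono2') auto
  have base: "\<delta> powr (- m) \<le> (1 + m) * \<delta> powr (- m)" using m by (simp add: algebra_simps)
  consider "r \<le> \<delta>" | "\<delta> < r" "r \<le> R" | "R < r" "r \<le> truncation_end m R" | "truncation_end m R < r" by linarith
  then have "0 \<le> truncation m \<delta> R r \<and> truncation m \<delta> R r \<le> (1 + m) * \<delta> powr (- m)"
  proof cases
    case 1
    have "m * \<delta> powr (- m - 1) * (\<delta> - r) \<le> m * \<delta> powr (- m - 1) * \<delta>"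
      using m r by (intro mult_left_mono) auto
    also have "\<dots> = m * \<delta> powr (- m)" using p1[OF d(1)] by (simp add: mult.assoc)
    finally have "m * \<delta> powr (- m - 1) * (\<delta> - r) \<le> m * \<delta> powr (- m)" .
    moreover have "0 \<le> m * \<delta> powr (- m - 1) * (\<delta> - r)" using m 1 by simp
    moreover have "truncation m \<delta> R r = \<delta> powr (- m) + m * \<delta> powr (- m - 1) * (\<delta> - r)"
      using 1 by (simp add: truncation_def tangent_line_def algebra_simps)
    moreover have "(1 + m) * \<delta> powr (- m) = \<delta> powr (- m) + m * \<delta> powr (- m)" by (simp add: algebra_simps)
    moreover have "0 \<le> \<delta> powr (- m)" by simp
    ultimately show ?thesis by linarith
  next
    case 2
    then show ?thesis using le[of r] base by (simp add: truncation_def)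
  next
    case 3
    have "m * R powr (- m - 1) * (r - R) \<le> m * R powr (- m - 1) * (R / m)"
      using m 3 by (intro mult_left_mono) (auto simp: truncation_end_def)
    also have "\<dots> = R powr (- m)" using p1[OF R] m by simp
    finally have "m * R powr (- m - 1) * (r - R) \<le> R powr (- m)" .
    moreover have "0 \<le> m * R powr (- m - 1) * (r - R)" using m 3 by simp
    moreover have "truncation m \<delta> R r = R powr (- m) - m * R powr (- m - 1) * (r - R)"
      using 3 d by (simp add: truncation_def tangent_line_def)
    ultimately show ?thesis using d le[of R] base by linarith
  next
    case 4
    then have "R < r" using truncation_end_gt[OF m R] by simp
    then show ?thesis using 4 d m by (simp add: truncation_def)
  qed
  then show "0 \<le> truncation m \<delta> R r" "truncation m \<delta> R r \<le> (1 + m) * \<delta> powr (- m)" by auto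
qed

lemma truncation_measurable [measurable]: "truncation m \<delta> R \<in> borel_measurable borel"
  unfolding truncation_def tangent_line_def by measurable


section \<open>Truncated operators and the testing condition\<close>

lemma riesz_kernel_eq:
  "riesz_kernel c \<psi> x y = (c * \<psi> (norm (x - y)) / norm (x - y)) *\<^sub>R (x - y)"
  by (simp add: riesz_kernel_def riesz_Omega_def vec_eq_iff)

text \<open>
  Between the radii \<open>\<delta>\<close> and \<open>R\<close> the truncated kernel can be handled by the calculus of \<open>line_kernel\<close>.
\<close>

lemma riesz_kernel_line:
  fixes x y :: "real ^ 'n::finite"
  assumes "\<delta> \<le> norm (x - y)" "norm (x - y) \<le> R" "0 < \<delta>"
  shows "riesz_kernel c (truncation m \<delta> R) x y \<bullet> e = c * line_kernel m e (x - y)"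
proof -
  have "0 < norm (x - y)" using assms by linarith
  then have "norm (x - y) powr (- m) / norm (x - y) = norm (x - y) powr (- (m + 1))"
    using powr_diff[of "norm (x - y)" "- m" 1] by simp
  then have "c * line_kernel m e (x - y) = c * ((x - y) \<bullet> e) * (norm (x - y) powr (- m) / norm (x - y))"
    by (simp only: line_kernel_def mult.assoc)
  then show ?thesis using assms(1,2)
    by (simp add: riesz_kernel_eq truncation_eq)
qed

lemma transpose_riesz_kernel: "transpose_kernel (riesz_kernel c \<psi>) x y = - riesz_kernel c \<psi> x y"
  by (simp add: transpose_kernel_def riesz_kernel_eq norm_minus_commute scaleR_right_diff_distrib)

text \<open>
  The Riesz kernel is odd, so transposition changes only the sign of the operator.
\<close>

lemma testing_sq_transpose:
  "testing_sq (transpose_kernel ` riesz_truncations c \<alpha>) \<sigma> \<omega> =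
     testing_sq (riesz_truncations c \<alpha>) (\<sigma> :: (real ^ 'n::finite) measure) \<omega>"
proof -
  have "norm (kernel_op (transpose_kernel K) \<mu> x) = norm (kernel_op K \<mu> x)"
    if K: "K \<in> riesz_truncations c \<alpha>" for K and \<mu> :: "(real ^ 'n) measure" and x
  proof -
    obtain \<psi> where \<psi>: "K = riesz_kernel c \<psi>" using K by (auto simp: riesz_truncations_def)
    have "kernel_op (transpose_kernel K) \<mu> x = - kernel_op K \<mu> x"
      by (simp add: kernel_op_def \<psi> transpose_riesz_kernel vec_eq_iff)
    then show ?thesis by simp
  qed
  then show ?thesis by (simp add: testing_sq_def image_image)
qed

lemma borel_measurable_vec_nth [measurable (raw)]:
  fixes f :: "'a \<Rightarrow> real ^ 'n::finite"
  shows "f \<in> borel_measurable M \<Longrightarrow> (\<lambda>x. f x $ i) \<in> borel_measurable M"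
  by (rule measurable_compose[OF _ borel_measurable_nth])

lemma riesz_kernel_measurable [measurable]:
  assumes [measurable]: "\<psi> \<in> borel_measurable borel"
  shows "(\<lambda>(x, y). riesz_kernel c \<psi> x y) \<in> borel_measurable (borel \<Otimes>\<^sub>M borel)"
  unfolding riesz_kernel_eq by measurable

lemma riesz_kernel_measurable_right [measurable]:
  assumes [measurable]: "\<psi> \<in> borel_measurable borel"
  shows "riesz_kernel c \<psi> x \<in> borel_measurable borel"
  unfolding riesz_kernel_eq by measurable

lemma norm_riesz_kernel_le:
  assumes m: "0 < m" and d: "0 < \<delta>" "\<delta> < R" and c: "0 < c"
  shows "norm (riesz_kernel c (truncation m \<delta> R) x y) \<le> c * ((1 + m) * \<delta> powr (- m))"
proof (cases "x = y")
  case True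
  then show ?thesis using m c by (simp add: riesz_kernel_eq)
next
  case False
  then have "norm (riesz_kernel c (truncation m \<delta> R) x y) = c * truncation m \<delta> R (norm (x - y))"
    using truncation_bounds(1)[OF m d, of "norm (x - y)"] c by (simp add: riesz_kernel_eq)
  also have "\<dots> \<le> c * ((1 + m) * \<delta> powr (- m))"
    using truncation_bounds(2)[OF m d, of "norm (x - y)"] c by (intro mult_left_mono) auto
  finally show ?thesis .
qed

text \<open>
  The truncated operator applied to the restriction of \<open>\<sigma>\<close> to \<open>E\<close>, as one vector-valued integral.
\<close>

definition truncated_integral ::
    "real \<Rightarrow> real \<Rightarrow> real \<Rightarrow> real \<Rightarrow> (real ^ 'n::finite) measure \<Rightarrow> (real ^ 'n) set \<Rightarrow> real ^ 'n \<Rightarrow> real ^ 'n" where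
  "truncated_integral c m \<delta> R \<sigma> E x = (\<integral>y. indicator E y *\<^sub>R riesz_kernel c (truncation m \<delta> R) x y \<partial>\<sigma>)"

lemma truncated_integrable:
  fixes \<sigma> :: "(real ^ 'n::finite) measure"
  assumes \<sigma>: "locally_finite_borel \<sigma>" and m: "0 < m" and d: "0 < \<delta>" "\<delta> < R" and c: "0 < c"
    and E: "E \<in> sets borel" "E \<subseteq> cube_set I"
  shows "integrable \<sigma> (\<lambda>y. indicator E y *\<^sub>R riesz_kernel c (truncation m \<delta> R) x y)"
proof (rule integrable_bounded_cube[OF \<sigma>, where K = I and B = "c * ((1 + m) * \<delta> powr (- m))"])
  show "(\<lambda>y. indicat_real E y *\<^sub>R riesz_kernel c (truncation m \<delta> R) x y) \<in> borel_measurable borel"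
    using E(1) by measurable
  show "norm (indicat_real E y *\<^sub>R riesz_kernel c (truncation m \<delta> R) x y) \<le> c * ((1 + m) * \<delta> powr (- m))" for y
    using norm_riesz_kernel_le[OF m d c, of x y] c m by (cases "y \<in> E") auto
qed (use E in \<open>auto simp: indicator_def\<close>)

lemma kernel_op_restrict:
  fixes \<sigma> :: "(real ^ 'n::finite) measure"
  assumes \<sigma>: "locally_finite_borel \<sigma>" and m: "0 < m" and d: "0 < \<delta>" "\<delta> < R" and c: "0 < c"
  shows "kernel_op (riesz_kernel c (truncation m \<delta> R)) (restrict_measure (cube_set Q) \<sigma>)
    = truncated_integral c m \<delta> R \<sigma> (cube_set Q)"
proof (intro ext)
  fix x
  let ?K = "riesz_kernel c (truncation m \<delta> R)"
  have int: "integrable \<sigma> (\<lambda>y. indicator (cube_set Q) y *\<^sub>R ?K x y)"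
    by (rule truncated_integrable[OF \<sigma> m d c _ order_refl]) simp
  show "kernel_op ?K (restrict_measure (cube_set Q) \<sigma>) x = truncated_integral c m \<delta> R \<sigma> (cube_set Q) x"
    unfolding truncated_integral_def
  proof (subst vec_eq_iff, intro allI)
    fix l
    have meas: "(\<lambda>y. ?K x y $ l) \<in> borel_measurable \<sigma>" "indicat_real (cube_set Q) \<in> borel_measurable \<sigma>"
      unfolding measurable_cong_sets[OF locally_finite_sets[OF \<sigma>] refl] by measurable
    have "kernel_op ?K (restrict_measure (cube_set Q) \<sigma>) x $ l =
        integral\<^sup>L (density \<sigma> (\<lambda>y. ennreal (indicator (cube_set Q) y))) (\<lambda>y. ?K x y $ l)"
      by (simp add: kernel_op_def restrict_measure_def ennreal_indicator)
    also have "\<dots> = (\<integral>y. indicator (cube_set Q) y *\<^sub>R (?K x y $ l) \<partial>\<sigma>)"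
      by (intro integral_density meas) simp
    also have "\<dots> = (\<integral>y. (indicator (cube_set Q) y *\<^sub>R ?K x y) $ l \<partial>\<sigma>)" by simp
    also have "\<dots> = (\<integral>y. indicator (cube_set Q) y *\<^sub>R ?K x y \<partial>\<sigma>) $ l"
      using integral_bounded_linear[OF bounded_linear_vec_nth int, of l] by simp
    finally show "kernel_op ?K (restrict_measure (cube_set Q) \<sigma>) x $ l = (\<integral>y. indicator (cube_set Q) y *\<^sub>R ?K x y \<partial>\<sigma>) $ l" .
  qed
qed

lemma finite_restrict_measure:
  fixes \<sigma> :: "(real ^ 'n::finite) measure"
  assumes \<sigma>: "locally_finite_borel \<sigma>"
  shows "finite_measure (restrict_measure (cube_set Q) \<sigma>)"
proof
  have "emeasure (density \<sigma> (indicator (cube_set Q))) (space \<sigma>) = (\<integral>\<^sup>+x. indicator (cube_set Q) x * indicator (space \<sigma>) x \<partial>\<sigma>)"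
    by (intro emeasure_density borel_measurable_indicator sets.top) (simp add: locally_finite_sets[OF \<sigma>])
  also have "\<dots> = (\<integral>\<^sup>+x. indicator (cube_set Q) x \<partial>\<sigma>)"
    by (intro nn_integral_cong) simp
  also have "\<dots> = emeasure \<sigma> (cube_set Q)"
    by (intro nn_integral_indicator) (simp add: locally_finite_sets[OF \<sigma>])
  finally have "emeasure (restrict_measure (cube_set Q) \<sigma>) (space (restrict_measure (cube_set Q) \<sigma>)) = emeasure \<sigma> (cube_set Q)"
    by (simp add: restrict_measure_def)
  then show "emeasure (restrict_measure (cube_set Q) \<sigma>) (space (restrict_measure (cube_set Q) \<sigma>)) \<noteq> \<infinity>"
    using emeasure_cube_finite[OF \<sigma>, of Q] by auto
qed

lemma truncated_integral_measurable:
  fixes \<sigma> :: "(real ^ 'n::finite) measure"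
  assumes \<sigma>: "locally_finite_borel \<sigma>" and m: "0 < m" and d: "0 < \<delta>" "\<delta> < R" and c: "0 < c"
  shows "truncated_integral c m \<delta> R \<sigma> (cube_set Q) \<in> borel_measurable borel"
proof -
  let ?\<nu> = "restrict_measure (cube_set Q) \<sigma>"
  interpret finite_measure ?\<nu> by (rule finite_restrict_measure[OF \<sigma>])
  have "(\<lambda>x. \<integral>y. riesz_kernel c (truncation m \<delta> R) x y $ l \<partial>?\<nu>) \<in> borel_measurable borel" for l
  proof (rule borel_measurable_lebesgue_integral)
    have "sets (borel \<Otimes>\<^sub>M ?\<nu>) = sets (borel \<Otimes>\<^sub>M (borel :: (real ^ 'n) measure))"
      by (intro sets_pair_measure_cong refl) (simp add: locally_finite_sets[OF \<sigma>] restrict_measure_def)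
    then have "(\<lambda>(x, y). riesz_kernel c (truncation m \<delta> R) x y) \<in> borel_measurable (borel \<Otimes>\<^sub>M ?\<nu>)"
      using riesz_kernel_measurable[OF truncation_measurable] measurable_cong_sets by blast
    then have "(\<lambda>p. (case p of (x, y) \<Rightarrow> riesz_kernel c (truncation m \<delta> R) x y) $ l) \<in> borel_measurable (borel \<Otimes>\<^sub>M ?\<nu>)"
      by (rule borel_measurable_vec_nth)
    then show "(\<lambda>(x, y). riesz_kernel c (truncation m \<delta> R) x y $ l) \<in> borel_measurable (borel \<Otimes>\<^sub>M ?\<nu>)"
      by (simp add: split_def)
  qed
  then show ?thesis
    unfolding kernel_op_restrict[OF \<sigma> m d c, symmetric]
    by (subst borel_measurable_euclidean_space) (auto simp: kernel_op_def Basis_vec_def inner_axis)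
qed

text \<open>
  Cubes of measure zero are not part of the supremum in the testing constant; for them the operator
  vanishes.
\<close>

lemma testing_bound:
  fixes \<sigma> :: "(real ^ 'n::finite) measure"
  assumes \<sigma>: "locally_finite_borel \<sigma>" and a: "\<alpha> < real CARD('n)" and d: "0 < \<delta>" "\<delta> < R" and c: "0 < c"
    and Q: "0 < side Q"
  defines "m \<equiv> real CARD('n) - \<alpha>"
  shows "(\<integral>\<^sup>+x\<in>cube_set Q. ennreal ((norm (truncated_integral c m \<delta> R \<sigma> (cube_set Q) x))\<^sup>2) \<partial>\<omega>)
      \<le> testing_sq (riesz_truncations c \<alpha>) \<sigma> \<omega> * emeasure \<sigma> (cube_set Q)"
    (is "?X \<le> _ * ?s")
proof (cases "?s = 0")
  case True
  then have AE: "AE y in \<sigma>. y \<notin> cube_set Q"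
    by (intro AE_not_in) (simp add: null_sets_def locally_finite_sets[OF \<sigma>])
  have m: "0 < m" using a by (simp add: m_def)
  have "truncated_integral c m \<delta> R \<sigma> (cube_set Q) x = (\<integral>y. 0 \<partial>\<sigma>)" for x
    unfolding truncated_integral_def
    using AE by (intro integral_cong_AE borel_measurable_integrable
        truncated_integrable[OF \<sigma> m d c _ order_refl]) auto
  then show ?thesis by simp
next
  case False
  let ?K = "riesz_kernel c (truncation m \<delta> R) :: real ^ 'n \<Rightarrow> real ^ 'n \<Rightarrow> real ^ 'n"
  have m: "0 < m" using a by (simp add: m_def)
  have "tangent_line_truncation CARD('n) \<alpha> \<delta> R (truncation m \<delta> R)"
    unfolding m_def by (rule truncation_is_tangent_line_truncation[OF a d])
  then have KK: "?K \<in> riesz_truncations c \<alpha>"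
    unfolding riesz_truncations_def using d
    by blast
  have "?X / ?s \<le> testing_sq (riesz_truncations c \<alpha>) \<sigma> \<omega>"
    unfolding testing_sq_def kernel_op_restrict[OF \<sigma> m d c, symmetric]
    by (intro SUP_upper2[OF KK] SUP_upper2[of Q]) (use Q False in \<open>auto simp: cubes_def zero_less_iff_neq_zero\<close>)
  then have "?X / ?s * ?s \<le> testing_sq (riesz_truncations c \<alpha>) \<sigma> \<omega> * ?s" by (intro mult_right_mono) auto
  moreover have "?X / ?s * ?s = ?X"
    using False emeasure_cube_finite[OF \<sigma>, of Q] by (simp add: ennreal_divide_times ennreal_divide_self)
  ultimately show ?thesis by simp
qed


section \<open>The Muckenhoupt and Poisson quantities\<close>

text \<open>
  On \<open>Q\<close> itself the integrand of the reproducing Poisson integral is bounded below by a multiple of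
  \<open>(side Q)^(-m)\<close>, so the one-tailed condition contains the local one.
\<close>

lemma muckenhoupt_local:
  fixes \<sigma> \<omega> :: "(real ^ 'n::finite) measure"
  assumes \<sigma>: "locally_finite_borel \<sigma>" and \<omega>: "locally_finite_borel \<omega>" and a: "\<alpha> < real CARD('n)" and Q: "0 < side Q"
  defines "m \<equiv> real CARD('n) - \<alpha>"
  shows "emeasure \<sigma> (cube_set Q) * emeasure \<omega> (cube_set Q)
    \<le> ennreal (((1 + real CARD('n))\<^sup>2) powr m * side Q powr (2 * m)) * muckenhoupt \<alpha> \<sigma> \<omega>"
proof -
  let ?n = "real CARD('n)" and ?s = "side Q"
  have m: "0 < m" using a by (simp add: m_def)
  define k where "k = (1 / ((1 + ?n)\<^sup>2 * ?s)) powr m"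
  have kpos: "0 < k" using Q by (simp add: k_def add_nonneg_eq_0_iff)
  have "ennreal k * emeasure \<sigma> (cube_set Q) = (\<integral>\<^sup>+x. ennreal k * indicator (cube_set Q) x \<partial>\<sigma>)"
    by (simp add: nn_integral_cmult_indicator locally_finite_sets[OF \<sigma>])
  also have "\<dots> \<le> reproducing_poisson \<alpha> Q \<sigma>"
    unfolding reproducing_poisson_def
  proof (intro nn_integral_mono)
    fix x
    show "ennreal k * indicator (cube_set Q) x \<le> ennreal ((side Q / (side Q + norm (x - cube_center Q))\<^sup>2) powr (?n - \<alpha>))"
    proof (cases "x \<in> cube_set Q")
      case True
      have "norm (x - cube_center Q) \<le> ?n * ?s" by (rule norm_diff_cube_le[OF True cube_center_mem[OF Q]])
      then have "(?s + norm (x - cube_center Q))\<^sup>2 \<le> ((1 + ?n) * ?s)\<^sup>2"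
        using Q by (intro power_mono) (auto simp: algebra_simps)
      then have "?s / ((1 + ?n) * ?s)\<^sup>2 \<le> ?s / (?s + norm (x - cube_center Q))\<^sup>2"
        using Q by (intro divide_left_mono mult_pos_pos zero_less_power) (auto intro: add_pos_nonneg)
      moreover have "?s / ((1 + ?n) * ?s)\<^sup>2 = 1 / ((1 + ?n)\<^sup>2 * ?s)"
        using Q by (simp add: power2_eq_square)
      ultimately show ?thesis using True Q m
        unfolding k_def m_def[symmetric] by (auto intro!: ennreal_leI powr_mono2)
    qed simp
  qed
  finally have P: "ennreal k * emeasure \<sigma> (cube_set Q) \<le> reproducing_poisson \<alpha> Q \<sigma>" .
  have vol: "volume Q powr (1 - \<alpha> / ?n) = ?s powr m"
  proof -
    have "volume Q powr (1 - \<alpha> / ?n) = (?s powr ?n) powr (1 - \<alpha> / ?n)"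
      using Q by (simp add: volume_cube powr_realpow)
    also have "\<dots> = ?s powr (?n * (1 - \<alpha> / ?n))" by (rule powr_powr)
    also have "?n * (1 - \<alpha> / ?n) = m" by (simp add: m_def field_simps)
    finally show ?thesis .
  qed
  have sm: "0 < ?s powr m" using Q by simp
  have "reproducing_poisson \<alpha> Q \<sigma> * (emeasure \<omega> (cube_set Q) / ennreal (?s powr m)) \<le> muckenhoupt \<alpha> \<sigma> \<omega>"
    unfolding muckenhoupt_def using Q vol by (intro SUP_upper2[of Q]) (auto simp: cubes_def)
  moreover have "ennreal k * emeasure \<sigma> (cube_set Q) * (emeasure \<omega> (cube_set Q) / ennreal (?s powr m))
      \<le> reproducing_poisson \<alpha> Q \<sigma> * (emeasure \<omega> (cube_set Q) / ennreal (?s powr m))"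
    by (intro mult_right_mono P) simp
  ultimately have A: "ennreal k * emeasure \<sigma> (cube_set Q) * (emeasure \<omega> (cube_set Q) / ennreal (?s powr m)) \<le> muckenhoupt \<alpha> \<sigma> \<omega>"
    by (rule order_trans[rotated])
  have "emeasure \<sigma> (cube_set Q) * emeasure \<omega> (cube_set Q) =
      ennreal (?s powr m / k) * (ennreal k * emeasure \<sigma> (cube_set Q) * (emeasure \<omega> (cube_set Q) / ennreal (?s powr m)))"
  proof -
    have "ennreal (?s powr m / k) * (ennreal k * emeasure \<sigma> (cube_set Q) * (emeasure \<omega> (cube_set Q) / ennreal (?s powr m)))
      = (ennreal (?s powr m / k) * ennreal k / ennreal (?s powr m)) * (emeasure \<sigma> (cube_set Q) * emeasure \<omega> (cube_set Q))"
      by (simp add: divide_ennreal_def mult_ac)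
    also have "ennreal (?s powr m / k) * ennreal k / ennreal (?s powr m) = 1"
      using kpos sm by (simp add: ennreal_mult[symmetric] divide_ennreal)
    finally show ?thesis by simp
  qed
  also have "\<dots> \<le> ennreal (?s powr m / k) * muckenhoupt \<alpha> \<sigma> \<omega>"
    by (intro mult_left_mono A) simp
  also have "?s powr m / k = ((1 + ?n)\<^sup>2) powr m * ?s powr (2 * m)"
  proof -
    have "k = 1 / (((1 + ?n)\<^sup>2) powr m * ?s powr m)"
      using Q unfolding k_def by (subst powr_divide) (auto simp: powr_mult)
    moreover have "?s powr (2 * m) = ?s powr m * ?s powr m" by (simp add: powr_add[symmetric])
    ultimately show ?thesis by simp
  qed
  finally show ?thesis .
qed

text \<open>
  The Poisson integral of the restriction of \<open>\<sigma>\<close> to \<open>E\<close>, divided by the side of \<open>J\<close>: the size of the gradient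
  on \<open>J\<close> of the operator applied to that measure, if there is no cancellation.
\<close>

definition poisson_tail :: "real \<Rightarrow> (real ^ 'n::finite) measure \<Rightarrow> (real ^ 'n) set \<Rightarrow> 'n cube \<Rightarrow> real" where
  "poisson_tail m \<sigma> E J = (\<integral>y. indicator E y * (side J + norm (y - cube_center J)) powr (- (m + 1)) \<partial>\<sigma>)"

lemma poisson_tail_integrable:
  fixes \<sigma> :: "(real ^ 'n::finite) measure"
  assumes \<sigma>: "locally_finite_borel \<sigma>" and m: "0 < m" and J: "0 < side J"
    and E: "E \<in> sets borel" "E \<subseteq> cube_set I"
  shows "integrable \<sigma> (\<lambda>y. indicator E y * (side J + norm (y - cube_center J)) powr (- (m + 1)))"
proof (rule integrable_bounded_cube[OF \<sigma>, where K = I and B = "side J powr (- (m + 1))"])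
  have "(side J + norm (y - cube_center J)) powr (- (m + 1)) \<le> side J powr (- (m + 1))" for y
    using J m by (intro powr_mono2') auto
  then show "norm (indicat_real E x * (side J + norm (x - cube_center J)) powr (- (m + 1))) \<le> side J powr (- (m + 1))" for x
    by (auto simp: indicator_def)
  show "(\<lambda>y. indicat_real E y * (side J + norm (y - cube_center J)) powr (- (m + 1))) \<in> borel_measurable borel"
    using E by measurable
qed (use E in \<open>auto simp: indicator_def\<close>)

lemma poisson_tail_nonneg: "0 \<le> poisson_tail m \<sigma> E J"
  unfolding poisson_tail_def by (intro integral_nonneg_AE) auto

lemma poisson_eq_tail:
  fixes \<sigma> :: "(real ^ 'n::finite) measure"
  assumes \<sigma>: "locally_finite_borel \<sigma>" and a: "\<alpha> < real CARD('n)" and J: "0 < side J"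
    and E: "E \<in> sets borel" "E \<subseteq> cube_set I"
  shows "poisson \<alpha> J (restrict_measure E \<sigma>) / ennreal (side J) = ennreal (poisson_tail (real CARD('n) - \<alpha>) \<sigma> E J)"
proof -
  let ?p = "real CARD('n) + 1 - \<alpha>"
  have eq: "side J / (side J + norm (x - cube_center J)) powr ?p =
      side J * (side J + norm (x - cube_center J)) powr (- (real CARD('n) - \<alpha> + 1))" for x
  proof -
    have "- (real CARD('n) - \<alpha> + 1) = - ?p" by simp
    then show ?thesis by (simp only: powr_minus divide_inverse)
  qed
  have "poisson \<alpha> J (restrict_measure E \<sigma>) =
      (\<integral>\<^sup>+x. indicator E x * ennreal (side J / (side J + norm (x - cube_center J)) powr ?p) \<partial>\<sigma>)"
    unfolding poisson_def restrict_measure_def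
  proof (rule nn_integral_density)
    show "indicator E \<in> borel_measurable \<sigma>"
      using E(1) by (intro borel_measurable_indicator) (simp add: locally_finite_sets[OF \<sigma>])
    show "(\<lambda>x. ennreal (side J / (side J + norm (x - cube_center J)) powr ?p)) \<in> borel_measurable \<sigma>"
      unfolding measurable_cong_sets[OF locally_finite_sets[OF \<sigma>] refl] by measurable
  qed
  also have "\<dots> = (\<integral>\<^sup>+x. ennreal (side J * (indicator E x * (side J + norm (x - cube_center J)) powr (- (real CARD('n) - \<alpha> + 1)))) \<partial>\<sigma>)"
    unfolding eq by (intro nn_integral_cong) (auto simp: indicator_def)
  also have "\<dots> = ennreal (\<integral>x. side J * (indicator E x * (side J + norm (x - cube_center J)) powr (- (real CARD('n) - \<alpha> + 1))) \<partial>\<sigma>)"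
    using a J by (intro nn_integral_eq_integral integrable_mult_right poisson_tail_integrable[OF \<sigma> _ J E]) auto
  also have "\<dots> = ennreal (side J * poisson_tail (real CARD('n) - \<alpha>) \<sigma> E J)"
    by (simp add: poisson_tail_def)
  finally show ?thesis using J by (simp add: divide_ennreal poisson_tail_nonneg)
qed


section \<open>Reversal of energy\<close>

text \<open>
  For \<open>x\<close> in \<open>J\<close> and \<open>y\<close> outside the dilate of \<open>J\<close>, the distance of \<open>x\<close> and \<open>y\<close> is comparable to the side of \<open>J\<close>
  plus the distance of \<open>y\<close> to the center of \<open>J\<close>, with this ratio. The next three constants are the aperture
  of the cone in which \<open>line_kernel_reversal\<close> applies, and the constants in its lower bound and in the
  error terms.
\<close>

definition comparison_ratio :: "'n::finite itself \<Rightarrow> real" where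
  "comparison_ratio _ = 4 * real CARD('n)"

definition cone_aperture :: "'n::finite itself \<Rightarrow> real \<Rightarrow> real" where
  "cone_aperture N m = sqrt (m / (m + 2)) / comparison_ratio N"

definition reversal_gain :: "'n::finite itself \<Rightarrow> real \<Rightarrow> real" where
  "reversal_gain N m = m / (m + 2) * comparison_ratio N powr (- (m + 1))"

definition reversal_loss :: "'n::finite itself \<Rightarrow> real \<Rightarrow> real" where
  "reversal_loss N m = (m + 2) * comparison_ratio N powr (m + 1)"

lemma comparison_ratio_ge: "4 \<le> comparison_ratio TYPE('n::finite)"
  using card_ge_1[where 'n = 'n] by (simp add: comparison_ratio_def)

lemma reversal_constants_pos:
  assumes "0 < m"
  shows "0 < cone_aperture TYPE('n::finite) m" "0 < reversal_gain TYPE('n::finite) m" "0 < reversal_loss TYPE('n::finite) m"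
proof -
  have "0 < comparison_ratio TYPE('n)" using comparison_ratio_ge[where 'n = 'n] by simp
  then show "0 < cone_aperture TYPE('n) m" "0 < reversal_gain TYPE('n) m" "0 < reversal_loss TYPE('n) m"
    using assms by (simp_all add: cone_aperture_def reversal_gain_def reversal_loss_def)
qed

lemma outside_dilate_comparison:
  fixes J :: "'n::finite cube"
  assumes y: "y \<notin> cube_set (dilate \<gamma> J)" and g: "2 \<le> \<gamma>" and x: "x \<in> cube_set J"
  defines "T \<equiv> side J + norm (y - cube_center J)"
  shows "T / comparison_ratio TYPE('n) \<le> norm (x - y)" "norm (x - y) \<le> comparison_ratio TYPE('n) * T" "side J / 2 \<le> norm (x - y)"
proof -
  let ?n = "real CARD('n)" and ?c = "cube_center J" and ?s = "side J"
  have s: "0 < ?s" by (rule side_pos_of_mem[OF x])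
  have n1: "1 \<le> ?n" by (rule card_ge_1)
  obtain i where i: "\<And>j. \<bar>y $ j - ?c $ j\<bar> \<le> \<bar>y $ i - ?c $ i\<bar>"
  proof -
    let ?f = "\<lambda>j. \<bar>y $ j - ?c $ j\<bar>"
    have "Max (range ?f) \<in> range ?f" by (intro Max_in) auto
    then obtain i where i: "Max (range ?f) = ?f i" by blast
    have "?f j \<le> Max (range ?f)" for j by (intro Max_ge) auto
    then show ?thesis using that[of i] unfolding i by blast
  qed
  define M where "M = \<bar>y $ i - ?c $ i\<bar>"
  obtain k where k: "\<gamma> * ?s / 2 \<le> \<bar>y $ k - ?c $ k\<bar>" using outside_dilate_component[OF y] .
  have "2 * ?s \<le> \<gamma> * ?s" using g s by (intro mult_right_mono) auto
  then have M: "?s \<le> M" using k i[of k] by (simp add: M_def)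
  have xi: "\<bar>x $ i - ?c $ i\<bar> \<le> ?s / 2" by (rule center_dist_component[OF x])
  have half: "M / 2 \<le> norm (x - y)"
  proof -
    have "b \<le> a' + a" if "a = \<bar>p - q\<bar>" "a' = \<bar>p - r\<bar>" "b = \<bar>r - q\<bar>" for a a' b p q r :: real
      using that by linarith
    from this[OF refl refl refl] have "M \<le> \<bar>x $ i - y $ i\<bar> + \<bar>x $ i - ?c $ i\<bar>" unfolding M_def .
    moreover have "\<bar>x $ i - y $ i\<bar> \<le> norm (x - y)" using component_le_norm_cart[of "x - y" i] by simp
    ultimately show ?thesis using xi M by linarith
  qed
  then show "?s / 2 \<le> norm (x - y)" using M by simp
  have yc: "norm (y - ?c) \<le> ?n * M"
    by (rule norm_le_card_mult) (use i in \<open>simp add: M_def\<close>)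
  have "1 * M \<le> ?n * M" using n1 M s by (intro mult_right_mono) auto
  then have "T \<le> 2 * (?n * M)" using yc M by (simp add: T_def)
  also have "\<dots> = comparison_ratio TYPE('n) * (M / 2)" by (simp add: comparison_ratio_def)
  also have "\<dots> \<le> comparison_ratio TYPE('n) * norm (x - y)"
    using half comparison_ratio_ge[where 'n = 'n] by (intro mult_left_mono) auto
  finally show "T / comparison_ratio TYPE('n) \<le> norm (x - y)"
    using comparison_ratio_ge[where 'n = 'n] by (simp add: divide_le_eq mult.commute)
  have "norm (x - y) \<le> norm (x - ?c) + norm (y - ?c)"
    using norm_triangle_ineq4[of "x - ?c" "y - ?c"] by simp
  also have "\<dots> \<le> ?n * ?s + 1 * norm (y - ?c)"
    using norm_diff_cube_le[OF x cube_center_mem[OF s]] by simp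
  also have "\<dots> \<le> ?n * ?s + ?n * norm (y - ?c)"
    using n1 by (intro add_left_mono mult_right_mono) auto
  also have "\<dots> = ?n * T" by (simp add: T_def algebra_simps)
  also have "\<dots> \<le> comparison_ratio TYPE('n) * T"
    using s by (intro mult_right_mono) (auto simp: T_def comparison_ratio_def intro: add_nonneg_nonneg)
  finally show "norm (x - y) \<le> comparison_ratio TYPE('n) * T" .
qed

lemma truncated_integral_Diff:
  fixes \<sigma> :: "(real ^ 'n::finite) measure"
  assumes \<sigma>: "locally_finite_borel \<sigma>" and m: "0 < m" and d: "0 < \<delta>" "\<delta> < R" and c: "0 < c"
    and Q: "cube_set Q \<subseteq> cube_set I"
  shows "truncated_integral c m \<delta> R \<sigma> (cube_set I - cube_set Q) x =
    truncated_integral c m \<delta> R \<sigma> (cube_set I) x - truncated_integral c m \<delta> R \<sigma> (cube_set Q) x"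
proof -
  have "indicator (cube_set I - cube_set Q) y *\<^sub>R v = indicator (cube_set I) y *\<^sub>R v - indicator (cube_set Q) y *\<^sub>R v"
    for y and v :: "real ^ 'n"
    using Q by (auto simp: indicator_def)
  then show ?thesis unfolding truncated_integral_def
    by (simp add: Bochner_Integration.integral_diff truncated_integrable[OF \<sigma> m d c _ order_refl]
        truncated_integrable[OF \<sigma> m d c _ Q])
qed

text \<open>
  One cube \<open>J\<close> of the energy sum. The truncation is fine enough to leave the kernel unchanged between points
  of \<open>J\<close> and points of \<open>I\<close> outside the dilate of \<open>J\<close>.
\<close>

locale reversal_setup =
  fixes \<sigma> :: "(real ^ 'n::finite) measure" and m c \<delta> R \<gamma> :: real and I J :: "'n cube"
  assumes \<sigma>: "locally_finite_borel \<sigma>" and m: "0 < m" and c: "0 < c" and g: "2 \<le> \<gamma>"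
    and d: "0 < \<delta>" "\<delta> \<le> side J / 2" "real CARD('n) * side I \<le> R" "\<delta> < R"
    and J: "0 < side J" and JI: "cube_set (dilate \<gamma> J) \<subseteq> cube_set I"
begin

abbreviation "N \<equiv> TYPE('n)"
abbreviation "shell \<equiv> cube_set I - cube_set (dilate \<gamma> J)"
abbreviation "U \<equiv> truncated_integral c m \<delta> R \<sigma> shell"
abbreviation "tail E \<equiv> poisson_tail m \<sigma> E J"
abbreviation "weight y \<equiv> (side J + norm (y - cube_center J)) powr (- (m + 1))"
abbreviation "krn \<equiv> riesz_kernel c (truncation m \<delta> R)"

lemma J_sub_I: "cube_set J \<subseteq> cube_set I"
  using cube_subset_dilate[of \<gamma> J] g J JI by auto

lemma shell_sets: "shell \<in> sets borel" "shell \<subseteq> cube_set I"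
  by auto

lemma shell_kernel:
  assumes x: "x \<in> cube_set J" and y: "y \<in> shell"
  shows "krn x y \<bullet> e = c * line_kernel m e (x - y)"
proof (rule riesz_kernel_line)
  show "\<delta> \<le> norm (x - y)"
    using outside_dilate_comparison(3)[OF _ g x, of y] y d(2) by auto
  have "norm (x - y) \<le> real CARD('n) * side I"
    using x y J_sub_I by (intro norm_diff_cube_le) auto
  then show "norm (x - y) \<le> R" using d(3) by simp
qed (rule d(1))

lemma tail_int:
  assumes "E \<in> sets borel" "E \<subseteq> shell"
  shows "integrable \<sigma> (\<lambda>y. indicator E y * weight y)"
  using assms by (intro poisson_tail_integrable[OF \<sigma> m J, where I = I]) auto

lemma segment_comparison:
  assumes x: "x \<in> cube_set J" and z: "z \<in> cube_set J" and y: "y \<in> shell" and t: "0 \<le> t" "t \<le> 1"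
  defines "T \<equiv> side J + norm (y - cube_center J)"
  shows "T / comparison_ratio N \<le> norm (z - y + t *\<^sub>R (x - z))" "norm (z - y + t *\<^sub>R (x - z)) \<le> comparison_ratio N * T"
proof -
  have "(1 - t) *\<^sub>R z + t *\<^sub>R x \<in> cube_set J"
    using convex_cube_set[of J] x z t unfolding convex_alt by blast
  note cmp = outside_dilate_comparison(1,2)[OF _ g this, of y]
  have "(1 - t) *\<^sub>R z + t *\<^sub>R x - y = z - y + t *\<^sub>R (x - z)" by (simp add: algebra_simps)
  then show "T / comparison_ratio N \<le> norm (z - y + t *\<^sub>R (x - z))" "norm (z - y + t *\<^sub>R (x - z)) \<le> comparison_ratio N * T"
    using cmp y unfolding T_def by (simp_all only: Diff_iff not_False_eq_True)
qed

text \<open>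
  For a point \<open>y\<close> outside \<open>Far\<close> the whole segment of differences stays in the cone, and the increment of the
  kernel has the sign opposite to that of \<open>x - z\<close> along \<open>e\<close>. That sign does not depend on \<open>y\<close>. For \<open>y\<close> in \<open>Far\<close>
  nothing is gained, and the Lipschitz bound is charged to the last term.
\<close>

lemma reversal_pointwise:
  assumes e: "norm e = 1" and x: "x \<in> cube_set J" and z: "z \<in> cube_set J" and y: "y \<in> shell"
    and near: "y \<notin> Far \<Longrightarrow> \<forall>t. 0 \<le> t \<and> t \<le> 1 \<longrightarrow>
      norm (perp e (z - y + t *\<^sub>R (x - z))) \<le> cone_aperture N m * (side J + norm (y - cube_center J))"
  shows "reversal_gain N m * \<bar>(x - z) \<bullet> e\<bar> * weight y \<le>
    - sgn ((x - z) \<bullet> e) / c * ((krn x y - krn z y) \<bullet> e)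
    + reversal_loss N m * norm (perp e (x - z)) * weight y
    + (reversal_gain N m + reversal_loss N m) * norm (x - z) * (indicator Far y * weight y)"
proof -
  define T where "T = side J + norm (y - cube_center J)"
  have T: "0 < T" using J by (simp add: T_def add_pos_nonneg)
  have k: "0 < comparison_ratio N" using comparison_ratio_ge[where 'n = 'n] by simp
  define dF where "dF = line_kernel m e (x - y) - line_kernel m e (z - y)"
  define u where "u = (x - z) \<bullet> e"
  have up: "m + 1 \<le> m + 2" by simp
  have xz: "z - y + (x - z) = x - y" by simp
  have ker: "- sgn u / c * ((krn x y - krn z y) \<bullet> e) = - sgn u * dF"
    using c by (simp add: inner_diff_left shell_kernel[OF x y] shell_kernel[OF z y] dF_def right_diff_distrib[symmetric])
  have sgc: "\<bar>- sgn u * dF\<bar> \<le> \<bar>dF\<bar>" by (simp add: abs_mult sgn_real_def)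
  show ?thesis
  proof (cases "y \<in> Far")
    case True
    have "\<bar>dF\<bar> \<le> reversal_loss N m * norm (x - z) * weight y"
      using line_kernel_lipschitz[OF e m T k, of "z - y" "x - z"] segment_comparison[OF x z y]
      by (simp add: dF_def xz T_def reversal_loss_def)
    then have "- sgn u * dF \<ge> - (reversal_loss N m * norm (x - z) * weight y)" using sgc by linarith
    moreover have "reversal_gain N m * \<bar>u\<bar> * weight y \<le> reversal_gain N m * norm (x - z) * weight y"
      using abs_inner_unit_le[OF e, of "x - z"] reversal_constants_pos(2)[OF m, where 'n = 'n]
      by (intro mult_right_mono mult_left_mono) (auto simp: u_def)
    moreover have "0 \<le> reversal_loss N m * norm (perp e (x - z)) * weight y"
      using reversal_constants_pos(3)[OF m, where 'n = 'n] by simp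
    ultimately show ?thesis using True ker by (simp add: u_def algebra_simps)
  next
    case False
    have "m / (m + 2) * comparison_ratio N powr (- (m + 1)) * \<bar>u\<bar> * weight y
           \<le> - sgn u * dF + (m + 1) * comparison_ratio N powr (m + 1) * norm (perp e (x - z)) * weight y"
      using line_kernel_reversal[OF e m T k, of "z - y" "x - z"] segment_comparison[OF x z y] near[OF False]
      by (simp add: dF_def xz T_def cone_aperture_def u_def)
    also have "(m + 1) * comparison_ratio N powr (m + 1) * norm (perp e (x - z)) * weight y \<le>
        reversal_loss N m * norm (perp e (x - z)) * weight y"
      unfolding reversal_loss_def by (intro mult_right_mono up) auto
    finally show ?thesis using False ker by (simp add: u_def reversal_gain_def)
  qed
qed

text \<open>
  Since the sign in \<open>reversal_pointwise\<close> is the same for all \<open>y\<close>, integration in \<open>y\<close> causes no cancellation: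
  the increment of the operator bounds the full Poisson tail, up to the two error terms.
\<close>

lemma reversal_integrated:
  assumes e: "norm e = 1" and x: "x \<in> cube_set J" and z: "z \<in> cube_set J" and Far: "Far \<in> sets borel"
    and near: "AE y in \<sigma>. y \<notin> Far \<longrightarrow> (\<forall>t. 0 \<le> t \<and> t \<le> 1 \<longrightarrow>
      norm (perp e (z - y + t *\<^sub>R (x - z))) \<le> cone_aperture N m * (side J + norm (y - cube_center J)))"
  shows "reversal_gain N m * \<bar>(x - z) \<bullet> e\<bar> * tail shell \<le>
    (norm (U x) + norm (U z)) / c + reversal_loss N m * norm (perp e (x - z)) * tail shell
    + (reversal_gain N m + reversal_loss N m) * norm (x - z) * tail (shell \<inter> Far)"
proof -
  let ?u = "(x - z) \<bullet> e"
  have intw: "integrable \<sigma> (\<lambda>y. indicator shell y * weight y)" by (intro tail_int) auto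
  have intF: "integrable \<sigma> (\<lambda>y. indicator (shell \<inter> Far) y * weight y)" using Far by (intro tail_int) auto
  have intU: "integrable \<sigma> (\<lambda>y. indicator shell y *\<^sub>R krn v y)" for v
    by (rule truncated_integrable[OF \<sigma> m d(1,4) c shell_sets])
  have intK: "integrable \<sigma> (\<lambda>y. indicator shell y * ((krn x y - krn z y) \<bullet> e))"
  proof -
    have "integrable \<sigma> (\<lambda>y. (indicator shell y *\<^sub>R krn x y - indicator shell y *\<^sub>R krn z y) \<bullet> e)"
      by (intro integrable_inner_left Bochner_Integration.integrable_diff intU)
    then show ?thesis by (simp add: inner_diff_left right_diff_distrib)
  qed
  have U: "(\<integral>y. indicator shell y * ((krn x y - krn z y) \<bullet> e) \<partial>\<sigma>) = (U x - U z) \<bullet> e"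
  proof -
    have "(\<integral>y. indicator shell y * ((krn x y - krn z y) \<bullet> e) \<partial>\<sigma>) =
       (\<integral>y. (indicator shell y *\<^sub>R krn x y - indicator shell y *\<^sub>R krn z y) \<bullet> e \<partial>\<sigma>)"
      by (simp add: inner_diff_left right_diff_distrib)
    also have "\<dots> = (\<integral>y. indicator shell y *\<^sub>R krn x y - indicator shell y *\<^sub>R krn z y \<partial>\<sigma>) \<bullet> e"
      by (intro integral_inner_left Bochner_Integration.integrable_diff intU)
    also have "\<dots> = (U x - U z) \<bullet> e"
      unfolding truncated_integral_def by (subst Bochner_Integration.integral_diff[OF intU intU]) simp
    finally show ?thesis .
  qed
  have "(\<integral>y. (reversal_gain N m * \<bar>?u\<bar>) * (indicator shell y * weight y) \<partial>\<sigma>) \<le>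
    (\<integral>y. (- sgn ?u / c) * (indicator shell y * ((krn x y - krn z y) \<bullet> e))
      + (reversal_loss N m * norm (perp e (x - z))) * (indicator shell y * weight y)
      + ((reversal_gain N m + reversal_loss N m) * norm (x - z)) * (indicator (shell \<inter> Far) y * weight y) \<partial>\<sigma>)"
  proof (rule integral_mono_AE)
    show "integrable \<sigma> (\<lambda>y. (reversal_gain N m * \<bar>?u\<bar>) * (indicator shell y * weight y))"
      by (intro integrable_mult_right intw)
    show "integrable \<sigma> (\<lambda>y. (- sgn ?u / c) * (indicator shell y * ((krn x y - krn z y) \<bullet> e))
      + (reversal_loss N m * norm (perp e (x - z))) * (indicator shell y * weight y)
      + ((reversal_gain N m + reversal_loss N m) * norm (x - z)) * (indicator (shell \<inter> Far) y * weight y))"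
      by (intro Bochner_Integration.integrable_add integrable_mult_right intw intF intK)
    show "AE y in \<sigma>. (reversal_gain N m * \<bar>?u\<bar>) * (indicator shell y * weight y) \<le>
      (- sgn ?u / c) * (indicator shell y * ((krn x y - krn z y) \<bullet> e))
      + (reversal_loss N m * norm (perp e (x - z))) * (indicator shell y * weight y)
      + ((reversal_gain N m + reversal_loss N m) * norm (x - z)) * (indicator (shell \<inter> Far) y * weight y)"
      using near
    proof eventually_elim
      case (elim y)
      show ?case
      proof (cases "y \<in> shell")
        case True
        then have "indicator (shell \<inter> Far) y = (indicator Far y :: real)" by (simp add: indicator_def)
        then show ?thesis
          using reversal_pointwise[OF e x z True, of Far] elim True by simp
      next
        case False
        then have "indicator (shell \<inter> Far) y = (0 :: real)" "indicator shell y = (0::real)" by auto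
        then show ?thesis by (simp only: mult_zero_left mult_zero_right add_0 order_refl)
      qed
    qed
  qed
  also have "\<dots> = - sgn ?u / c * ((U x - U z) \<bullet> e) + reversal_loss N m * norm (perp e (x - z)) * tail shell
      + (reversal_gain N m + reversal_loss N m) * norm (x - z) * tail (shell \<inter> Far)"
    unfolding poisson_tail_def U[symmetric]
    by (simp only: Bochner_Integration.integral_add Bochner_Integration.integrable_add
        integrable_mult_right intw intF intK integral_mult_right_zero)
  also have "(\<integral>y. (reversal_gain N m * \<bar>?u\<bar>) * (indicator shell y * weight y) \<partial>\<sigma>) = reversal_gain N m * \<bar>?u\<bar> * tail shell"
    unfolding poisson_tail_def by (rule integral_mult_right_zero)
  finally have main: "reversal_gain N m * \<bar>?u\<bar> * tail shell \<le> - sgn ?u / c * ((U x - U z) \<bullet> e)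
      + reversal_loss N m * norm (perp e (x - z)) * tail shell
      + (reversal_gain N m + reversal_loss N m) * norm (x - z) * tail (shell \<inter> Far)" .
  have bd: "\<bar>- sgn ?u / c * ((U x - U z) \<bullet> e)\<bar> \<le> 1 / c * (norm (U x) + norm (U z))"
    unfolding abs_mult
  proof (intro mult_mono)
    show "\<bar>- sgn ?u / c\<bar> \<le> 1 / c" using c by (simp add: sgn_real_def)
    show "\<bar>(U x - U z) \<bullet> e\<bar> \<le> norm (U x) + norm (U z)"
      using abs_inner_unit_le[OF e, of "U x - U z"] norm_triangle_ineq4[of "U x" "U z"] by linarith
  qed (use c in auto)
  have "- sgn ?u / c * ((U x - U z) \<bullet> e) \<le> 1 / c * (norm (U x) + norm (U z))"
    by (rule order_trans[OF abs_ge_self bd])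
  also have "\<dots> = (norm (U x) + norm (U z)) / c" by simp
  finally have "- sgn ?u / c * ((U x - U z) \<bullet> e) \<le> (norm (U x) + norm (U z)) / c" .
  with main show ?thesis by linarith
qed

lemma tail_nonneg: "0 \<le> tail E"
  by (rule poisson_tail_nonneg)

text \<open>
  When \<open>x\<close> and \<open>z\<close> are on the line, moving from one to the other does not change the perpendicular part of
  the difference to \<open>y\<close>. It is the distance of \<open>y\<close> to the line, so the exceptional points \<open>y\<close> are those far
  from the line compared with their distance to \<open>J\<close>.
\<close>

lemma reversal_on_line:
  assumes e: "norm e = 1" and x: "x \<in> cube_set J" "perp e x = p" and z: "z \<in> cube_set J" "perp e z = p"
  defines "Far \<equiv> {y. cone_aperture N m * (side J + norm (y - cube_center J)) < norm (perp e y - p)}"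
  shows "tail shell * norm (x - z) \<le> (1 / (c * reversal_gain N m)) * (norm (U x) + norm (U z))
    + ((1 + reversal_loss N m / reversal_gain N m) * real CARD('n)) * (side J * tail (shell \<inter> Far))"
proof -
  have Far: "Far \<in> sets borel" unfolding Far_def perp_def by measurable
  have p0: "perp e (x - z) = 0" using x z by (simp add: perp_diff)
  have L: "0 < reversal_gain N m" "0 < reversal_loss N m" using reversal_constants_pos[OF m, where 'n = 'n] by auto
  have "norm (perp e (z - y + t *\<^sub>R (x - z))) = norm (perp e y - p)" for y t
    using p0 z by (simp add: perp_add perp_scale perp_diff[of e z y] norm_minus_commute)
  then have "reversal_gain N m * \<bar>(x - z) \<bullet> e\<bar> * tail shell \<le>
    (norm (U x) + norm (U z)) / c + reversal_loss N m * norm (perp e (x - z)) * tail shell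
    + (reversal_gain N m + reversal_loss N m) * norm (x - z) * tail (shell \<inter> Far)"
    by (intro reversal_integrated[OF e x(1) z(1) Far]) (simp add: Far_def not_less)
  moreover have "\<bar>(x - z) \<bullet> e\<bar> = norm (x - z)"
  proof (rule power2_eq_imp_eq)
    show "\<bar>(x - z) \<bullet> e\<bar>\<^sup>2 = (norm (x - z))\<^sup>2" using norm_sq_perp[OF e, of "x - z"] p0 by simp
  qed auto
  ultimately have "reversal_gain N m * (tail shell * norm (x - z)) \<le>
    (norm (U x) + norm (U z)) / c + (reversal_gain N m + reversal_loss N m) * norm (x - z) * tail (shell \<inter> Far)"
    using p0 by (simp add: mult_ac)
  also have "\<dots> \<le> (norm (U x) + norm (U z)) / c + (reversal_gain N m + reversal_loss N m) * (real CARD('n) * side J) * tail (shell \<inter> Far)"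
    using norm_diff_cube_le[OF x(1) z(1)] L tail_nonneg
    by (intro add_left_mono mult_right_mono mult_left_mono) auto
  finally have "tail shell * norm (x - z) \<le> ((norm (U x) + norm (U z)) / c
      + (reversal_gain N m + reversal_loss N m) * (real CARD('n) * side J) * tail (shell \<inter> Far)) / reversal_gain N m"
    using L by (simp add: pos_le_divide_eq mult.commute)
  also have "\<dots> = (1 / (c * reversal_gain N m)) * (norm (U x) + norm (U z))
    + ((1 + reversal_loss N m / reversal_gain N m) * real CARD('n)) * (side J * tail (shell \<inter> Far))"
    using L c by (simp add: add_divide_distrib distrib_right)
  finally show ?thesis .
qed

text \<open>
  When \<open>\<sigma>\<close> is on the line, all \<open>x - y\<close> have the same perpendicular part \<open>q\<close>. The component of the kernel along
  \<open>q\<close> is then nonnegative for every \<open>y\<close>, and the operator on all of \<open>I\<close> dominates \<open>|q|\<close> times the Poisson tail.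
\<close>

lemma perp_part_bound:
  assumes e: "norm e = 1" and line: "AE y in \<sigma>. perp e (y - a) = 0" and x: "x \<in> cube_set J"
  shows "norm (perp e (x - a)) * tail shell \<le>
    (comparison_ratio N powr (m + 1) / c) * norm (truncated_integral c m \<delta> R \<sigma> (cube_set I) x)"
proof -
  define q where "q = perp e (x - a)"
  let ?G = "truncated_integral c m \<delta> R \<sigma> (cube_set I) x"
  let ?k = "c * comparison_ratio N powr (- (m + 1))"
  have k: "0 < comparison_ratio N" using comparison_ratio_ge[where 'n = 'n] by simp
  have intG: "integrable \<sigma> (\<lambda>y. indicator (cube_set I) y *\<^sub>R krn x y)"
    by (rule truncated_integrable[OF \<sigma> m d(1,4) c]) auto
  have intw: "integrable \<sigma> (\<lambda>y. indicator shell y * weight y)" by (intro tail_int) auto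
  have "(\<integral>y. (?k * (norm q)\<^sup>2) * (indicator shell y * weight y) \<partial>\<sigma>) \<le> (\<integral>y. (indicator (cube_set I) y *\<^sub>R krn x y) \<bullet> q \<partial>\<sigma>)"
  proof (rule integral_mono_AE)
    show "integrable \<sigma> (\<lambda>y. (?k * (norm q)\<^sup>2) * (indicator shell y * weight y))"
      by (intro integrable_mult_right intw)
    show "integrable \<sigma> (\<lambda>y. (indicator (cube_set I) y *\<^sub>R krn x y) \<bullet> q)"
      by (intro integrable_inner_left intG)
    show "AE y in \<sigma>. (?k * (norm q)\<^sup>2) * (indicator shell y * weight y) \<le> (indicator (cube_set I) y *\<^sub>R krn x y) \<bullet> q"
      using line
    proof eventually_elim
      case (elim y)
      have pw: "perp e (x - y) = q"
      proof -
        have "x - y = (x - a) - (y - a)" by simp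
        then have "perp e (x - y) = perp e (x - a) - perp e (y - a)" by (metis perp_diff)
        then show ?thesis using elim by (simp add: q_def)
      qed
      have qe: "q \<bullet> e = 0" using perp_orth[OF e] by (simp add: q_def)
      have "perp e q = q" using qe by (simp add: perp_def)
      then have dot: "(x - y) \<bullet> q = (norm q)\<^sup>2"
        using inner_eq_perp[OF e, of "x - y" q] qe pw by (simp add: power2_norm_eq_inner)
      have ker: "krn x y \<bullet> q = c * truncation m \<delta> R (norm (x - y)) / norm (x - y) * (norm q)\<^sup>2"
        by (simp add: riesz_kernel_eq dot)
      have nonneg: "0 \<le> krn x y \<bullet> q"
        unfolding ker using truncation_bounds(1)[OF m d(1,4), of "norm (x - y)"] c by simp
      show ?case
      proof (cases "y \<in> shell")
        case False
        then show ?thesis using nonneg by (auto simp: indicator_def)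
      next
        case True
        let ?w = "norm (x - y)"
        have s2: "side J / 2 \<le> ?w" using outside_dilate_comparison(3)[OF _ g x, of y] True by auto
        then have wpos: "0 < ?w" using J by linarith
        have "?w \<le> real CARD('n) * side I" using x True J_sub_I by (intro norm_diff_cube_le) auto
        then have tr: "truncation m \<delta> R ?w = ?w powr (- m)" using s2 d by (intro truncation_eq) auto
        have pm: "?w powr (- m) / ?w = ?w powr (- (m + 1))"
          using powr_diff[of ?w "- m" 1] wpos by simp
        have T: "0 < side J + norm (y - cube_center J)" using J by (simp add: add_pos_nonneg)
        have "comparison_ratio N powr (- (m + 1)) * weight y \<le> ?w powr (- (m + 1))"
          using outside_dilate_comparison(1,2)[OF _ g x, of y] True m
          by (intro powr_neg_bounds(2)[OF T k]) auto
        then have "c * (comparison_ratio N powr (- (m + 1)) * weight y) * (norm q)\<^sup>2 \<le> c * (?w powr (- (m + 1))) * (norm q)\<^sup>2"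
          using c by (intro mult_right_mono mult_left_mono) auto
        also have "\<dots> = krn x y \<bullet> q" unfolding ker tr pm[symmetric] by simp
        finally show ?thesis using True by (simp add: mult_ac)
      qed
    qed
  qed
  also have "\<dots> = ?G \<bullet> q"
    unfolding truncated_integral_def by (intro integral_inner_left intG)
  also have "\<dots> \<le> norm ?G * norm q" by (rule norm_cauchy_schwarz)
  finally have le: "?k * (norm q)\<^sup>2 * tail shell \<le> norm ?G * norm q"
    by (simp add: poisson_tail_def)
  have kk: "comparison_ratio N powr (- (m + 1)) = 1 / comparison_ratio N powr (m + 1)"
    by (simp only: powr_minus divide_inverse mult_1)
  show ?thesis
  proof (cases "norm q = 0")
    case True
    then show ?thesis using c by (simp add: q_def)
  next
    case False
    then have q: "0 < norm q" by simp
    have "norm q * (?k * (norm q * tail shell)) \<le> norm q * norm ?G"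
      using le by (simp add: power2_eq_square mult_ac)
    then have "?k * (norm q * tail shell) \<le> norm ?G" using q by (simp only: mult_le_cancel_left_pos)
    then show ?thesis using c k unfolding q_def kk by (simp add: field_simps)
  qed
qed

text \<open>
  If both points are close to the line, the cone condition holds for every \<open>y\<close> on the line and only the
  perpendicular error term is left. Otherwise the distance of \<open>x\<close> and \<open>z\<close> is itself bounded by a multiple of
  their distances to the line. Either way \<open>perp_part_bound\<close> takes care of the perpendicular parts.
\<close>

lemma reversal_from_line:
  assumes e: "norm e = 1" and line: "AE y in \<sigma>. perp e (y - a) = 0"
    and x: "x \<in> cube_set J" and z: "z \<in> cube_set J"
  shows "tail shell * norm (x - z) \<le> (1 / (c * reversal_gain N m)) * (norm (U x) + norm (U z))
    + ((1 + reversal_loss N m / reversal_gain N m + real CARD('n) / cone_aperture N m) * (comparison_ratio N powr (m + 1) / c)) *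
      (norm (truncated_integral c m \<delta> R \<sigma> (cube_set I) x) + norm (truncated_integral c m \<delta> R \<sigma> (cube_set I) z))"
proof -
  let ?p = "\<lambda>x. norm (perp e (x - a))"
  let ?G = "\<lambda>x. norm (truncated_integral c m \<delta> R \<sigma> (cube_set I) x)"
  let ?L = "reversal_gain N m" and ?Up = "reversal_loss N m" and ?\<eta> = "cone_aperture N m"
  have L: "0 < ?\<eta>" "0 < ?L" "0 < ?Up" using reversal_constants_pos[OF m, where 'n = 'n] by auto
  have PP: "(?p x + ?p z) * tail shell \<le> (comparison_ratio N powr (m + 1) / c) * (?G x + ?G z)"
    using perp_part_bound[OF e line x] perp_part_bound[OF e line z] by (simp add: distrib_left distrib_right)
  have "tail shell * norm (x - z) \<le> (1 / (c * ?L)) * (norm (U x) + norm (U z))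
    + (1 + ?Up / ?L + real CARD('n) / ?\<eta>) * ((?p x + ?p z) * tail shell)"
  proof (cases "?p x \<le> ?\<eta> * side J \<and> ?p z \<le> ?\<eta> * side J")
    case True
    have "reversal_gain N m * \<bar>(x - z) \<bullet> e\<bar> * tail shell \<le>
      (norm (U x) + norm (U z)) / c + reversal_loss N m * norm (perp e (x - z)) * tail shell
      + (reversal_gain N m + reversal_loss N m) * norm (x - z) * tail (shell \<inter> {})"
    proof (rule reversal_integrated[OF e x z])
      show "AE y in \<sigma>. y \<notin> {} \<longrightarrow> (\<forall>t. 0 \<le> t \<and> t \<le> 1 \<longrightarrow>
        norm (perp e (z - y + t *\<^sub>R (x - z))) \<le> cone_aperture N m * (side J + norm (y - cube_center J)))"
        using line
      proof eventually_elim
        case (elim y)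
        show ?case
        proof (intro impI allI)
          fix t :: real assume t: "0 \<le> t \<and> t \<le> 1"
          have "z - y + t *\<^sub>R (x - z) = (1 - t) *\<^sub>R (z - a) + t *\<^sub>R (x - a) - (y - a)" by (simp add: algebra_simps)
          then have "perp e (z - y + t *\<^sub>R (x - z)) = (1 - t) *\<^sub>R perp e (z - a) + t *\<^sub>R perp e (x - a) - perp e (y - a)"
            by (simp only: perp_add perp_scale perp_diff)
          then have "norm (perp e (z - y + t *\<^sub>R (x - z))) \<le> (1 - t) * ?p z + t * ?p x"
            using elim t norm_triangle_ineq[of "(1 - t) *\<^sub>R perp e (z - a)" "t *\<^sub>R perp e (x - a)"] by simp
          also have "\<dots> \<le> (1 - t) * (?\<eta> * side J) + t * (?\<eta> * side J)"
            using True t by (intro add_mono mult_left_mono) auto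
          also have "\<dots> = ?\<eta> * side J" by (simp add: algebra_simps)
          also have "\<dots> \<le> ?\<eta> * (side J + norm (y - cube_center J))"
            using L by (intro mult_left_mono) auto
          finally show "norm (perp e (z - y + t *\<^sub>R (x - z))) \<le> ?\<eta> * (side J + norm (y - cube_center J))" .
        qed
      qed
    qed simp
    then have main: "?L * \<bar>(x - z) \<bullet> e\<bar> * tail shell \<le>
      (norm (U x) + norm (U z)) / c + ?Up * norm (perp e (x - z)) * tail shell"
      by (simp add: poisson_tail_def)
    have ph: "norm (perp e (x - z)) \<le> ?p x + ?p z"
    proof -
      have "perp e (x - z) = perp e (x - a) - perp e (z - a)" by (simp add: perp_diff)
      then show ?thesis by (simp add: norm_triangle_ineq4)
    qed
    have "?L * (\<bar>(x - z) \<bullet> e\<bar> * tail shell) \<le> (norm (U x) + norm (U z)) / c + ?Up * norm (perp e (x - z)) * tail shell"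
      using main by (simp add: mult.assoc)
    also have "\<dots> \<le> (norm (U x) + norm (U z)) / c + ?Up * (?p x + ?p z) * tail shell"
      using ph L tail_nonneg by (intro add_left_mono mult_right_mono mult_left_mono) auto
    finally have "\<bar>(x - z) \<bullet> e\<bar> * tail shell \<le> ((norm (U x) + norm (U z)) / c + ?Up * (?p x + ?p z) * tail shell) / ?L"
      using L by (simp add: pos_le_divide_eq mult.commute)
    also have "\<dots> = (1 / (c * ?L)) * (norm (U x) + norm (U z)) + (?Up / ?L) * ((?p x + ?p z) * tail shell)"
      by (simp add: add_divide_distrib)
    finally have A: "\<bar>(x - z) \<bullet> e\<bar> * tail shell \<le> (1 / (c * ?L)) * (norm (U x) + norm (U z)) + (?Up / ?L) * ((?p x + ?p z) * tail shell)" .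
    have "norm (x - z) * tail shell \<le> (\<bar>(x - z) \<bullet> e\<bar> + (?p x + ?p z)) * tail shell"
      using norm_le_perp_sum[OF e, of "x - z"] ph tail_nonneg by (intro mult_right_mono) auto
    also have "\<dots> \<le> (1 / (c * ?L)) * (norm (U x) + norm (U z)) + (1 + ?Up / ?L) * ((?p x + ?p z) * tail shell)"
      using A by (simp add: distrib_right)
    also have "\<dots> \<le> (1 / (c * ?L)) * (norm (U x) + norm (U z)) + (1 + ?Up / ?L + real CARD('n) / ?\<eta>) * ((?p x + ?p z) * tail shell)"
      using L tail_nonneg by (intro add_left_mono mult_right_mono mult_nonneg_nonneg add_nonneg_nonneg) auto
    finally show ?thesis by (simp add: mult.commute)
  next
    case False
    then have "?\<eta> * side J \<le> ?p x + ?p z" using norm_ge_zero[of "perp e (x - a)"] norm_ge_zero[of "perp e (z - a)"] by linarith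
    then have "side J \<le> (?p x + ?p z) / ?\<eta>" using L by (simp add: pos_le_divide_eq mult.commute)
    then have "real CARD('n) * side J \<le> real CARD('n) * ((?p x + ?p z) / ?\<eta>)" by (intro mult_left_mono) auto
    then have "norm (x - z) \<le> (real CARD('n) / ?\<eta>) * (?p x + ?p z)"
      using norm_diff_cube_le[OF x z] by simp
    then have "norm (x - z) * tail shell \<le> (real CARD('n) / ?\<eta>) * (?p x + ?p z) * tail shell"
      using tail_nonneg by (intro mult_right_mono) auto
    also have "\<dots> = (real CARD('n) / ?\<eta>) * ((?p x + ?p z) * tail shell)" by (rule mult.assoc)
    also have "\<dots> \<le> (1 + ?Up / ?L + real CARD('n) / ?\<eta>) * ((?p x + ?p z) * tail shell)"
      using L tail_nonneg by (intro mult_right_mono mult_nonneg_nonneg add_nonneg_nonneg) auto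
    moreover have "0 \<le> (1 / (c * ?L)) * (norm (U x) + norm (U z))" using L c by simp
    ultimately show ?thesis by (simp add: mult.commute)
  qed
  also have "\<dots> \<le> (1 / (c * ?L)) * (norm (U x) + norm (U z))
      + (1 + ?Up / ?L + real CARD('n) / ?\<eta>) * ((comparison_ratio N powr (m + 1) / c) * (?G x + ?G z))"
    using PP L by (intro add_left_mono mult_left_mono) auto
  finally show ?thesis by (simp only: mult.assoc)
qed

end


section \<open>Summing the energy terms\<close>

text \<open>
  For fixed \<open>z\<close>, bound the energy by the integral of \<open>|x - z|\<^sup>2\<close> and square the reversal inequality; then
  average over \<open>z\<close> in \<open>J\<close> and divide by the measure of \<open>J\<close>.
\<close>

lemma energy_term_le:
  fixes \<omega> :: "(real ^ 'n::finite) measure" and G H :: "real ^ 'n \<Rightarrow> real ^ 'n"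
  assumes \<omega>: "locally_finite_borel \<omega>" and GH [measurable]: "G \<in> borel_measurable borel" "H \<in> borel_measurable borel"
    and \<Lambda>: "AE x in \<omega>. x \<in> \<Lambda>" and nn: "0 \<le> P" "0 \<le> C" "0 \<le> q"
    and rev: "\<And>x z. x \<in> cube_set J \<Longrightarrow> z \<in> cube_set J \<Longrightarrow> x \<in> \<Lambda> \<Longrightarrow> z \<in> \<Lambda> \<Longrightarrow>
      P * norm (x - z) \<le> C * (norm (G x) + norm (H x) + norm (G z) + norm (H z) + q)"
    and W: "\<And>z. W \<le> (\<integral>\<^sup>+x\<in>cube_set J. ennreal ((norm (x - z))\<^sup>2) \<partial>\<omega>)"
  shows "(ennreal P)\<^sup>2 * W \<le> ennreal (10 * C\<^sup>2) *
    ((\<integral>\<^sup>+x\<in>cube_set J. ennreal ((norm (G x))\<^sup>2) \<partial>\<omega>) + (\<integral>\<^sup>+x\<in>cube_set J. ennreal ((norm (H x))\<^sup>2) \<partial>\<omega>)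
      + ennreal (q\<^sup>2) * emeasure \<omega> (cube_set J))"
proof -
  define \<Phi> where "\<Phi> = (\<lambda>x. (norm (G x))\<^sup>2 + (norm (H x))\<^sup>2)"
  define A where "A = (\<integral>\<^sup>+x\<in>cube_set J. ennreal (\<Phi> x) \<partial>\<omega>)"
  define om where "om = emeasure \<omega> (cube_set J)"
  have bm: "f \<in> borel_measurable \<omega>" if "f \<in> borel_measurable borel" for f :: "real ^ 'n \<Rightarrow> ennreal"
    using that measurable_cong_sets[OF locally_finite_sets[OF \<omega>] refl] by blast
  have Js: "cube_set J \<in> sets \<omega>" by (simp add: locally_finite_sets[OF \<omega>])
  have [measurable]: "\<Phi> \<in> borel_measurable borel" unfolding \<Phi>_def by measurable
  have \<Phi>0: "0 \<le> \<Phi> x" for x by (simp add: \<Phi>_def)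
  have A_eq: "A = (\<integral>\<^sup>+x\<in>cube_set J. ennreal ((norm (G x))\<^sup>2) \<partial>\<omega>) + (\<integral>\<^sup>+x\<in>cube_set J. ennreal ((norm (H x))\<^sup>2) \<partial>\<omega>)"
  proof -
    have "A = (\<integral>\<^sup>+x. ennreal ((norm (G x))\<^sup>2) * indicator (cube_set J) x + ennreal ((norm (H x))\<^sup>2) * indicator (cube_set J) x \<partial>\<omega>)"
      unfolding A_def \<Phi>_def by (intro nn_integral_cong) (simp add: distrib_right)
    also have "\<dots> = (\<integral>\<^sup>+x\<in>cube_set J. ennreal ((norm (G x))\<^sup>2) \<partial>\<omega>) + (\<integral>\<^sup>+x\<in>cube_set J. ennreal ((norm (H x))\<^sup>2) \<partial>\<omega>)"
      by (intro nn_integral_add bm) measurable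
    finally show ?thesis .
  qed
  show ?thesis
  proof (cases "om = 0")
    case True
    then have "cube_set J \<in> null_sets \<omega>" using Js by (auto simp: om_def)
    then have "(\<integral>\<^sup>+x\<in>cube_set J. ennreal ((norm (x - 0))\<^sup>2) \<partial>\<omega>) = 0" by (rule nn_integral_null_set)
    then have "W = 0" using W[of 0] by simp
    then show ?thesis by simp
  next
    case False
    have fin: "om \<noteq> top" using emeasure_cube_finite[OF \<omega>, of J] by (simp add: om_def)
    have step: "(ennreal P)\<^sup>2 * W \<le> ennreal (5 * C\<^sup>2) * (A + ennreal (\<Phi> z + q\<^sup>2) * om)"
      if z: "z \<in> cube_set J" "z \<in> \<Lambda>" for z
    proof -
      have "(ennreal P)\<^sup>2 * W \<le> (ennreal P)\<^sup>2 * (\<integral>\<^sup>+x\<in>cube_set J. ennreal ((norm (x - z))\<^sup>2) \<partial>\<omega>)"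
        by (intro mult_left_mono W) simp
      also have "\<dots> = (\<integral>\<^sup>+x. (ennreal P)\<^sup>2 * (ennreal ((norm (x - z))\<^sup>2) * indicator (cube_set J) x) \<partial>\<omega>)"
        by (intro nn_integral_cmult[symmetric] bm) measurable
      also have "\<dots> \<le> (\<integral>\<^sup>+x. ennreal (5 * C\<^sup>2) * (ennreal (\<Phi> x) * indicator (cube_set J) x
            + ennreal (\<Phi> z + q\<^sup>2) * indicator (cube_set J) x) \<partial>\<omega>)"
      proof (rule nn_integral_mono_AE, use \<Lambda> in eventually_elim)
        case (elim x)
        show ?case
        proof (cases "x \<in> cube_set J")
          case True
          let ?a = "norm (G x)" and ?b = "norm (H x)" and ?c = "norm (G z)" and ?d = "norm (H z)"
          have sq: "(a + b + c + d + e)\<^sup>2 \<le> 5 * (a\<^sup>2 + b\<^sup>2 + c\<^sup>2 + d\<^sup>2 + e\<^sup>2)" for a b c d e :: real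
          proof -
            have "0 \<le> (a-b)\<^sup>2 + (a-c)\<^sup>2 + (a-d)\<^sup>2 + (a-e)\<^sup>2 + (b-c)\<^sup>2 + (b-d)\<^sup>2 + (b-e)\<^sup>2 + (c-d)\<^sup>2 + (c-e)\<^sup>2 + (d-e)\<^sup>2"
              by simp
            then show ?thesis by (simp add: power2_eq_square algebra_simps)
          qed
          have "(P * norm (x - z))\<^sup>2 \<le> (C * (?a + ?b + ?c + ?d + q))\<^sup>2"
            using rev[OF True z(1) elim z(2)] nn by (intro power_mono) auto
          also have "\<dots> = C\<^sup>2 * (?a + ?b + ?c + ?d + q)\<^sup>2" by (rule power_mult_distrib)
          also have "\<dots> \<le> C\<^sup>2 * (5 * (?a\<^sup>2 + ?b\<^sup>2 + ?c\<^sup>2 + ?d\<^sup>2 + q\<^sup>2))" by (intro mult_left_mono sq) simp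
          also have "\<dots> = 5 * C\<^sup>2 * (\<Phi> x + (\<Phi> z + q\<^sup>2))" by (simp add: \<Phi>_def)
          finally have "P\<^sup>2 * (norm (x - z))\<^sup>2 \<le> 5 * C\<^sup>2 * (\<Phi> x + (\<Phi> z + q\<^sup>2))" by (simp add: power_mult_distrib)
          then have "ennreal (P\<^sup>2 * (norm (x - z))\<^sup>2) \<le> ennreal (5 * C\<^sup>2 * (\<Phi> x + (\<Phi> z + q\<^sup>2)))" by (rule ennreal_leI)
          moreover have "ennreal (P\<^sup>2 * (norm (x - z))\<^sup>2) = (ennreal P)\<^sup>2 * ennreal ((norm (x - z))\<^sup>2)"
            using nn by (simp add: ennreal_mult ennreal_power)
          moreover have "ennreal (5 * C\<^sup>2 * (\<Phi> x + (\<Phi> z + q\<^sup>2))) = ennreal (5 * C\<^sup>2) * (ennreal (\<Phi> x) + ennreal (\<Phi> z + q\<^sup>2))"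
            using \<Phi>0 by (simp add: ennreal_mult ennreal_plus[symmetric] del: ennreal_plus)
          ultimately show ?thesis using True by simp
        qed simp
      qed
      also have "\<dots> = ennreal (5 * C\<^sup>2) * (\<integral>\<^sup>+x. ennreal (\<Phi> x) * indicator (cube_set J) x
            + ennreal (\<Phi> z + q\<^sup>2) * indicator (cube_set J) x \<partial>\<omega>)"
        by (intro nn_integral_cmult bm) measurable
      also have "(\<integral>\<^sup>+x. ennreal (\<Phi> x) * indicator (cube_set J) x
            + ennreal (\<Phi> z + q\<^sup>2) * indicator (cube_set J) x \<partial>\<omega>) = A + (\<integral>\<^sup>+x. ennreal (\<Phi> z + q\<^sup>2) * indicator (cube_set J) x \<partial>\<omega>)"
        unfolding A_def by (intro nn_integral_add bm) measurable
      also have "(\<integral>\<^sup>+x. ennreal (\<Phi> z + q\<^sup>2) * indicator (cube_set J) x \<partial>\<omega>) = ennreal (\<Phi> z + q\<^sup>2) * om"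
        unfolding om_def by (intro nn_integral_cmult_indicator Js)
      finally show ?thesis .
    qed
    have "om * ((ennreal P)\<^sup>2 * W) = (\<integral>\<^sup>+z. ((ennreal P)\<^sup>2 * W) * indicator (cube_set J) z \<partial>\<omega>)"
      unfolding om_def by (subst nn_integral_cmult_indicator[OF Js]) (rule mult.commute)
    also have "\<dots> \<le> (\<integral>\<^sup>+z. ennreal (5 * C\<^sup>2) * ((A + ennreal (q\<^sup>2) * om) * indicator (cube_set J) z
        + om * (ennreal (\<Phi> z) * indicator (cube_set J) z)) \<partial>\<omega>)"
    proof (rule nn_integral_mono_AE, use \<Lambda> in eventually_elim)
      case (elim z)
      show ?case
      proof (cases "z \<in> cube_set J")
        case True
        have "(ennreal P)\<^sup>2 * W \<le> ennreal (5 * C\<^sup>2) * (A + ennreal (\<Phi> z + q\<^sup>2) * om)" by (rule step[OF True elim])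
        also have "A + ennreal (\<Phi> z + q\<^sup>2) * om = (A + ennreal (q\<^sup>2) * om) + om * ennreal (\<Phi> z)"
          using \<Phi>0[of z] by (simp add: algebra_simps)
        finally show ?thesis using True by simp
      qed simp
    qed
    also have "\<dots> = ennreal (5 * C\<^sup>2) * (\<integral>\<^sup>+z. (A + ennreal (q\<^sup>2) * om) * indicator (cube_set J) z
        + om * (ennreal (\<Phi> z) * indicator (cube_set J) z) \<partial>\<omega>)"
      by (intro nn_integral_cmult bm) measurable
    also have "(\<integral>\<^sup>+z. (A + ennreal (q\<^sup>2) * om) * indicator (cube_set J) z
        + om * (ennreal (\<Phi> z) * indicator (cube_set J) z) \<partial>\<omega>) =
        (\<integral>\<^sup>+z. (A + ennreal (q\<^sup>2) * om) * indicator (cube_set J) z \<partial>\<omega>)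
        + (\<integral>\<^sup>+z. om * (ennreal (\<Phi> z) * indicator (cube_set J) z) \<partial>\<omega>)"
      by (intro nn_integral_add bm) measurable
    also have "(\<integral>\<^sup>+z. (A + ennreal (q\<^sup>2) * om) * indicator (cube_set J) z \<partial>\<omega>) = (A + ennreal (q\<^sup>2) * om) * om"
      unfolding om_def by (intro nn_integral_cmult_indicator Js)
    also have "(\<integral>\<^sup>+z. om * (ennreal (\<Phi> z) * indicator (cube_set J) z) \<partial>\<omega>) = om * A"
      unfolding A_def by (intro nn_integral_cmult bm) measurable
    also have "ennreal (5 * C\<^sup>2) * ((A + ennreal (q\<^sup>2) * om) * om + om * A) =
        om * (ennreal (5 * C\<^sup>2) * (A + A + ennreal (q\<^sup>2) * om))"
      by (simp add: algebra_simps)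
    finally have "om * ((ennreal P)\<^sup>2 * W) \<le> om * (ennreal (5 * C\<^sup>2) * (A + A + ennreal (q\<^sup>2) * om))" .
    then have "(ennreal P)\<^sup>2 * W \<le> ennreal (5 * C\<^sup>2) * (A + A + ennreal (q\<^sup>2) * om)"
      using ennreal_mult_le_mult_iff[OF False fin] by blast
    also have "\<dots> \<le> ennreal (5 * C\<^sup>2) * (2 * (A + ennreal (q\<^sup>2) * om))"
    proof (rule mult_left_mono)
      have "2 * (a + b) = a + a + b + b" for a b :: ennreal unfolding mult_2 by (simp only: add_ac)
      then show "A + A + ennreal (q\<^sup>2) * om \<le> 2 * (A + ennreal (q\<^sup>2) * om)"
        by (simp only: le_iff_add) blast
    qed simp
    also have "\<dots> = ennreal (10 * C\<^sup>2) * (A + ennreal (q\<^sup>2) * om)"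
    proof -
      have "ennreal (10 * C\<^sup>2) = ennreal (5 * C\<^sup>2) * 2"
        using ennreal_mult[of "5 * C\<^sup>2" 2] by simp
      then show ?thesis by (simp add: mult.assoc)
    qed
    finally show ?thesis unfolding A_eq om_def .
  qed
qed

lemma infsum_pairs_le:
  fixes f :: "'a \<Rightarrow> 'b \<Rightarrow> ennreal"
  assumes le: "\<And>G. finite G \<Longrightarrow> G \<subseteq> Sigma A B \<Longrightarrow> (\<Sum>(x, y)\<in>G. f x y) \<le> c"
  shows "(\<Sum>\<^sub>\<infinity>x\<in>A. \<Sum>\<^sub>\<infinity>y\<in>B x. f x y) \<le> c"
proof (rule infsum_le_finite_sums)
  show "(\<lambda>x. \<Sum>\<^sub>\<infinity>y\<in>B x. f x y) summable_on A" by (rule nonneg_summable_on_complete) simp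
  fix X assume X: "finite X" "X \<subseteq> A"
  have "(\<Sum>x\<in>X. \<Sum>\<^sub>\<infinity>y\<in>B x. f x y) = (\<Sum>\<^sub>\<infinity>(x, y)\<in>Sigma X B. f x y)"
    using X(1)
  proof induction
    case empty
    then show ?case by simp
  next
    case (insert a X)
    have Sig: "Sigma (insert a X) B = Pair a ` B a \<union> Sigma X B" by auto
    have "(\<Sum>\<^sub>\<infinity>(x, y)\<in>Sigma (insert a X) B. f x y) = (\<Sum>\<^sub>\<infinity>(x, y)\<in>Pair a ` B a. f x y) + (\<Sum>\<^sub>\<infinity>(x, y)\<in>Sigma X B. f x y)"
      unfolding Sig using insert(2)
      by (intro infsum_Un_disjoint nonneg_summable_on_complete) auto
    also have "(\<Sum>\<^sub>\<infinity>(x, y)\<in>Pair a ` B a. f x y) = (\<Sum>\<^sub>\<infinity>y\<in>B a. f a y)"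
      by (subst infsum_reindex) (auto simp: inj_on_def o_def)
    finally show ?case using insert by simp
  qed
  also have "\<dots> \<le> c"
    using X le by (intro infsum_le_finite_sums nonneg_summable_on_complete) auto
  finally show "(\<Sum>x\<in>X. \<Sum>\<^sub>\<infinity>y\<in>B x. f x y) \<le> c" .
qed

lemma dyadic_annulus:
  assumes "0 < s" "s \<le> (T::real)"
  shows "\<exists>k::nat. 2 ^ k * s \<le> T \<and> T < 2 ^ Suc k * s"
proof -
  obtain n where n: "T / s < 2 ^ n" using real_arch_pow[of 2 "T / s"] by auto
  define k where "k = (LEAST n. T / s < 2 ^ n)"
  have k: "T / s < 2 ^ k" unfolding k_def by (rule LeastI[of _ n]) (rule n)
  have "k \<noteq> 0" using k assms by (cases k) (auto simp: field_simps)
  then obtain j where j: "k = Suc j" by (cases k) auto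
  have "\<not> T / s < 2 ^ j" using not_less_Least[of j "\<lambda>n. T / s < 2 ^ n"] j by (simp add: k_def)
  then show ?thesis using k j assms(1) by (intro exI[of _ j]) (auto simp: field_simps)
qed

lemma dyadic_annuli_disjoint:
  assumes "0 < (s::real)"
  shows "disjoint_family (\<lambda>k::nat. {y \<in> E. 2 ^ k * s \<le> T y \<and> T y < 2 ^ Suc k * s})"
proof -
  define A where "A = (\<lambda>k::nat. {y \<in> E. 2 ^ k * s \<le> T y \<and> T y < 2 ^ Suc k * s})"
  have less: "A j \<inter> A k = {}" if "j < k" for j k
  proof (rule ccontr)
    assume "A j \<inter> A k \<noteq> {}"
    then obtain y where y: "T y < 2 ^ Suc j * s" "2 ^ k * s \<le> T y" unfolding A_def by blast
    have "(2::real) ^ Suc j \<le> 2 ^ k" using that by (intro power_increasing) auto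
    then have "2 ^ Suc j * s \<le> 2 ^ k * s" using assms by (intro mult_right_mono) auto
    with y show False by linarith
  qed
  have "A j \<inter> A k = {}" if "j \<noteq> k" for j k
    using that less[of j k] less[of k j] by (cases j k rule: linorder_cases) (simp_all add: Int_commute)
  then have "disjoint_family A" by (simp add: disjoint_family_on_def)
  then show ?thesis unfolding A_def .
qed

lemma geometric_Cauchy_Schwarz:
  fixes b :: "nat \<Rightarrow> ennreal"
  shows "(\<Sum>k. ennreal ((1 / 2) ^ k) * b k)\<^sup>2 \<le> 2 * (\<Sum>k. (b k)\<^sup>2)"
proof -
  have "(\<Sum>k. ennreal ((1 / 2) ^ k) * b k)\<^sup>2 \<le> (\<Sum>k. (ennreal ((1 / 2) ^ k))\<^sup>2) * (\<Sum>k. (b k)\<^sup>2)"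
    using Cauchy_Schwarz_nn_integral[of "\<lambda>k. ennreal ((1 / 2) ^ k)" "count_space UNIV" b]
    by (simp add: nn_integral_count_space_nat)
  also have "(\<Sum>k. (ennreal ((1 / 2) ^ k))\<^sup>2) = (\<Sum>k. ennreal ((1 / 4) ^ k))"
  proof (rule suminf_cong)
    fix k :: nat
    have "((1 / 2) ^ k)\<^sup>2 = (((1 / 2)\<^sup>2) ^ k :: real)" unfolding power_mult[symmetric] by (simp only: mult.commute)
    then have "((1 / 2) ^ k)\<^sup>2 = ((1 / 4) ^ k :: real)" by (simp add: power2_eq_square)
    then show "(ennreal ((1 / 2) ^ k))\<^sup>2 = ennreal ((1 / 4) ^ k)" by (simp add: ennreal_power)
  qed
  also have "\<dots> = ennreal (\<Sum>k. (1 / 4) ^ k)"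
    by (rule suminf_ennreal2) (auto intro: summable_geometric)
  also have "\<dots> \<le> 2" using suminf_geometric[of "1 / 4 :: real"] by (simp add: ennreal_le_iff flip: ennreal_numeral)
  finally show ?thesis by (simp add: mult_right_mono)
qed

text \<open>
  The points outside the cone around the line with direction \<open>e\<close> whose points all have perpendicular part
  \<open>p\<close>, seen from \<open>J\<close>.
\<close>

definition far_set :: "real \<Rightarrow> real ^ 'n::finite \<Rightarrow> real ^ 'n \<Rightarrow> 'n cube \<Rightarrow> (real ^ 'n) set" where
  "far_set m e p J = {y. cone_aperture TYPE('n) m * (side J + norm (y - cube_center J)) < norm (perp e y - p)}"

definition far_constant :: "'n::finite itself \<Rightarrow> real \<Rightarrow> real" where
  "far_constant N m = 2 * (((1 + real CARD('n))\<^sup>2) powr m * (12 * (real CARD('n))\<^sup>2 / cone_aperture N m) powr (2 * m))"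

lemma far_set_sets: "far_set m e p J \<in> sets borel"
  unfolding far_set_def perp_def by measurable

text \<open>
  On the \<open>k\<close>-th annulus the kernel is \<open>2^(-k)\<close> times the natural density at that scale; this decay pays for
  passing from the square of the sum over the scales to the sum of the squares.
\<close>

lemma annulus_bound:
  fixes \<sigma> :: "(real ^ 'n::finite) measure"
  assumes \<sigma>: "locally_finite_borel \<sigma>" and m: "0 < m" and J: "0 < side J"
    and E: "E \<in> sets borel" "E \<subseteq> cube_set I"
  defines "A \<equiv> \<lambda>k. {y \<in> E. 2 ^ k * side J \<le> side J + norm (y - cube_center J) \<and>
      side J + norm (y - cube_center J) < 2 ^ Suc k * side J}"
  shows "ennreal ((side J * poisson_tail m \<sigma> E J)\<^sup>2)
    \<le> 2 * (\<Sum>k. (ennreal ((2 ^ k * side J) powr (- m)) * emeasure \<sigma> (A k))\<^sup>2)"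
proof -
  let ?T = "\<lambda>y. side J + norm (y - cube_center J)"
  have As: "A k \<in> sets \<sigma>" for k
    unfolding A_def locally_finite_sets[OF \<sigma>] using E(1) by measurable
  have disj: "disjoint_family A"
    unfolding A_def by (rule dyadic_annuli_disjoint[OF J])
  have "ennreal (side J * poisson_tail m \<sigma> E J) = (\<integral>\<^sup>+y. ennreal (side J * (indicator E y * ?T y powr (- (m + 1)))) \<partial>\<sigma>)"
  proof -
    have "(\<integral>\<^sup>+y. ennreal (side J * (indicator E y * ?T y powr (- (m + 1)))) \<partial>\<sigma>) =
        ennreal (\<integral>y. side J * (indicator E y * ?T y powr (- (m + 1))) \<partial>\<sigma>)"
      using J by (intro nn_integral_eq_integral integrable_mult_right poisson_tail_integrable[OF \<sigma> m J E]) auto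
    then show ?thesis by (simp add: poisson_tail_def)
  qed
  also have "\<dots> \<le> (\<integral>\<^sup>+y. (\<Sum>k. ennreal ((1 / 2) ^ k * (2 ^ k * side J) powr (- m)) * indicator (A k) y) \<partial>\<sigma>)"
  proof (rule nn_integral_mono)
    fix y
    show "ennreal (side J * (indicator E y * ?T y powr (- (m + 1))))
      \<le> (\<Sum>k. ennreal ((1 / 2) ^ k * (2 ^ k * side J) powr (- m)) * indicator (A k) y)"
    proof (cases "y \<in> E")
      case True
      obtain k where k: "2 ^ k * side J \<le> ?T y" "?T y < 2 ^ Suc k * side J"
        using dyadic_annulus[OF J, of "?T y"] by auto
      have yA: "y \<in> A k" using True k by (simp add: A_def)
      have pos: "0 < 2 ^ k * side J" using J by simp
      have "side J * ?T y powr (- (m + 1)) \<le> side J * (2 ^ k * side J) powr (- (m + 1))"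
        using k(1) pos m J by (intro mult_left_mono powr_mono2') auto
      also have "(2 ^ k * side J) powr (- (m + 1)) = (2 ^ k * side J) powr (- m) / (2 ^ k * side J)"
        using powr_diff[of "2 ^ k * side J" "- m" 1] pos by simp
      also have "side J * ((2 ^ k * side J) powr (- m) / (2 ^ k * side J)) = (1 / 2) ^ k * (2 ^ k * side J) powr (- m)"
        using J by (simp add: power_divide)
      finally show ?thesis
        unfolding suminf_cmult_indicator[OF disj yA] using True by (simp add: ennreal_leI)
    qed simp
  qed
  also have "\<dots> = (\<Sum>k. \<integral>\<^sup>+y. ennreal ((1 / 2) ^ k * (2 ^ k * side J) powr (- m)) * indicator (A k) y \<partial>\<sigma>)"
    using As by (intro nn_integral_suminf) auto
  also have "\<dots> = (\<Sum>k. ennreal ((1 / 2) ^ k) * (ennreal ((2 ^ k * side J) powr (- m)) * emeasure \<sigma> (A k)))"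
    unfolding nn_integral_cmult_indicator[OF As] mult.assoc[symmetric]
    by (simp add: ennreal_mult)
  finally have le: "ennreal (side J * poisson_tail m \<sigma> E J)
      \<le> (\<Sum>k. ennreal ((1 / 2) ^ k) * (ennreal ((2 ^ k * side J) powr (- m)) * emeasure \<sigma> (A k)))" .
  have "ennreal ((side J * poisson_tail m \<sigma> E J)\<^sup>2) = (ennreal (side J * poisson_tail m \<sigma> E J))\<^sup>2"
    using J by (simp add: ennreal_power poisson_tail_nonneg)
  also have "\<dots> \<le> (\<Sum>k. ennreal ((1 / 2) ^ k) * (ennreal ((2 ^ k * side J) powr (- m)) * emeasure \<sigma> (A k)))\<^sup>2"
    by (intro power_mono le) simp
  also have "\<dots> \<le> 2 * (\<Sum>k. (ennreal ((2 ^ k * side J) powr (- m)) * emeasure \<sigma> (A k))\<^sup>2)"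
    by (rule geometric_Cauchy_Schwarz)
  finally show ?thesis .
qed

text \<open>
  After \<open>annulus_bound\<close>, write one of the two factors \<open>\<sigma>(A J k)\<close> as an integral over \<open>y\<close> and exchange it with
  the sums over \<open>J\<close> and \<open>k\<close>. Fix \<open>y\<close> and let \<open>d\<close> be its distance to the line. A cube \<open>J\<close> that charges \<open>\<omega>\<close> meets
  the line, so if \<open>y\<close> is in the far set of \<open>J\<close>, its distance to \<open>J\<close> is comparable to \<open>d\<close>. Only one \<open>k\<close> occurs for
  each \<open>J\<close>, and the cube \<open>Q\<close> around \<open>y\<close> with side a multiple of \<open>d\<close> contains all annuli and all cubes \<open>J\<close> in
  question. As the cubes \<open>J\<close> are disjoint, what remains is the local Muckenhoupt quotient of \<open>Q\<close>.
\<close>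

lemma far_energy_sum:
  fixes \<sigma> \<omega> :: "(real ^ 'n::finite) measure" and F :: "'n cube set"
  assumes \<sigma>: "locally_finite_borel \<sigma>" and \<omega>: "locally_finite_borel \<omega>" and a: "\<alpha> < real CARD('n)"
    and e: "norm e = 1" and line: "AE x in \<omega>. perp e x = p"
    and F: "finite F" "\<And>J. J \<in> F \<Longrightarrow> 0 < side J" "disjoint_family_on cube_set F"
    and E: "\<And>J. J \<in> F \<Longrightarrow> E J \<in> sets borel" "\<And>J. J \<in> F \<Longrightarrow> E J \<subseteq> cube_set I"
  defines "m \<equiv> real CARD('n) - \<alpha>"
  shows "(\<Sum>J\<in>F. ennreal ((side J * poisson_tail m \<sigma> (E J \<inter> far_set m e p J) J)\<^sup>2) * emeasure \<omega> (cube_set J))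
    \<le> ennreal (far_constant TYPE('n) m) * muckenhoupt \<alpha> \<sigma> \<omega> * emeasure \<sigma> (cube_set I)"
proof -
  let ?n = "real CARD('n)"
  define \<eta> where "\<eta> = cone_aperture TYPE('n) m"
  have m: "0 < m" using a by (simp add: m_def)
  have \<eta>: "0 < \<eta>" using reversal_constants_pos(1)[OF m, where 'n = 'n] by (simp add: \<eta>_def)
  have n1: "1 \<le> ?n" by (rule card_ge_1)
  define T where "T = (\<lambda>(J :: 'n cube) y. side J + norm (y - cube_center J))"
  define A where "A = (\<lambda>(J :: 'n cube) k. {y \<in> E J \<inter> far_set m e p J. 2 ^ k * side J \<le> T J y \<and> T J y < 2 ^ Suc k * side J})"
  define g where "g = (\<lambda>J k. emeasure \<omega> (cube_set J) * (ennreal ((2 ^ k * side J) powr (- m)))\<^sup>2 * emeasure \<sigma> (A J k))"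
  define K where "K = far_constant TYPE('n) m / 2"
  have As: "A J k \<in> sets \<sigma>" if "J \<in> F" for J k
    unfolding A_def T_def locally_finite_sets[OF \<sigma>] using E(1)[OF that] far_set_sets[of m e p J] by measurable
  have AEJ: "A J k \<subseteq> E J" for J k by (auto simp: A_def)
  have step: "ennreal ((side J * poisson_tail m \<sigma> (E J \<inter> far_set m e p J) J)\<^sup>2) * emeasure \<omega> (cube_set J)
      \<le> 2 * (\<integral>\<^sup>+y. (\<Sum>k. g J k * indicator (A J k) y) \<partial>\<sigma>)" if J: "J \<in> F" for J
  proof -
    have "ennreal ((side J * poisson_tail m \<sigma> (E J \<inter> far_set m e p J) J)\<^sup>2)
      \<le> 2 * (\<Sum>k. (ennreal ((2 ^ k * side J) powr (- m)) * emeasure \<sigma> (A J k))\<^sup>2)"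
      unfolding A_def T_def
    proof (rule annulus_bound[OF \<sigma> m F(2)[OF J]])
      show "E J \<inter> far_set m e p J \<in> sets borel" by (rule sets.Int[OF E(1)[OF J] far_set_sets])
      show "E J \<inter> far_set m e p J \<subseteq> cube_set I" using E(2)[OF J] by blast
    qed
    then have "ennreal ((side J * poisson_tail m \<sigma> (E J \<inter> far_set m e p J) J)\<^sup>2) * emeasure \<omega> (cube_set J)
      \<le> 2 * (\<Sum>k. (ennreal ((2 ^ k * side J) powr (- m)) * emeasure \<sigma> (A J k))\<^sup>2) * emeasure \<omega> (cube_set J)"
      by (rule mult_right_mono) simp
    also have "\<dots> = 2 * (\<Sum>k. g J k * emeasure \<sigma> (A J k))"
      unfolding g_def ennreal_suminf_multc[symmetric] mult.assoc
      by (intro arg_cong[where f = "(*) 2"] suminf_cong) (simp add: power2_eq_square mult_ac)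
    also have "(\<Sum>k. g J k * emeasure \<sigma> (A J k)) = (\<Sum>k. \<integral>\<^sup>+y. g J k * indicator (A J k) y \<partial>\<sigma>)"
      using As[OF J] by (simp add: nn_integral_cmult_indicator)
    also have "\<dots> = (\<integral>\<^sup>+y. (\<Sum>k. g J k * indicator (A J k) y) \<partial>\<sigma>)"
      using As[OF J] by (intro nn_integral_suminf[symmetric]) auto
    finally show ?thesis .
  qed
  have point: "(\<Sum>J\<in>F. \<Sum>k. g J k * indicator (A J k) y) \<le> ennreal K * muckenhoupt \<alpha> \<sigma> \<omega> * indicator (cube_set I) y" for y
  proof -
    define d where "d = norm (perp e y - p)"
    \<comment> \<open>The annuli and the cubes that interact with \<open>y\<close> have distance at most \<open>3 n T\<close> from \<open>y\<close>, and \<open>T < d / \<eta>\<close>.\<close>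
    define r where "r = 3 * ?n * d / \<eta>"
    define Q :: "'n cube" where "Q = ((\<chi> i. y $ i - r), 2 * r)"
    define h where "h = (ennreal ((d / (2 * ?n)) powr (- m)))\<^sup>2 * emeasure \<sigma> (cube_set Q)"
    define F' where "F' = {J \<in> F. y \<in> E J \<inter> far_set m e p J \<and> emeasure \<omega> (cube_set J) \<noteq> 0}"
    have facts: "T J y \<le> ?n * T J y" "d \<le> ?n * T J y" "\<eta> * T J y < d" "0 < T J y" if J: "J \<in> F'" for J
    proof -
      have JF: "J \<in> F" and far: "y \<in> far_set m e p J" and ne: "emeasure \<omega> (cube_set J) \<noteq> 0" using J by (auto simp: F'_def)
      have s: "0 < side J" by (rule F(2)[OF JF])
      show T0: "0 < T J y" using s by (simp add: T_def add_pos_nonneg)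
      show "T J y \<le> ?n * T J y" using n1 T0 by simp
      show "\<eta> * T J y < d" using far by (simp add: far_set_def T_def d_def \<eta>_def)
      have "\<exists>x\<in>cube_set J. perp e x = p"
      proof (rule ccontr)
        assume no: "\<not> (\<exists>x\<in>cube_set J. perp e x = p)"
        have "AE x in \<omega>. x \<notin> cube_set J" using line by eventually_elim (use no in blast)
        then have "emeasure \<omega> (cube_set J) = 0"
          by (subst (asm) AE_iff_measurable[of "cube_set J"])
            (auto simp: locally_finite_sets[OF \<omega>] sets_eq_imp_space_eq[OF locally_finite_sets[OF \<omega>]])
        then show False using ne by simp
      qed
      then obtain x where x: "x \<in> cube_set J" "perp e x = p" by blast
      have "d = norm (perp e (y - x))" using x(2) by (simp add: d_def perp_diff)
      also have "\<dots> \<le> norm (y - x)" by (rule norm_perp_le[OF e])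
      also have "\<dots> \<le> norm (y - cube_center J) + norm (x - cube_center J)"
        using norm_triangle_ineq4[of "y - cube_center J" "x - cube_center J"] by simp
      also have "\<dots> \<le> 1 * norm (y - cube_center J) + ?n * side J"
        using norm_diff_cube_le[OF x(1) cube_center_mem[OF s]] by simp
      also have "\<dots> \<le> ?n * norm (y - cube_center J) + ?n * side J"
        using n1 by (intro add_right_mono mult_right_mono) auto
      finally show "d \<le> ?n * T J y" by (simp add: T_def algebra_simps)
    qed
    have in_Q: "v \<in> cube_set Q" if "norm (v - y) < r" for v
    proof -
      have "\<bar>v $ i - y $ i\<bar> < r" for i using component_le_norm_cart[of "v - y" i] that by simp
      then have "y $ i - r \<le> v $ i \<and> v $ i < y $ i - r + 2 * r" for i by (smt (verit))
      then show ?thesis by (simp add: mem_cube_set Q_def)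
    qed
    have J_le: "(\<Sum>k. g J k * indicator (A J k) y) \<le> (if J \<in> F' then h * emeasure \<omega> (cube_set J) else 0)" if J: "J \<in> F" for J
    proof (cases "\<exists>k. y \<in> A J k")
      case False
      then have "(\<Sum>k. g J k * indicator (A J k) y) = 0" by simp
      then show ?thesis by (simp only: zero_le)
    next
      case True
      then obtain k where k: "y \<in> A J k" by blast
      have s: "0 < side J" by (rule F(2)[OF J])
      have disj: "disjoint_family (A J)"
        unfolding A_def by (rule dyadic_annuli_disjoint[OF s])
      show ?thesis
      proof (cases "emeasure \<omega> (cube_set J) = 0")
        case True
        then show ?thesis by (simp add: g_def)
      next
        case False
        then have J': "J \<in> F'" using J k by (auto simp: F'_def A_def)
        have Tk: "2 ^ k * side J \<le> T J y" "T J y < 2 * (2 ^ k * side J)" using k by (auto simp: A_def)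
        have d0: "0 < d" using facts(3,4)[OF J'] \<eta> by (smt (verit) mult_pos_pos)
        have "d / (2 * ?n) \<le> 2 ^ k * side J"
        proof -
          have "d \<le> ?n * (2 * (2 ^ k * side J))"
            using facts(2)[OF J'] mult_left_mono[OF less_imp_le[OF Tk(2)], of ?n] by linarith
          then show ?thesis using n1 by (simp add: divide_le_eq mult_ac)
        qed
        then have "(2 ^ k * side J) powr (- m) \<le> (d / (2 * ?n)) powr (- m)"
          using d0 n1 m by (intro powr_mono2') auto
        then have 1: "(ennreal ((2 ^ k * side J) powr (- m)))\<^sup>2 \<le> (ennreal ((d / (2 * ?n)) powr (- m)))\<^sup>2"
          by (intro power_mono ennreal_leI) auto
        have "A J k \<subseteq> cube_set Q"
        proof
          fix v assume v: "v \<in> A J k"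
          have "T J v < 2 * (2 ^ k * side J)" using v by (simp add: A_def)
          also have "\<dots> \<le> 2 * T J y" using Tk by simp
          finally have Tv: "T J v < 2 * T J y" .
          have "norm (v - y) \<le> norm (v - cube_center J) + norm (y - cube_center J)"
            using norm_triangle_ineq4[of "v - cube_center J" "y - cube_center J"] by simp
          also have "\<dots> \<le> T J v + T J y" using s by (simp add: T_def)
          also have "\<dots> < 3 * T J y" using Tv by simp
          also have "\<dots> \<le> 3 * ?n * T J y" using facts(1)[OF J'] by simp
          also have "\<dots> = (3 * ?n * (\<eta> * T J y)) / \<eta>" using \<eta> by simp
          also have "\<dots> \<le> r" unfolding r_def
            using facts(3)[OF J'] \<eta> n1 by (intro divide_right_mono mult_left_mono) auto
          finally show "v \<in> cube_set Q" by (rule in_Q)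
        qed
        then have 2: "emeasure \<sigma> (A J k) \<le> emeasure \<sigma> (cube_set Q)"
          by (intro emeasure_mono) (auto simp: locally_finite_sets[OF \<sigma>])
        have "(\<Sum>k. g J k * indicator (A J k) y) = g J k" by (rule suminf_cmult_indicator[OF disj k])
        also have "\<dots> \<le> emeasure \<omega> (cube_set J) * (ennreal ((d / (2 * ?n)) powr (- m)))\<^sup>2 * emeasure \<sigma> (cube_set Q)"
          unfolding g_def by (intro mult_mono 1 2 order_refl) auto
        also have "\<dots> = h * emeasure \<omega> (cube_set J)" by (simp add: h_def mult_ac)
        finally show ?thesis using J' by simp
      qed
    qed
    have "(\<Sum>J\<in>F. \<Sum>k. g J k * indicator (A J k) y) \<le> (\<Sum>J\<in>F. if J \<in> F' then h * emeasure \<omega> (cube_set J) else 0)"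
      by (intro sum_mono J_le)
    also have "\<dots> = (\<Sum>J\<in>F'. h * emeasure \<omega> (cube_set J))"
      using F(1) by (intro sum.mono_neutral_cong_right) (auto simp: F'_def)
    also have "\<dots> = h * (\<Sum>J\<in>F'. emeasure \<omega> (cube_set J))" by (simp add: sum_distrib_left)
    finally have le1: "(\<Sum>J\<in>F. \<Sum>k. g J k * indicator (A J k) y) \<le> h * (\<Sum>J\<in>F'. emeasure \<omega> (cube_set J))" .
    show ?thesis
    proof (cases "F' = {}")
      case True
      then show ?thesis using le1 by simp
    next
      case False
      then obtain J0 where J0: "J0 \<in> F'" by blast
      have yI: "y \<in> cube_set I" using J0 E(2)[of J0] by (auto simp: F'_def)
      have d0: "0 < d" using facts(3,4)[OF J0] \<eta> by (smt (verit) mult_pos_pos)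
      have r0: "0 < r" using d0 \<eta> n1 by (simp add: r_def)
      have sub: "cube_set J \<subseteq> cube_set Q" if J: "J \<in> F'" for J
      proof
        fix v assume v: "v \<in> cube_set J"
        have s: "0 < side J" by (rule side_pos_of_mem[OF v])
        have "norm (v - y) \<le> norm (v - cube_center J) + norm (y - cube_center J)"
          using norm_triangle_ineq4[of "v - cube_center J" "y - cube_center J"] by simp
        also have "\<dots> \<le> ?n * side J + norm (y - cube_center J)"
          using norm_diff_cube_le[OF v cube_center_mem[OF s]] by simp
        also have "\<dots> \<le> ?n * T J y + T J y"
          using s n1 by (intro add_mono mult_left_mono) (auto simp: T_def)
        also have "\<dots> \<le> 2 * (?n * T J y)" using facts(1)[OF J] by simp
        also have "\<dots> < 3 * (?n * T J y)" using facts(4)[OF J] n1 by simp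
        also have "\<dots> = (3 * ?n * (\<eta> * T J y)) / \<eta>" using \<eta> by simp
        also have "\<dots> \<le> r" unfolding r_def
          using facts(3)[OF J] \<eta> n1 by (intro divide_right_mono mult_left_mono) auto
        finally show "v \<in> cube_set Q" by (rule in_Q)
      qed
      have "(\<Sum>J\<in>F'. emeasure \<omega> (cube_set J)) = emeasure \<omega> (\<Union>J\<in>F'. cube_set J)"
        using F(1,3) by (intro sum_emeasure)
          (auto simp: F'_def locally_finite_sets[OF \<omega>] disjoint_family_on_def)
      also have "\<dots> \<le> emeasure \<omega> (cube_set Q)"
        using sub by (intro emeasure_mono) (auto simp: locally_finite_sets[OF \<omega>])
      finally have "h * (\<Sum>J\<in>F'. emeasure \<omega> (cube_set J)) \<le> h * emeasure \<omega> (cube_set Q)" by (intro mult_left_mono) auto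
      also have "\<dots> = (ennreal ((d / (2 * ?n)) powr (- m)))\<^sup>2 * (emeasure \<sigma> (cube_set Q) * emeasure \<omega> (cube_set Q))"
        by (simp add: h_def mult_ac)
      also have "\<dots> \<le> (ennreal ((d / (2 * ?n)) powr (- m)))\<^sup>2 *
          (ennreal (((1 + ?n)\<^sup>2) powr m * side Q powr (2 * m)) * muckenhoupt \<alpha> \<sigma> \<omega>)"
        using r0 unfolding m_def by (intro mult_left_mono muckenhoupt_local[OF \<sigma> \<omega> a]) (auto simp: Q_def)
      also have "\<dots> = ennreal (((d / (2 * ?n)) powr (- m))\<^sup>2 * (((1 + ?n)\<^sup>2) powr m * side Q powr (2 * m))) * muckenhoupt \<alpha> \<sigma> \<omega>"
        by (simp add: ennreal_mult ennreal_power mult.assoc)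
      also have "((d / (2 * ?n)) powr (- m))\<^sup>2 * (((1 + ?n)\<^sup>2) powr m * side Q powr (2 * m)) = K"
      proof -
        have "((d / (2 * ?n)) powr (- m))\<^sup>2 = (d / (2 * ?n)) powr (- (2 * m))"
          by (simp add: power2_eq_square powr_add[symmetric])
        also have "\<dots> = 1 / (d / (2 * ?n)) powr (2 * m)" by (simp only: powr_minus divide_inverse mult_1)
        finally have 1: "((d / (2 * ?n)) powr (- m))\<^sup>2 = 1 / (d / (2 * ?n)) powr (2 * m)" .
        have "side Q = (d / (2 * ?n)) * (12 * ?n\<^sup>2 / \<eta>)"
          using n1 by (simp add: Q_def r_def power2_eq_square)
        then have 2: "side Q powr (2 * m) = (d / (2 * ?n)) powr (2 * m) * (12 * ?n\<^sup>2 / \<eta>) powr (2 * m)"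
          using d0 n1 \<eta> by (simp only: powr_mult)
        have "0 < (d / (2 * ?n)) powr (2 * m)" using d0 n1 by simp
        then have "((d / (2 * ?n)) powr (- m))\<^sup>2 * (((1 + ?n)\<^sup>2) powr m * side Q powr (2 * m)) =
            ((1 + ?n)\<^sup>2) powr m * (12 * ?n\<^sup>2 / \<eta>) powr (2 * m)"
          unfolding 1 2 by simp
        then show ?thesis by (simp add: K_def far_constant_def \<eta>_def)
      qed
      finally show ?thesis using le1 yI by (simp add: order_trans)
    qed
  qed
  have "(\<Sum>J\<in>F. ennreal ((side J * poisson_tail m \<sigma> (E J \<inter> far_set m e p J) J)\<^sup>2) * emeasure \<omega> (cube_set J))
      \<le> (\<Sum>J\<in>F. 2 * (\<integral>\<^sup>+y. (\<Sum>k. g J k * indicator (A J k) y) \<partial>\<sigma>))"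
    by (intro sum_mono step)
  also have "\<dots> = 2 * (\<integral>\<^sup>+y. (\<Sum>J\<in>F. \<Sum>k. g J k * indicator (A J k) y) \<partial>\<sigma>)"
    using As by (subst nn_integral_sum) (auto simp: sum_distrib_left)
  also have "\<dots> \<le> 2 * (\<integral>\<^sup>+y. ennreal K * muckenhoupt \<alpha> \<sigma> \<omega> * indicator (cube_set I) y \<partial>\<sigma>)"
    by (intro mult_left_mono nn_integral_mono point) simp
  also have "\<dots> = 2 * (ennreal K * muckenhoupt \<alpha> \<sigma> \<omega> * emeasure \<sigma> (cube_set I))"
    by (simp add: nn_integral_cmult_indicator locally_finite_sets[OF \<sigma>])
  also have "\<dots> = ennreal (far_constant TYPE('n) m) * muckenhoupt \<alpha> \<sigma> \<omega> * emeasure \<sigma> (cube_set I)"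
  proof -
    have "ennreal (far_constant TYPE('n) m) = 2 * ennreal K"
      using ennreal_mult[of 2 K] by (simp add: K_def far_constant_def)
    then show ?thesis by (simp add: mult.assoc)
  qed
  finally show ?thesis .
qed

lemma overlap_sum:
  fixes \<sigma> :: "(real ^ 'n::finite) measure"
  assumes \<sigma>: "locally_finite_borel \<sigma>" and F: "finite F" and b: "0 \<le> \<beta>"
    and sub: "\<And>J. J \<in> F \<Longrightarrow> cube_set (dilate \<gamma> J) \<subseteq> cube_set I"
    and overlap: "\<And>y. real (card {J \<in> F. y \<in> cube_set (dilate \<gamma> J)}) \<le> \<beta>"
  shows "(\<Sum>J\<in>F. emeasure \<sigma> (cube_set (dilate \<gamma> J))) \<le> ennreal \<beta> * emeasure \<sigma> (cube_set I)"
proof -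
  have "(\<Sum>J\<in>F. emeasure \<sigma> (cube_set (dilate \<gamma> J))) = (\<integral>\<^sup>+y. (\<Sum>J\<in>F. indicator (cube_set (dilate \<gamma> J)) y) \<partial>\<sigma>)"
    by (subst nn_integral_sum) (simp_all add: locally_finite_sets[OF \<sigma>] borel_measurable_indicator)
  also have "\<dots> \<le> (\<integral>\<^sup>+y. ennreal \<beta> * indicator (cube_set I) y \<partial>\<sigma>)"
  proof (rule nn_integral_mono)
    fix y
    have "(\<Sum>J\<in>F. indicator (cube_set (dilate \<gamma> J)) y) = (of_nat (card {J \<in> F. y \<in> cube_set (dilate \<gamma> J)}) :: ennreal)"
      using F by (simp add: indicator_def sum.If_cases Int_def)
    also have "\<dots> = ennreal (real (card {J \<in> F. y \<in> cube_set (dilate \<gamma> J)}))" by (simp add: ennreal_of_nat_eq_real_of_nat)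
    also have "\<dots> \<le> ennreal \<beta> * indicator (cube_set I) y"
    proof (cases "y \<in> cube_set I")
      case True
      then show ?thesis using overlap[of y] by (simp add: ennreal_leI)
    next
      case False
      then have "{J \<in> F. y \<in> cube_set (dilate \<gamma> J)} = {}" using sub by blast
      then show ?thesis by (simp only: card.empty) simp
    qed
    finally show "(\<Sum>J\<in>F. indicator (cube_set (dilate \<gamma> J)) y) \<le> ennreal \<beta> * indicator (cube_set I) y" .
  qed
  also have "\<dots> = ennreal \<beta> * emeasure \<sigma> (cube_set I)"
    by (simp add: nn_integral_cmult_indicator locally_finite_sets[OF \<sigma>])
  finally show ?thesis .
qed


section \<open>The energy condition\<close>

definition reversal_constant :: "'n::finite itself \<Rightarrow> real \<Rightarrow> real \<Rightarrow> real" where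
  "reversal_constant N m c = 1 / (c * reversal_gain N m)
    + (1 + reversal_loss N m / reversal_gain N m) * real CARD('n)
    + (1 + reversal_loss N m / reversal_gain N m + real CARD('n) / cone_aperture N m) * (comparison_ratio N powr (m + 1) / c)"

text \<open>
  The error term of the reversal inequality: \<open>b\<close> tells whether it is \<open>\<omega>\<close> that lies on the line, and only
  then there is an exceptional set.
\<close>

definition far_error ::
    "real \<Rightarrow> (real ^ 'n::finite) measure \<Rightarrow> bool \<Rightarrow> real ^ 'n \<Rightarrow> real ^ 'n \<Rightarrow> (real ^ 'n) set \<Rightarrow> 'n cube \<Rightarrow> real" where
  "far_error m \<sigma> b e p E J = (if b then side J * poisson_tail m \<sigma> (E \<inter> far_set m e p J) J else 0)"

text \<open>
  A line is closed, so its complement is measurable and, having measure zero, a null set.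
\<close>

lemma supported_on_lineD:
  fixes \<mu> :: "(real ^ 'n::finite) measure"
  assumes \<mu>: "locally_finite_borel \<mu>" and line: "supported_on_line \<mu>"
  obtains e a where "norm e = 1" "AE x in \<mu>. perp e (x - a) = 0"
proof -
  obtain a v where v: "v \<noteq> 0" and null: "emeasure \<mu> (- range (\<lambda>t. a + t *\<^sub>R v)) = 0"
    using line unfolding supported_on_line_def by blast
  define e where "e = v /\<^sub>R norm v"
  have e: "norm e = 1" using v by (simp add: e_def)
  have "range (\<lambda>t. a + t *\<^sub>R v) = (+) a ` span {v}"
    by (auto simp: span_singleton image_image)
  then have "closed (range (\<lambda>t. a + t *\<^sub>R v))"
    by (simp add: closed_translation closed_subspace)
  then have "- range (\<lambda>t. a + t *\<^sub>R v) \<in> null_sets \<mu>"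
    using null by (auto simp: null_sets_def locally_finite_sets[OF \<mu>])
  then have "AE x in \<mu>. x \<notin> - range (\<lambda>t. a + t *\<^sub>R v)" by (rule AE_not_in)
  then have "AE x in \<mu>. perp e (x - a) = 0"
  proof eventually_elim
    case (elim x)
    then obtain t where "x = a + t *\<^sub>R v" by auto
    then have "x - a = (t * norm v) *\<^sub>R e" using v by (simp add: e_def)
    then show ?case by (simp only: perp_multiple[OF e])
  qed
  with e show ?thesis by (rule that)
qed

lemma (in reversal_setup) local_reversal:
  assumes e: "norm e = 1"
    and case_omega: "b \<Longrightarrow> \<Lambda> = {x. perp e (x - a) = 0}"
    and case_sigma: "\<not> b \<Longrightarrow> AE y in \<sigma>. perp e (y - a) = 0"
    and x: "x \<in> cube_set J" "x \<in> \<Lambda>" and z: "z \<in> cube_set J" "z \<in> \<Lambda>"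
  defines "G \<equiv> truncated_integral c m \<delta> R \<sigma> (cube_set I)"
    and "H \<equiv> truncated_integral c m \<delta> R \<sigma> (cube_set (dilate \<gamma> J))"
  shows "tail shell * norm (x - z) \<le> reversal_constant N m c *
    (norm (G x) + norm (H x) + norm (G z) + norm (H z) + far_error m \<sigma> b e (perp e a) shell J)"
proof -
  let ?L = "reversal_gain N m" and ?Up = "reversal_loss N m" and ?\<eta> = "cone_aperture N m"
  define C1 C2 C3 where "C1 = 1 / (c * ?L)" and "C2 = (1 + ?Up / ?L) * real CARD('n)"
    and "C3 = (1 + ?Up / ?L + real CARD('n) / ?\<eta>) * (comparison_ratio N powr (m + 1) / c)"
  have L: "0 < ?\<eta>" "0 < ?L" "0 < ?Up" using reversal_constants_pos[OF m, where 'n = 'n] by auto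
  have C: "0 \<le> C1" "0 \<le> C2" "0 \<le> C3" using L c by (simp_all add: C1_def C2_def C3_def)
  have Ule: "norm (U v) \<le> norm (G v) + norm (H v)" for v
    unfolding G_def H_def truncated_integral_Diff[OF \<sigma> m d(1,4) c JI] by (rule norm_triangle_ineq4)
  let ?S = "norm (G x) + norm (H x) + norm (G z) + norm (H z)"
  let ?q = "far_error m \<sigma> b e (perp e a) shell J"
  have q0: "0 \<le> ?q" using J tail_nonneg by (simp add: far_error_def)
  have S0: "0 \<le> ?S" by simp
  have U: "C1 * (norm (U x) + norm (U z)) \<le> C1 * ?S"
    using Ule[of x] Ule[of z] C by (intro mult_left_mono) auto
  show ?thesis
  proof (cases b)
    case True
    have px: "perp e x = perp e a" "perp e z = perp e a" using case_omega[OF True] x z by (auto simp: perp_diff)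
    have "tail shell * norm (x - z) \<le> C1 * (norm (U x) + norm (U z)) + C2 * ?q"
      using reversal_on_line[OF e x(1) px(1) z(1) px(2)] True
      unfolding C1_def C2_def far_error_def far_set_def by simp
    also have "\<dots> \<le> C1 * ?S + C2 * ?q" using U by simp
    also have "\<dots> \<le> (C1 + C2 + C3) * (?S + ?q)"
    proof -
      have "(C1 + C2 + C3) * (?S + ?q) = C1 * ?S + C2 * ?q + (C1 * ?q + C2 * ?S + C3 * (?S + ?q))"
        by (simp add: algebra_simps)
      moreover have "0 \<le> C1 * ?q + C2 * ?S + C3 * (?S + ?q)" by (intro add_nonneg_nonneg mult_nonneg_nonneg C q0 norm_ge_zero)
      ultimately show ?thesis by linarith
    qed
    finally show ?thesis unfolding reversal_constant_def C1_def C2_def C3_def .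
  next
    case False
    have "tail shell * norm (x - z) \<le> C1 * (norm (U x) + norm (U z)) + C3 * (norm (G x) + norm (G z))"
      using reversal_from_line[OF e case_sigma[OF False] x(1) z(1)]
      unfolding C1_def C3_def G_def .
    also have "\<dots> \<le> C1 * ?S + C3 * ?S" by (rule add_mono[OF U mult_left_mono]) (use C in auto)
    also have "\<dots> \<le> (C1 + C2 + C3) * (?S + ?q)"
    proof -
      have "(C1 + C2 + C3) * (?S + ?q) = C1 * ?S + C3 * ?S + (C2 * ?S + (C1 + C2 + C3) * ?q)"
        by (simp add: algebra_simps)
      moreover have "0 \<le> C2 * ?S + (C1 + C2 + C3) * ?q" by (intro add_nonneg_nonneg mult_nonneg_nonneg C q0 norm_ge_zero)
      ultimately show ?thesis by linarith
    qed
    finally show ?thesis unfolding reversal_constant_def C1_def C2_def C3_def .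
  qed
qed

definition energy_constant :: "'n::finite itself \<Rightarrow> real \<Rightarrow> real \<Rightarrow> real \<Rightarrow> real" where
  "energy_constant N m c \<beta> = 10 * (reversal_constant N m c)\<^sup>2 * (1 + \<beta> + far_constant N m)"

lemma reversal_constant_pos:
  assumes "0 < m" "0 < c"
  shows "0 < reversal_constant TYPE('n::finite) m c"
proof -
  have L: "0 < cone_aperture TYPE('n) m" "0 < reversal_gain TYPE('n) m" "0 < reversal_loss TYPE('n) m"
    using reversal_constants_pos[OF assms(1), where 'n = 'n] by auto
  have "0 < 1 / (c * reversal_gain TYPE('n) m)" using assms L by simp
  moreover have "0 \<le> (1 + reversal_loss TYPE('n) m / reversal_gain TYPE('n) m) * real CARD('n)" using L by simp
  moreover have "0 \<le> (1 + reversal_loss TYPE('n) m / reversal_gain TYPE('n) m + real CARD('n) / cone_aperture TYPE('n) m) *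
      (comparison_ratio TYPE('n) powr (m + 1) / c)" using L assms by simp
  ultimately show ?thesis unfolding reversal_constant_def by linarith
qed

lemma far_constant_nonneg: "0 \<le> far_constant N m"
  by (simp add: far_constant_def)

text \<open>
  Summation of \<open>energy_term_le\<close> over finitely many cubes. The operator on \<open>I\<close> contributes the testing
  inequality for \<open>I\<close>, because the cubes are disjoint; the operators on the dilates contribute the testing
  inequalities for the dilates, which overlap boundedly; the far errors contribute \<open>far_energy_sum\<close>.
\<close>

lemma finite_energy_sum:
  fixes \<sigma> \<omega> :: "(real ^ 'n::finite) measure" and F :: "'n cube set"
  assumes \<sigma>: "locally_finite_borel \<sigma>" and \<omega>: "locally_finite_borel \<omega>"
    and a: "\<alpha> < real CARD('n)" and c: "0 < c" and g: "2 \<le> \<gamma>"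
    and line: "supported_on_line \<sigma> \<or> supported_on_line \<omega>"
    and D: "dyadic_grid D" and I: "0 < side I"
    and F: "finite F" "F \<subseteq> D" "disjoint_family_on cube_set F" "\<And>J. J \<in> F \<Longrightarrow> cube_set (dilate \<gamma> J) \<subseteq> cube_set I"
    and b0: "0 \<le> \<beta>" and overlap: "\<And>y. real (card {J \<in> F. y \<in> cube_set (dilate \<gamma> J)}) \<le> \<beta>"
  defines "m \<equiv> real CARD('n) - \<alpha>"
  shows "(\<Sum>J\<in>F. (poisson \<alpha> J (restrict_measure (cube_set I - cube_set (dilate \<gamma> J)) \<sigma>) / ennreal (side J))\<^sup>2
      * L2_norm_sq \<omega> (subgood_proj D r \<epsilon> \<omega> J (\<lambda>x. x)))
    \<le> ennreal (energy_constant TYPE('n) m c \<beta>) *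
      (muckenhoupt \<alpha> \<sigma> \<omega> + testing_sq (riesz_truncations c \<alpha>) \<sigma> \<omega>) * emeasure \<sigma> (cube_set I)"
proof -
  let ?n = "real CARD('n)"
  define Te where "Te = testing_sq (riesz_truncations c \<alpha>) \<sigma> \<omega>"
  define A2 where "A2 = muckenhoupt \<alpha> \<sigma> \<omega>"
  define sI where "sI = emeasure \<sigma> (cube_set I)"
  define C where "C = reversal_constant TYPE('n) m c"
  have m: "0 < m" using a by (simp add: m_def)
  have C: "0 < C" using reversal_constant_pos[OF m c, where 'n = 'n] by (simp add: C_def)
  define b where "b \<longleftrightarrow> supported_on_line \<omega>"
  obtain e p where e: "norm e = 1" and lo: "b \<Longrightarrow> AE x in \<omega>. perp e (x - p) = 0"
    and ls: "\<not> b \<Longrightarrow> AE x in \<sigma>. perp e (x - p) = 0"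
  proof (cases b)
    case True
    then show ?thesis using supported_on_lineD[OF \<omega>] that unfolding b_def by metis
  next
    case False
    then show ?thesis using supported_on_lineD[OF \<sigma>] that line unfolding b_def by metis
  qed
  \<comment> \<open>If \<open>\<omega>\<close> is on the line, the reversal inequality is needed only for points of the line.\<close>
  define \<Lambda> where "\<Lambda> = (if b then {x. perp e (x - p) = 0} else UNIV)"
  have AE\<Lambda>: "AE x in \<omega>. x \<in> \<Lambda>" using lo by (auto simp: \<Lambda>_def)
  have posF: "0 < side J" if "J \<in> F" for J using grid_side_pos[OF D] F(2) that by blast
  have JI: "cube_set J \<subseteq> cube_set I" if "J \<in> F" for J
    using cube_subset_dilate[of \<gamma> J] posF[OF that] F(4)[OF that] g by auto
  \<comment> \<open>The sum being finite, one truncation leaves the kernel unchanged at all distances between a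
    point of some \<open>J\<close> and a point of \<open>I\<close> outside the dilate of \<open>J\<close>.\<close>
  define \<delta> where "\<delta> = Min (insert (side I) (side ` F)) / 2"
  define R where "R = ?n * side I + side I"
  have n1: "1 \<le> ?n" by (rule card_ge_1)
  have \<delta>0: "0 < \<delta>" using F(1) posF I by (auto simp: \<delta>_def)
  have \<delta>J: "\<delta> \<le> side J / 2" if "J \<in> F" for J
    unfolding \<delta>_def using F(1) that by (intro divide_right_mono Min_le) auto
  have "\<delta> \<le> side I / 2" unfolding \<delta>_def using F(1) by (intro divide_right_mono Min_le) auto
  also have "\<dots> < R" using I n1 by (simp add: R_def add_pos_pos)
  finally have \<delta>R: "\<delta> < R" .
  have RI: "?n * side I \<le> R" using I by (simp add: R_def)
  define G where "G = truncated_integral c m \<delta> R \<sigma> (cube_set I)"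
  define H where "H = (\<lambda>J. truncated_integral c m \<delta> R \<sigma> (cube_set (dilate \<gamma> J)))"
  define q where "q = (\<lambda>J. far_error m \<sigma> b e (perp e p) (cube_set I - cube_set (dilate \<gamma> J)) J)"
  have meas [measurable]: "truncated_integral c m \<delta> R \<sigma> (cube_set Q) \<in> borel_measurable borel" for Q
    by (rule truncated_integral_measurable[OF \<sigma> m \<delta>0 \<delta>R c])
  have test: "(\<integral>\<^sup>+x\<in>cube_set Q. ennreal ((norm (truncated_integral c m \<delta> R \<sigma> (cube_set Q) x))\<^sup>2) \<partial>\<omega>) \<le> Te * emeasure \<sigma> (cube_set Q)"
    if "0 < side Q" for Q
    unfolding Te_def m_def by (rule testing_bound[OF \<sigma> a \<delta>0 \<delta>R c that])
  have q0: "0 \<le> q J" if "J \<in> F" for J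
    using posF[OF that] by (simp add: q_def far_error_def poisson_tail_nonneg)
  let ?g = "\<lambda>J. \<integral>\<^sup>+x\<in>cube_set J. ennreal ((norm (G x))\<^sup>2) \<partial>\<omega>"
  let ?h = "\<lambda>J. \<integral>\<^sup>+x\<in>cube_set J. ennreal ((norm (H J x))\<^sup>2) \<partial>\<omega>"
  let ?f = "\<lambda>J. ennreal ((q J)\<^sup>2) * emeasure \<omega> (cube_set J)"
  have tm: "(poisson \<alpha> J (restrict_measure (cube_set I - cube_set (dilate \<gamma> J)) \<sigma>) / ennreal (side J))\<^sup>2
      * L2_norm_sq \<omega> (subgood_proj D r \<epsilon> \<omega> J (\<lambda>x. x)) \<le> ennreal (10 * C\<^sup>2) * (?g J + ?h J + ?f J)" if JF: "J \<in> F" for J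
  proof -
    interpret reversal_setup \<sigma> m c \<delta> R \<gamma> I J
      by unfold_locales (use \<sigma> m c g \<delta>0 \<delta>J[OF JF] RI \<delta>R posF[OF JF] F(4)[OF JF] in auto)
    have JD: "J \<in> D" using JF F(2) by blast
    have "poisson \<alpha> J (restrict_measure shell \<sigma>) / ennreal (side J) = ennreal (tail shell)"
      unfolding m_def by (rule poisson_eq_tail[OF \<sigma> a posF[OF JF] shell_sets])
    moreover have "(ennreal (tail shell))\<^sup>2 * L2_norm_sq \<omega> (subgood_proj D r \<epsilon> \<omega> J (\<lambda>x. x))
        \<le> ennreal (10 * C\<^sup>2) * (?g J + ?h J + ?f J)"
    proof (rule energy_term_le[OF \<omega> _ _ AE\<Lambda> tail_nonneg _ q0[OF JF]])
      show "G \<in> borel_measurable borel" "H J \<in> borel_measurable borel" unfolding G_def H_def by (rule meas)+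
      show "0 \<le> C" using C by simp
      show "tail shell * norm (x - z) \<le> C * (norm (G x) + norm (H J x) + norm (G z) + norm (H J z) + q J)"
        if "x \<in> cube_set J" "z \<in> cube_set J" "x \<in> \<Lambda>" "z \<in> \<Lambda>" for x z
        unfolding C_def G_def H_def q_def
        by (rule local_reversal[OF e _ ls that(1,3,2,4)]) (simp_all add: \<Lambda>_def)
      show "L2_norm_sq \<omega> (subgood_proj D r \<epsilon> \<omega> J (\<lambda>x. x)) \<le> (\<integral>\<^sup>+x\<in>cube_set J. ennreal ((norm (x - z))\<^sup>2) \<partial>\<omega>)" for z
        by (rule subgood_energy_le[OF D \<omega> JD])
    qed
    ultimately show ?thesis by simp
  qed
  have sumg: "(\<Sum>J\<in>F. ?g J) \<le> Te * sI"
  proof -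
    have bm: "(\<lambda>x. ennreal ((norm (G x))\<^sup>2) * indicator (cube_set J) x) \<in> borel_measurable \<omega>" for J
      unfolding G_def measurable_cong_sets[OF locally_finite_sets[OF \<omega>] refl] by measurable
    have "(\<Sum>J\<in>F. ?g J) = (\<integral>\<^sup>+x. (\<Sum>J\<in>F. ennreal ((norm (G x))\<^sup>2) * indicator (cube_set J) x) \<partial>\<omega>)"
      by (intro nn_integral_sum[symmetric] bm)
    also have "\<dots> \<le> (\<integral>\<^sup>+x\<in>cube_set I. ennreal ((norm (G x))\<^sup>2) \<partial>\<omega>)"
    proof (rule nn_integral_mono)
      fix x
      have "(\<Sum>J\<in>F. indicator (cube_set J) x) = (indicator (\<Union>J\<in>F. cube_set J) x :: ennreal)"
        using F(1,3) by (intro indicator_UN_disjoint[symmetric])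
      also have "\<dots> \<le> indicator (cube_set I) x" using JI by (auto simp: indicator_def)
      finally have "ennreal ((norm (G x))\<^sup>2) * (\<Sum>J\<in>F. indicator (cube_set J) x) \<le> ennreal ((norm (G x))\<^sup>2) * indicator (cube_set I) x"
        by (rule mult_left_mono) simp
      then show "(\<Sum>J\<in>F. ennreal ((norm (G x))\<^sup>2) * indicator (cube_set J) x) \<le> ennreal ((norm (G x))\<^sup>2) * indicator (cube_set I) x"
        by (simp only: sum_distrib_left)
    qed
    also have "\<dots> \<le> Te * sI" unfolding G_def sI_def by (rule test[OF I])
    finally show ?thesis .
  qed
  have sumh: "(\<Sum>J\<in>F. ?h J) \<le> Te * (ennreal \<beta> * sI)"
  proof -
    have "(\<Sum>J\<in>F. ?h J) \<le> (\<Sum>J\<in>F. Te * emeasure \<sigma> (cube_set (dilate \<gamma> J)))"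
    proof (rule sum_mono)
      fix J assume J: "J \<in> F"
      have "?h J \<le> (\<integral>\<^sup>+x\<in>cube_set (dilate \<gamma> J). ennreal ((norm (H J x))\<^sup>2) \<partial>\<omega>)"
        using cube_subset_dilate[of \<gamma> J] posF[OF J] g
        by (intro nn_integral_mono mult_left_mono) (auto simp: indicator_def)
      also have "\<dots> \<le> Te * emeasure \<sigma> (cube_set (dilate \<gamma> J))"
        unfolding H_def using posF[OF J] g by (intro test) simp
      finally show "?h J \<le> Te * emeasure \<sigma> (cube_set (dilate \<gamma> J))" .
    qed
    also have "\<dots> = Te * (\<Sum>J\<in>F. emeasure \<sigma> (cube_set (dilate \<gamma> J)))" by (simp add: sum_distrib_left)
    also have "\<dots> \<le> Te * (ennreal \<beta> * sI)"
      unfolding sI_def by (intro mult_left_mono overlap_sum[OF \<sigma> F(1) b0 F(4) overlap]) auto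
    finally show ?thesis .
  qed
  have sumf: "(\<Sum>J\<in>F. ?f J) \<le> ennreal (far_constant TYPE('n) m) * A2 * sI"
  proof (cases b)
    case True
    have "(\<Sum>J\<in>F. ?f J) = (\<Sum>J\<in>F. ennreal ((side J * poisson_tail m \<sigma> ((cube_set I - cube_set (dilate \<gamma> J)) \<inter> far_set m e (perp e p) J) J)\<^sup>2)
        * emeasure \<omega> (cube_set J))"
      using True by (simp add: q_def far_error_def)
    also have "\<dots> \<le> ennreal (far_constant TYPE('n) m) * A2 * sI"
      unfolding m_def A2_def sI_def
    proof (rule far_energy_sum[OF \<sigma> \<omega> a e _ F(1) posF F(3)])
      show "AE x in \<omega>. perp e x = perp e p" using lo[OF True] by (simp add: perp_diff)
    qed auto
    finally show ?thesis .
  next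
    case False
    then show ?thesis by (simp add: q_def far_error_def)
  qed
  have "(\<Sum>J\<in>F. (poisson \<alpha> J (restrict_measure (cube_set I - cube_set (dilate \<gamma> J)) \<sigma>) / ennreal (side J))\<^sup>2
      * L2_norm_sq \<omega> (subgood_proj D r \<epsilon> \<omega> J (\<lambda>x. x))) \<le> (\<Sum>J\<in>F. ennreal (10 * C\<^sup>2) * (?g J + ?h J + ?f J))"
    by (intro sum_mono tm)
  also have "\<dots> = ennreal (10 * C\<^sup>2) * ((\<Sum>J\<in>F. ?g J) + (\<Sum>J\<in>F. ?h J) + (\<Sum>J\<in>F. ?f J))"
    by (simp only: sum_distrib_left sum.distrib distrib_left)
  also have "\<dots> \<le> ennreal (10 * C\<^sup>2) * (Te * sI + Te * (ennreal \<beta> * sI) + ennreal (far_constant TYPE('n) m) * A2 * sI)"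
    by (intro mult_left_mono add_mono sumg sumh sumf) simp
  also have "\<dots> \<le> ennreal (10 * C\<^sup>2) * ((1 + ennreal \<beta> + ennreal (far_constant TYPE('n) m)) * (A2 + Te) * sI)"
  proof (rule mult_left_mono)
    let ?k = "ennreal (far_constant TYPE('n) m)"
    have "(1 + ennreal \<beta> + ?k) * (A2 + Te) * sI =
        Te * sI + Te * (ennreal \<beta> * sI) + ?k * A2 * sI + (A2 * sI + ennreal \<beta> * A2 * sI + ?k * Te * sI)"
      by (simp add: distrib_left distrib_right mult_ac add_ac)
    then show "Te * sI + Te * (ennreal \<beta> * sI) + ?k * A2 * sI \<le> (1 + ennreal \<beta> + ?k) * (A2 + Te) * sI"
      by simp
  qed simp
  also have "\<dots> = ennreal (energy_constant TYPE('n) m c \<beta>) * (A2 + Te) * sI"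
  proof -
    have "1 + ennreal \<beta> + ennreal (far_constant TYPE('n) m) = ennreal (1 + \<beta> + far_constant TYPE('n) m)"
      using b0 far_constant_nonneg[of "TYPE('n)" m] by simp
    then have "ennreal (energy_constant TYPE('n) m c \<beta>) = ennreal (10 * C\<^sup>2) * (1 + ennreal \<beta> + ennreal (far_constant TYPE('n) m))"
      unfolding energy_constant_def C_def using b0 far_constant_nonneg[of "TYPE('n)" m] by (subst ennreal_mult) auto
    then show ?thesis by (simp add: mult.assoc)
  qed
  finally show ?thesis unfolding A2_def Te_def sI_def .
qed

text \<open>
  \<open>J\<close> is deeply embedded in the ancestor of \<open>K\<close> only, but it lies in a cube \<open>L\<close> deeply embedded in \<open>K\<close>, and the
  dilate of \<open>J\<close> is contained in that of \<open>L\<close>.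
\<close>

lemma M_deep_level_props:
  fixes D :: "'n::finite cube set"
  assumes D: "dyadic_grid D" and K: "K \<in> D" and g: "2 \<le> \<gamma>"
    and r: "admissible_depth TYPE('n) \<gamma> \<epsilon> r" and eps: "\<epsilon> < 1"
    and J: "J \<in> M_deep_level D r \<epsilon> l K"
  shows "J \<in> D" "J \<in> M_deep D r \<epsilon> ((dyadic_parent D ^^ l) K)" "cube_set (dilate \<gamma> J) \<subseteq> cube_set K"
    "cube_set J \<subseteq> cube_set K"
proof -
  show J1: "J \<in> M_deep D r \<epsilon> ((dyadic_parent D ^^ l) K)" using J by (simp add: M_deep_level_def)
  then show JD: "J \<in> D" by (simp add: M_deep_def maximal_cubes_def)
  obtain L where L: "L \<in> M_deep D r \<epsilon> K" "cube_set J \<subseteq> cube_set L" using J by (auto simp: M_deep_level_def)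
  have LD: "L \<in> D" "deeply_embedded r \<epsilon> L K" using L(1) by (simp_all add: M_deep_def maximal_cubes_def)
  have "cube_set (dilate \<gamma> J) \<subseteq> cube_set (dilate \<gamma> L)"
    using g by (intro dilate_mono[OF _ grid_side_pos[OF D JD] L(2)]) simp
  also have "\<dots> \<subseteq> cube_set K"
    by (rule dilate_deep_subset[OF r eps grid_side_pos[OF D LD(1)] LD(2)])
  finally show "cube_set (dilate \<gamma> J) \<subseteq> cube_set K" .
  then show "cube_set J \<subseteq> cube_set K" using cube_subset_dilate[of \<gamma> J] g grid_side_pos[OF D JD] by auto
qed

lemma overlap_bound_nonneg: "1 \<le> \<gamma> \<Longrightarrow> 0 \<le> overlap_bound N \<gamma> \<epsilon>"
  by (simp add: overlap_bound_def)

text \<open>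
  The cubes \<open>J\<close> belonging to different \<open>I'\<close> are disjoint because the \<open>I'\<close> are, and their dilates stay inside
  the respective \<open>I'\<close>. So at every point only the cubes of one \<open>I'\<close> overlap, all of them maximal deeply
  embedded cubes of one ancestor.
\<close>

lemma energy_sq_le:
  fixes \<sigma> \<omega> :: "(real ^ 'n::finite) measure"
  assumes \<sigma>: "locally_finite_borel \<sigma>" and \<omega>: "locally_finite_borel \<omega>"
    and a: "\<alpha> < real CARD('n)" and c: "0 < c" and g: "2 \<le> \<gamma>"
    and line: "supported_on_line \<sigma> \<or> supported_on_line \<omega>"
    and r: "admissible_depth TYPE('n) \<gamma> \<epsilon> r" and eps: "0 < \<epsilon>" "\<epsilon> < 1"
  shows "energy_sq r \<epsilon> \<gamma> \<alpha> \<sigma> \<omega>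
    \<le> ennreal (energy_constant TYPE('n) (real CARD('n) - \<alpha>) c (overlap_bound TYPE('n) \<gamma> \<epsilon>)) *
      (muckenhoupt \<alpha> \<sigma> \<omega> + testing_sq (riesz_truncations c \<alpha>) \<sigma> \<omega>)"
  unfolding energy_sq_def
proof (rule SUP_least, clarify)
  fix l and D :: "'n cube set" and Ia Ib \<I>
  assume D: "dyadic_grid D" and "(Ia, Ib) \<in> D" and dec: "dyadic_decomposition D (Ia, Ib) \<I>"
    and pos: "0 < emeasure \<sigma> (cube_set (Ia, Ib))"
  define I where "I = (Ia, Ib)"
  have I: "I \<in> D" using \<open>(Ia, Ib) \<in> D\<close> by (simp add: I_def)
  define \<beta> where "\<beta> = overlap_bound TYPE('n) \<gamma> \<epsilon>"
  define B where "B = ennreal (energy_constant TYPE('n) (real CARD('n) - \<alpha>) c \<beta>) *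
      (muckenhoupt \<alpha> \<sigma> \<omega> + testing_sq (riesz_truncations c \<alpha>) \<sigma> \<omega>)"
  define t where "t = (\<lambda>J. (poisson \<alpha> J (restrict_measure (cube_set I - cube_set (dilate \<gamma> J)) \<sigma>) / ennreal (side J))\<^sup>2
      * L2_norm_sq \<omega> (subgood_proj D r \<epsilon> \<omega> J (\<lambda>x. x)))"
  have \<I>D: "\<I> \<subseteq> D" and \<I>disj: "disjoint_family_on cube_set \<I>" and \<I>U: "(\<Union>J\<in>\<I>. cube_set J) = cube_set I"
    using dec by (auto simp: dyadic_decomposition_def I_def)
  have "(\<Sum>\<^sub>\<infinity>I'\<in>\<I>. \<Sum>\<^sub>\<infinity>J\<in>M_deep_level D r \<epsilon> l I'. t J) \<le> B * emeasure \<sigma> (cube_set I)"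
  proof (rule infsum_pairs_le)
    fix G assume G: "finite G" "G \<subseteq> Sigma \<I> (M_deep_level D r \<epsilon> l)"
    have props: "J \<in> D" "J \<in> M_deep D r \<epsilon> ((dyadic_parent D ^^ l) I')" "cube_set (dilate \<gamma> J) \<subseteq> cube_set I'"
      "cube_set J \<subseteq> cube_set I'" "I' \<in> \<I>" "I' \<in> D" "cube_set I' \<subseteq> cube_set I" if p: "(I', J) \<in> G" for I' J
    proof -
      show 1: "I' \<in> \<I>" using G p by auto
      then show 2: "I' \<in> D" using \<I>D by blast
      have J: "J \<in> M_deep_level D r \<epsilon> l I'" using G p by auto
      show "cube_set I' \<subseteq> cube_set I" using 1 \<I>U by blast
      show "J \<in> D" "J \<in> M_deep D r \<epsilon> ((dyadic_parent D ^^ l) I')" "cube_set (dilate \<gamma> J) \<subseteq> cube_set I'"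
        "cube_set J \<subseteq> cube_set I'"
        by (rule M_deep_level_props[OF D 2 g r eps(2) J])+
    qed
    have same: "I1 = I2" if "(I1, J1) \<in> G" "(I2, J2) \<in> G" "y \<in> cube_set I1" "y \<in> cube_set I2" for I1 I2 J1 J2 y
      using \<I>disj props(5)[OF that(1)] props(5)[OF that(2)] that(3,4) unfolding disjoint_family_on_def by blast
    have corner: "fst J \<in> cube_set J" if "(I', J) \<in> G" for I' J
      by (rule cube_corner_mem[OF grid_side_pos[OF D props(1)[OF that]]])
    have inj: "inj_on snd G"
    proof (rule inj_onI)
      fix u v assume u: "u \<in> G" and v: "v \<in> G" and uv: "snd u = snd v"
      obtain I1 J I2 where eq: "u = (I1, J)" "v = (I2, J)" using uv by (cases u, cases v) auto
      have "fst J \<in> cube_set I1" "fst J \<in> cube_set I2"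
        using corner[of I1 J] props(4)[of I1 J] props(4)[of I2 J] u v eq by auto
      then have "I1 = I2" using same[of I1 J I2 J] u v eq by blast
      then show "u = v" using eq by simp
    qed
    define F where "F = snd ` G"
    have Fmem: "\<exists>I'. (I', J) \<in> G" if "J \<in> F" for J using that unfolding F_def by (metis imageE surjective_pairing)
    have "(\<Sum>(I', J)\<in>G. t J) = (\<Sum>J\<in>F. t J)"
      unfolding F_def by (subst sum.reindex[OF inj]) (simp add: case_prod_unfold)
    also have "\<dots> \<le> ennreal (energy_constant TYPE('n) (real CARD('n) - \<alpha>) c \<beta>) *
      (muckenhoupt \<alpha> \<sigma> \<omega> + testing_sq (riesz_truncations c \<alpha>) \<sigma> \<omega>) * emeasure \<sigma> (cube_set I)"
      unfolding t_def
    proof (rule finite_energy_sum[OF \<sigma> \<omega> a c g line D grid_side_pos[OF D I]])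
      show "finite F" using G by (simp add: F_def)
      show "F \<subseteq> D" using Fmem props(1) by blast
      show "cube_set (dilate \<gamma> J) \<subseteq> cube_set I" if "J \<in> F" for J
        using Fmem[OF that] props(3,7) by (meson order_trans)
      show "0 \<le> \<beta>" using g by (simp add: \<beta>_def overlap_bound_nonneg)
      show "disjoint_family_on cube_set F"
        unfolding disjoint_family_on_def
      proof (intro ballI impI)
        fix J1 J2 assume J: "J1 \<in> F" "J2 \<in> F" "J1 \<noteq> J2"
        obtain I1 I2 where p: "(I1, J1) \<in> G" "(I2, J2) \<in> G" using Fmem J by metis
        show "cube_set J1 \<inter> cube_set J2 = {}"
        proof (rule ccontr)
          assume "cube_set J1 \<inter> cube_set J2 \<noteq> {}"
          then obtain y where y: "y \<in> cube_set J1" "y \<in> cube_set J2" by blast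
          then have "I1 = I2" using same[OF p] props(4)[OF p(1)] props(4)[OF p(2)] by blast
          then have "cube_set J1 \<inter> cube_set J2 = {}"
            using props(2)[OF p(1)] props(2)[OF p(2)] J(3) unfolding M_deep_def
            by (intro maximal_cubes_disjoint[OF D]) auto
          then show False using y by blast
        qed
      qed
      show "real (card {J \<in> F. y \<in> cube_set (dilate \<gamma> J)}) \<le> \<beta>" for y
      proof (cases "{J \<in> F. y \<in> cube_set (dilate \<gamma> J)} = {}")
        case True
        then have "card {J \<in> F. y \<in> cube_set (dilate \<gamma> J)} = 0" by (simp only: card.empty)
        then show ?thesis using g by (simp add: \<beta>_def overlap_bound_nonneg)
      next
        case False
        then obtain J0 I0 where J0: "(I0, J0) \<in> G" "y \<in> cube_set (dilate \<gamma> J0)" using Fmem by blast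
        show ?thesis
          unfolding \<beta>_def
        proof (rule M_deep_overlap[OF D dyadic_ancestor_mem[OF D props(6)[OF J0(1)]] _ r eps])
          show "finite {J \<in> F. y \<in> cube_set (dilate \<gamma> J)}" using G by (simp add: F_def)
          show "{J \<in> F. y \<in> cube_set (dilate \<gamma> J)} \<subseteq> M_deep D r \<epsilon> ((dyadic_parent D ^^ l) I0)"
          proof
            fix J assume J: "J \<in> {J \<in> F. y \<in> cube_set (dilate \<gamma> J)}"
            then obtain I' where I': "(I', J) \<in> G" using Fmem by blast
            have "I' = I0" using same[OF I' J0(1)] props(3)[OF I'] props(3)[OF J0(1)] J J0(2) by blast
            then show "J \<in> M_deep D r \<epsilon> ((dyadic_parent D ^^ l) I0)" using props(2)[OF I'] by simp
          qed
        qed (use g in auto)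
      qed
    qed
    finally show "(\<Sum>(I', J)\<in>G. t J) \<le> B * emeasure \<sigma> (cube_set I)" unfolding B_def .
  qed
  then have "(\<Sum>\<^sub>\<infinity>I'\<in>\<I>. \<Sum>\<^sub>\<infinity>J\<in>M_deep_level D r \<epsilon> l I'. t J) / emeasure \<sigma> (cube_set I) \<le> B"
    using pos by (intro divide_le_posI_ennreal) (simp_all add: I_def mult.commute)
  then show "(\<Sum>\<^sub>\<infinity>I'\<in>\<I>. \<Sum>\<^sub>\<infinity>J\<in>M_deep_level D r \<epsilon> l I'.
        (poisson \<alpha> J (restrict_measure (cube_set (Ia, Ib) - cube_set (dilate \<gamma> J)) \<sigma>) / ennreal (side J))\<^sup>2 *
        L2_norm_sq \<omega> (subgood_proj D r \<epsilon> \<omega> J (\<lambda>x. x))) / emeasure \<sigma> (cube_set (Ia, Ib))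
    \<le> ennreal (energy_constant TYPE('n) (real CARD('n) - \<alpha>) c (overlap_bound TYPE('n) \<gamma> \<epsilon>)) *
      (muckenhoupt \<alpha> \<sigma> \<omega> + testing_sq (riesz_truncations c \<alpha>) \<sigma> \<omega>)"
    unfolding t_def B_def I_def \<beta>_def .
qed

lemma ennsqrt_le:
  assumes le: "x \<le> ennreal C * (a + b)" and C: "0 < C"
  shows "ennsqrt x \<le> ennreal (sqrt C) * (ennsqrt a + ennsqrt b)"
proof (cases "a = \<infinity> \<or> b = \<infinity>")
  case True
  then have "ennsqrt a + ennsqrt b = top" by (auto simp: ennsqrt_def)
  moreover have "ennreal (sqrt C) * top = top" using C by (simp add: ennreal_mult_top)
  ultimately show ?thesis by (simp only: top_greatest)
next
  case False
  then obtain a' b' where ab: "a = ennreal a'" "b = ennreal b'" "0 \<le> a'" "0 \<le> b'"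
    by (cases a; cases b) auto
  have le': "x \<le> ennreal (C * (a' + b'))" using le ab C by (simp add: ennreal_mult flip: ennreal_plus)
  then obtain x' where x: "x = ennreal x'" "0 \<le> x'" by (cases x) (auto simp: top_unique)
  have "x' \<le> C * (a' + b')" using le' x ab C by (simp add: ennreal_le_iff)
  then have "sqrt x' \<le> sqrt C * sqrt (a' + b')" by (simp add: real_sqrt_mult[symmetric])
  also have "\<dots> \<le> sqrt C * (sqrt a' + sqrt b')"
    using C ab by (intro mult_left_mono sqrt_add_le_add_sqrt) auto
  finally have "ennreal (sqrt x') \<le> ennreal (sqrt C * (sqrt a' + sqrt b'))" by (rule ennreal_leI)
  then show ?thesis using x ab C by (simp add: ennsqrt_def ennreal_mult)
qed

theorem theorem2:
  fixes \<alpha> \<gamma> \<epsilon> c :: real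
  assumes "0 \<le> \<alpha>" and "\<alpha> < real CARD('n::finite)"
    and "2 \<le> \<gamma>" and "0 < \<epsilon>" and "\<epsilon> < 1" and "0 < c"
  shows "\<exists>r0::nat. \<forall>r\<ge>r0. \<exists>C::real. 0 < C \<and>
    (\<forall>(\<sigma> :: (real ^ 'n) measure) (\<omega> :: (real ^ 'n) measure).
      locally_finite_borel \<sigma> \<and> locally_finite_borel \<omega> \<and> no_common_point_masses \<sigma> \<omega> \<and>
      (supported_on_line \<sigma> \<or> supported_on_line \<omega>) \<longrightarrow>
        energy r \<epsilon> \<gamma> \<alpha> \<sigma> \<omega>
          \<le> ennreal C * (ennsqrt (muckenhoupt \<alpha> \<sigma> \<omega>) + riesz_testing c \<alpha> \<sigma> \<omega>) \<and>
        energy_dual r \<epsilon> \<gamma> \<alpha> \<sigma> \<omega>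
          \<le> ennreal C * (ennsqrt (muckenhoupt_dual \<alpha> \<sigma> \<omega>) + riesz_testing_dual c \<alpha> \<sigma> \<omega>))"
proof -
  obtain r0 where r0: "\<And>r. r0 \<le> r \<Longrightarrow> admissible_depth TYPE('n) \<gamma> \<epsilon> r"
    using admissible_depth_eventually[OF assms(5)] by blast
  define K where "K = energy_constant TYPE('n) (real CARD('n) - \<alpha>) c (overlap_bound TYPE('n) \<gamma> \<epsilon>)"
  have K: "0 < K"
  proof -
    have "0 < (reversal_constant TYPE('n) (real CARD('n) - \<alpha>) c)\<^sup>2"
      using reversal_constant_pos[of "real CARD('n) - \<alpha>" c, where 'n = 'n] assms by simp
    moreover have "0 < 1 + overlap_bound TYPE('n) \<gamma> \<epsilon> + far_constant TYPE('n) (real CARD('n) - \<alpha>)"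
      using overlap_bound_nonneg[of \<gamma> "TYPE('n)" \<epsilon>] far_constant_nonneg[of "TYPE('n)" "real CARD('n) - \<alpha>"] assms by linarith
    ultimately show ?thesis by (simp add: K_def energy_constant_def)
  qed
  have main: "energy r \<epsilon> \<gamma> \<alpha> \<sigma> \<omega> \<le> ennreal (sqrt K) * (ennsqrt (muckenhoupt \<alpha> \<sigma> \<omega>) + riesz_testing c \<alpha> \<sigma> \<omega>)"
    if "r0 \<le> r" "locally_finite_borel \<sigma>" "locally_finite_borel \<omega>" "supported_on_line \<sigma> \<or> supported_on_line \<omega>"
    for r and \<sigma> \<omega> :: "(real ^ 'n) measure"
    unfolding energy_def riesz_testing_def
    using energy_sq_le[OF that(2,3) assms(2,6,3) that(4) r0[OF that(1)] assms(4,5)] K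
    by (intro ennsqrt_le) (simp_all add: K_def)
  show ?thesis
  proof (rule exI[of _ r0], intro allI impI exI[of _ "sqrt K"] conjI)
    show "0 < sqrt K" using K by simp
  next
    fix r and \<sigma> \<omega> :: "(real ^ 'n) measure"
    assume r: "r0 \<le> r" and "locally_finite_borel \<sigma> \<and> locally_finite_borel \<omega> \<and> no_common_point_masses \<sigma> \<omega> \<and>
      (supported_on_line \<sigma> \<or> supported_on_line \<omega>)"
    then have l: "locally_finite_borel \<sigma>" "locally_finite_borel \<omega>" "supported_on_line \<sigma> \<or> supported_on_line \<omega>" by auto
    show "energy r \<epsilon> \<gamma> \<alpha> \<sigma> \<omega> \<le> ennreal (sqrt K) * (ennsqrt (muckenhoupt \<alpha> \<sigma> \<omega>) + riesz_testing c \<alpha> \<sigma> \<omega>)"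
      by (rule main[OF r l])
    have "riesz_testing_dual c \<alpha> \<sigma> \<omega> = riesz_testing c \<alpha> \<omega> \<sigma>"
      by (simp add: riesz_testing_dual_def riesz_testing_def testing_sq_transpose)
    then show "energy_dual r \<epsilon> \<gamma> \<alpha> \<sigma> \<omega> \<le> ennreal (sqrt K) * (ennsqrt (muckenhoupt_dual \<alpha> \<sigma> \<omega>) + riesz_testing_dual c \<alpha> \<sigma> \<omega>)"
      using main[OF r l(2,1)] l(3) by (auto simp: energy_dual_def muckenhoupt_dual_def)
  qed
qed

end
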